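(* Let $n\geq 3$ be a natural number, $(R,\Lambda)$ a form ring with $R$ commutative, and $\sigma\in U_{2n}(R,\Lambda)$. Let $i,j,k,l\in\Omega$ with $k\neq\pm l$ and $i\neq\pm j$. Then (i) $T_{kl}(\sigma_{ij})$ is a product of $160$ elementary unitary $\sigma$-conjugates, (ii) $T_{kl}(\sigma_{i,-i})$ is a product of $320$ elementary unitary $\sigma$-conjugates, (iii) $T_{kl}(\sigma_{ii}-\sigma_{jj})$ is a product of $480$ elementary unitary $\sigma$-conjugates, (iv) $T_{kl}(\sigma_{ii}-\sigma_{-i,-i})$ is a product of $960$ elementary unitary $\sigma$-conjugates, and (v) $T_{k,-k}(\lambda^{-(\epsilon(k)+1)/2}|\sigma_{*j}|)$ is a product of $1600n+4004$ elementary unitary $\sigma$-conjugates.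
   Context: Rings are associative with $1\neq 0$. Form rings: let $R$ be a ring with an involution $x\mapsto\bar x$, i.e. $\overline{x+y}=\bar x+\bar y$, $\overline{xy}=\bar y\bar x$, $\bar{\bar x}=x$. Let $\lambda\in \mathrm{center}(R)$ with $\lambda\bar\lambda=1$, and put $\Lambda_{min}:=\{x-\lambda\bar x\mid x\in R\}$ and $\Lambda_{max}:=\{x\in R\mid x=-\lambda\bar x\}$. A form parameter for $R$ is an additive subgroup $\Lambda$ of $R$ with $\Lambda_{min}\subseteq\Lambda\subseteq\Lambda_{max}$ and $x\Lambda\bar x\subseteq\Lambda$ for all $x\in R$. The pair $(R,\Lambda)$ is then called a form ring (the involution and $\lambda$ being part of the data). Unitary group: let $\Omega_+:=\{1,\dots,n\}$, $\Omega_-:=\{-n,\dots,-1\}$, $\Omega:=\Omega_+\cup\Omega_-$, and $\epsilon(i):=1$ if $i\in\Omega_+$, $\epsilon(i):=-1$ if $i\in\Omega_-$. Rows and columns of $2n\times2n$ matrices and coordinates of columns in $V:=R^{2n}$ are indexed by $\Omega$ in the order $1,\dots,n,-n,\dots,-1$ (so for $-n\leq i\leq-1$ the index $i$ refers to position $2n+1+i$). Let $p\in M_n(R)$ be the matrix with ones on the skew diagonal and zeros elsewhere. For $v,w\in V$ put $f(v,w):=\bar v^t\begin{pmatrix}0&p\\0&0\end{pmatrix}w$, $h(v,w):=\bar v^t\begin{pmatrix}0&p\\\lambda p&0\end{pmatrix}w$ (where $\bar v$ is obtained by applying the involution to each entry) and $q(v):=f(v,v)+\Lambda\in R/\Lambda$.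 The value of $v$ is $|v|:=f(v,v)$. The hyperbolic unitary group is $U_{2n}(R,\Lambda):=\{\sigma\in GL_{2n}(R)\mid h(\sigma u,\sigma v)=h(u,v)\text{ and }q(\sigma v)=q(v)\ \forall u,v\in V\}$. The entry of $\sigma$ at position $(i,j)$ is $\sigma_{ij}$ and its $j$-th column is $\sigma_{*j}$; for $\sigma\in U_{2n}(R,\Lambda)$ one has $|\sigma_{*j}|\in\Lambda$ for all $j\in\Omega$. Elementary transvections: let $e$ be the identity matrix and $e^{ij}$ ($i,j\in\Omega$) the matrix with $1$ at position $(i,j)$ and zeros elsewhere. For $i,j\in\Omega$ with $i\neq\pm j$ and $x\in R$, put $T_{ij}(x):=e+xe^{ij}-\lambda^{(\epsilon(j)-\epsilon(i))/2}\bar x e^{-j,-i}\in U_{2n}(R,\Lambda)$ (short root). For $i\in\Omega$ and $y\in\lambda^{-(\epsilon(i)+1)/2}\Lambda$, put $T_{i,-i}(y):=e+ye^{i,-i}\in U_{2n}(R,\Lambda)$ (long root). $EU_{2n}(R,\Lambda)$ is the subgroup of $U_{2n}(R,\Lambda)$ generated by all short and long root elementary transvections. For group elements $g,h$ put ${}^hg:=hgh^{-1}$. An elementary unitary $\sigma$-conjugate is a matrix of the form ${}^{\varepsilon}\sigma$ or ${}^{\varepsilon}(\sigma^{-1})$ with $\varepsilon\in EU_{2n}(R,\Lambda)$ (different factors of a product may use different $\varepsilon$ and different signs). *)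

theory Defs
  imports "Jordan_Normal_Form.Matrix" "HOL-Algebra.Generated_Groups"
begin

definition Lam_min :: "('a::ring_1 \<Rightarrow> 'a) \<Rightarrow> 'a \<Rightarrow> 'a set" where
  "Lam_min bar lam = {x - lam * bar x | x. True}"

definition Lam_max :: "('a::ring_1 \<Rightarrow> 'a) \<Rightarrow> 'a \<Rightarrow> 'a set" where
  "Lam_max bar lam = {x. x = - (lam * bar x)}"

locale form_ring =
  fixes bar :: "'a::ring_1 \<Rightarrow> 'a" and lam :: 'a and Lam :: "'a set"
  assumes bar_add: "bar (x + y) = bar x + bar y"
    and bar_mult: "bar (x * y) = bar y * bar x"
    and bar_bar: "bar (bar x) = x"
    and lam_central: "lam * x = x * lam"
    and lam_unit: "lam * bar lam = 1"
    and zero_Lam: "0 \<in> Lam"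
    and add_Lam: "x \<in> Lam \<Longrightarrow> y \<in> Lam \<Longrightarrow> x + y \<in> Lam"
    and uminus_Lam: "x \<in> Lam \<Longrightarrow> - x \<in> Lam"
    and Lam_min_le: "Lam_min bar lam \<subseteq> Lam"
    and Lam_le_max: "Lam \<subseteq> Lam_max bar lam"
    and conj_Lam: "y \<in> Lam \<Longrightarrow> x * y * bar x \<in> Lam"

definition Omega_plus :: "nat \<Rightarrow> int set" where
  "Omega_plus n = {1..int n}"

definition Omega_minus :: "nat \<Rightarrow> int set" where
  "Omega_minus n = {- int n..-1}"

definition Omega :: "nat \<Rightarrow> int set" where
  "Omega n = Omega_plus n \<union> Omega_minus n"

definition eps :: "nat \<Rightarrow> int \<Rightarrow> int" where
  "eps n i = (if i \<in> Omega_plus n then 1 else - 1)"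

text \<open>Matrices and vectors are indexed by \<open>0, \<dots>, 2n - 1\<close>; the position of an index
  in \<open>Omega n\<close> refers to the order \<open>1, \<dots>, n, -n, \<dots>, -1\<close>.\<close>

definition pos :: "nat \<Rightarrow> int \<Rightarrow> nat" where
  "pos n i = (if i > 0 then nat (i - 1) else nat (2 * int n + i))"

definition entry :: "nat \<Rightarrow> 'a mat \<Rightarrow> int \<Rightarrow> int \<Rightarrow> 'a" where
  "entry n \<sigma> i j = \<sigma> $$ (pos n i, pos n j)"

definition column :: "nat \<Rightarrow> 'a mat \<Rightarrow> int \<Rightarrow> 'a vec" where
  "column n \<sigma> j = col \<sigma> (pos n j)"

definition skew_id :: "nat \<Rightarrow> 'a::ring_1 mat" where
  "skew_id n = mat n n (\<lambda>(i, j). if i + j + 1 = n then 1 else 0)"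

definition f_form :: "('a::ring_1 \<Rightarrow> 'a) \<Rightarrow> nat \<Rightarrow> 'a vec \<Rightarrow> 'a vec \<Rightarrow> 'a" where
  "f_form bar n v w =
     map_vec bar v \<bullet> (four_block_mat (0\<^sub>m n n) (skew_id n) (0\<^sub>m n n) (0\<^sub>m n n) *\<^sub>v w)"

definition h_form :: "('a::ring_1 \<Rightarrow> 'a) \<Rightarrow> 'a \<Rightarrow> nat \<Rightarrow> 'a vec \<Rightarrow> 'a vec \<Rightarrow> 'a" where
  "h_form bar lam n v w =
     map_vec bar v \<bullet>
       (four_block_mat (0\<^sub>m n n) (skew_id n) (lam \<cdot>\<^sub>m skew_id n) (0\<^sub>m n n) *\<^sub>v w)"

definition vec_value :: "('a::ring_1 \<Rightarrow> 'a) \<Rightarrow> nat \<Rightarrow> 'a vec \<Rightarrow> 'a" where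
  "vec_value bar n v = f_form bar n v v"

text \<open>An element of \<open>R/\<Lambda>\<close> is represented as a coset, i.e. as a subset of \<open>R\<close>.\<close>

definition q_form :: "('a::ring_1 \<Rightarrow> 'a) \<Rightarrow> 'a set \<Rightarrow> nat \<Rightarrow> 'a vec \<Rightarrow> 'a set" where
  "q_form bar Lam n v = (\<lambda>x. f_form bar n v v + x) ` Lam"

definition GL :: "nat \<Rightarrow> 'a::ring_1 mat monoid" where
  "GL m = units_of (ring_mat TYPE('a) m ())"

definition U :: "('a::ring_1 \<Rightarrow> 'a) \<Rightarrow> 'a \<Rightarrow> 'a set \<Rightarrow> nat \<Rightarrow> 'a mat set" where
  "U bar lam Lam n = {\<sigma> \<in> carrier (GL (2 * n)).
     \<forall>u \<in> carrier_vec (2 * n). \<forall>v \<in> carrier_vec (2 * n).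
       h_form bar lam n (\<sigma> *\<^sub>v u) (\<sigma> *\<^sub>v v) = h_form bar lam n u v \<and>
       q_form bar Lam n (\<sigma> *\<^sub>v v) = q_form bar Lam n v}"

definition mat_unit :: "nat \<Rightarrow> int \<Rightarrow> int \<Rightarrow> 'a::ring_1 mat" where
  "mat_unit n i j =
     mat (2 * n) (2 * n) (\<lambda>(r, c). if r = pos n i \<and> c = pos n j then 1 else 0)"

text \<open>Integer powers of \<open>\<lambda>\<close>; since \<open>\<lambda>\<close> is central with \<open>lam * bar lam = 1\<close>, its inverse is \<open>bar lam\<close>.\<close>

definition lam_pow :: "('a::ring_1 \<Rightarrow> 'a) \<Rightarrow> 'a \<Rightarrow> int \<Rightarrow> 'a" where
  "lam_pow bar lam k = (if k \<ge> 0 then lam ^ nat k else bar lam ^ nat (- k))"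

text \<open>The divisions by 2 below are exact, as \<open>eps\<close> only takes the values 1 and -1.\<close>

definition T_short :: "('a::ring_1 \<Rightarrow> 'a) \<Rightarrow> 'a \<Rightarrow> nat \<Rightarrow> int \<Rightarrow> int \<Rightarrow> 'a \<Rightarrow> 'a mat" where
  "T_short bar lam n i j x =
     1\<^sub>m (2 * n) + x \<cdot>\<^sub>m mat_unit n i j
       - (lam_pow bar lam ((eps n j - eps n i) div 2) * bar x) \<cdot>\<^sub>m mat_unit n (- j) (- i)"

definition T_long :: "nat \<Rightarrow> int \<Rightarrow> 'a::ring_1 \<Rightarrow> 'a mat" where
  "T_long n i y = 1\<^sub>m (2 * n) + y \<cdot>\<^sub>m mat_unit n i (- i)"

definition elem_transvections ::
    "('a::ring_1 \<Rightarrow> 'a) \<Rightarrow> 'a \<Rightarrow> 'a set \<Rightarrow> nat \<Rightarrow> 'a mat set" where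
  "elem_transvections bar lam Lam n =
     {T_short bar lam n i j x | i j x. i \<in> Omega n \<and> j \<in> Omega n \<and> i \<noteq> j \<and> i \<noteq> - j} \<union>
     {T_long n i y | i y. i \<in> Omega n \<and>
        y \<in> (\<lambda>z. lam_pow bar lam (- ((eps n i + 1) div 2)) * z) ` Lam}"

definition EU :: "('a::ring_1 \<Rightarrow> 'a) \<Rightarrow> 'a \<Rightarrow> 'a set \<Rightarrow> nat \<Rightarrow> 'a mat set" where
  "EU bar lam Lam n = generate (GL (2 * n)) (elem_transvections bar lam Lam n)"

definition conjugate_by :: "('g, 'b) monoid_scheme \<Rightarrow> 'g \<Rightarrow> 'g \<Rightarrow> 'g" where
  "conjugate_by G h g = h \<otimes>\<^bsub>G\<^esub> g \<otimes>\<^bsub>G\<^esub> inv\<^bsub>G\<^esub> h"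

definition elem_conjugates ::
    "('a::ring_1 \<Rightarrow> 'a) \<Rightarrow> 'a \<Rightarrow> 'a set \<Rightarrow> nat \<Rightarrow> 'a mat \<Rightarrow> 'a mat set" where
  "elem_conjugates bar lam Lam n \<sigma> =
     {conjugate_by (GL (2 * n)) \<epsilon> \<sigma> | \<epsilon>. \<epsilon> \<in> EU bar lam Lam n} \<union>
     {conjugate_by (GL (2 * n)) \<epsilon> (inv\<^bsub>GL (2 * n)\<^esub> \<sigma>) | \<epsilon>. \<epsilon> \<in> EU bar lam Lam n}"

definition is_product_of :: "('g, 'b) monoid_scheme \<Rightarrow> 'g set \<Rightarrow> nat \<Rightarrow> 'g \<Rightarrow> bool" where
  "is_product_of G S N g \<longleftrightarrow>
     (\<exists>xs. length xs = N \<and> set xs \<subseteq> S \<and> g = foldr (\<lambda>x y. x \<otimes>\<^bsub>G\<^esub> y) xs \<one>\<^bsub>G\<^esub>)"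

abbreviation product_of_conjugates ::
    "('a::ring_1 \<Rightarrow> 'a) \<Rightarrow> 'a \<Rightarrow> 'a set \<Rightarrow> nat \<Rightarrow> 'a mat \<Rightarrow> nat \<Rightarrow> 'a mat \<Rightarrow> bool" where
  "product_of_conjugates bar lam Lam n \<sigma> N g \<equiv>
     is_product_of (GL (2 * n)) (elem_conjugates bar lam Lam n \<sigma>) N g"

end

theory Submission
  imports Defs "HOL-Library.Function_Algebras"
begin

text \<open>Let \<open>c = \<sigma> e\<^sub>m\<close> be a column of \<open>\<sigma>\<close>.  Koszul relations between two pairs of entries of \<open>c\<close> give an
  elementary \<open>\<tau>\<close> fixing \<open>c\<close>, so that \<open>\<sigma>\<^sup>-\<^sup>1 \<tau> \<sigma>\<close> fixes \<open>e\<^sub>m\<close> and normalises the unipotent radical of its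
  stabiliser.  Commutators with root elements of that radical produce root elements whose parameters are products
  \<open>c\<^sub>i bar c\<^sub>j\<close>.  Conjugating a root element by \<open>\<sigma>\<close>, with an entry \<open>z\<close> of \<open>c\<close> as parameter, gives a matrix with a column
  that is, modulo such products, \<open>1\<close> on the diagonal and a unit multiple of \<open>bar z\<close> at another place; the first step
  applied to this matrix yields \<open>z\<close> itself, and conjugation by root elements then yields differences of diagonal entries.

  For the value \<open>|\<sigma> e\<^sub>j|\<close> take \<open>\<tau>\<close> fixing \<open>\<sigma>\<^sup>-\<^sup>1 e\<^sub>m\<close> with parameters close to units.  The element of the radical
  of \<open>e\<^sub>m\<close> obtained by conjugating a root element has a vector which is a multiple of \<open>\<sigma> e\<^sub>j\<close> up to terms already treated,
  and removing its short root factors leaves the long root element with parameter \<open>\<theta> bar \<theta> |\<sigma> e\<^sub>j|\<close>, where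
  \<open>\<theta>\<close> is \<open>1\<close> up to terms already treated.\<close>


text \<open>Every commutator with an elementary matrix doubles the number of conjugates, and the
  constants record how many are taken. The obstacle is a long root factor whose parameter depends on
  the inverse of \<sigma>. It is never computed: a further commutator with an elementary matrix
  fixing \<open>ev m\<close> removes it, and this turns 8 into 16. If one of the two entries of the
  column is diagonal, an additional term appears and one more commutator is needed, whence 32. A
  single off-diagonal entry then costs 160 = 2 * 32 + 4 * 16 + 32, and 320, 480 and 960 are two,
  three and six times that. For the value of a column the cost depends on n, because the multiplier
  \<theta> is compared with 1 by way of the relation between two columns of \<sigma>, which has 2 n
  terms. The argument gives 1440 n + 4404; since the counts are exact, this is filled up by pairs of
  \<sigma> and its inverse.\<close>

locale commutative_form_ring = form_ring bar lam Lam
  for bar :: "'a::comm_ring_1 \<Rightarrow> 'a" and lam :: 'a and Lam :: "'a set" +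
  fixes n :: nat
  assumes three_le: "n \<ge> 3"
begin

section \<open>Scalars, signs and indices\<close>

abbreviation Om :: "int set" where "Om \<equiv> Omega n"

lemma bar_0 [simp]: "bar 0 = 0"
  using bar_add[of 0 0] by simp

lemma bar_1 [simp]: "bar 1 = 1"
  using bar_mult[of 1 "bar 1"] bar_bar[of 1] by simp

lemma bar_mult' [simp]: "bar (x * y) = bar x * bar y"
  by (simp add: bar_mult mult.commute)

lemma bar_uminus [simp]: "bar (- x) = - bar x"
  using bar_add[of x "- x"] by (simp add: eq_neg_iff_add_eq_0 add.commute)

lemma bar_diff [simp]: "bar (x - y) = bar x - bar y"
  using bar_add[of x "- y"] by simp

lemma bar_power [simp]: "bar (x ^ k) = bar x ^ k"
  by (induction k) simp_all

lemma bar_sum [simp]: "bar (sum F T) = (\<Sum>t\<in>T. bar (F t))"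
  by (induction T rule: infinite_finite_induct) (simp_all add: bar_add)

declare bar_add [simp] bar_bar [simp] lam_unit [simp]

lemma lam_unit' [simp]: "bar lam * lam = 1"
  by (simp add: mult.commute)

lemma lam_cancel [simp]:
  "lam * (bar lam * x) = x" "bar lam * (lam * x) = x"
  by (simp_all flip: mult.assoc)

text \<open>These are the elements of \<open>Lam_min\<close>, the long root parameters that can be
  reached from short root elements.\<close>

definition tr :: "'a \<Rightarrow> 'a" where "tr z = z - lam * bar z"

lemma tr_Lam [simp]: "tr z \<in> Lam"
  using Lam_min_le unfolding Lam_min_def tr_def by auto

lemma tr_add: "tr (x + y) = tr x + tr y"
  by (simp add: tr_def algebra_simps)

lemma tr_0 [simp]: "tr 0 = 0"
  by (simp add: tr_def)

lemma Lam_bar: "x \<in> Lam \<Longrightarrow> lam * bar x = - x"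
  using Lam_le_max unfolding Lam_max_def by (metis (mono_tags, lifting) CollectD minus_minus subsetD)

lemma Lam_bar': "x \<in> Lam \<Longrightarrow> bar x = - (bar lam * x)"
  by (metis Lam_bar lam_cancel(2) mult_minus_right)

lemma norm_Lam: "y \<in> Lam \<Longrightarrow> x * bar x * y \<in> Lam"
  using conj_Lam[of y x] by (simp add: ac_simps)

text \<open>The value of \<open>h\<close> at \<open>ev i\<close> and \<open>ev (- i)\<close>; it
  lets both blocks of the Gram matrix be treated alike.\<close>

definition mu :: "int \<Rightarrow> 'a" where "mu i = (if i > 0 then 1 else lam)"

lemma mu_unit [simp]: "mu i * bar (mu i) = 1" "bar (mu i) * mu i = 1"
  by (simp_all add: mu_def)

lemma mu_cancel [simp]: "mu i * (bar (mu i) * x) = x" "bar (mu i) * (mu i * x) = x"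
  by (simp_all flip: mult.assoc)

lemma mu_pos [simp]: "i > 0 \<Longrightarrow> mu i = 1" "i > 0 \<Longrightarrow> mu (- i) = lam"
  by (simp_all add: mu_def)

lemma Om_iff: "i \<in> Om \<longleftrightarrow> i \<noteq> 0 \<and> \<bar>i\<bar> \<le> int n"
  by (auto simp: Omega_def Omega_plus_def Omega_minus_def)

lemma mu_bar: "i \<in> Om \<Longrightarrow> lam * bar (mu i) = mu (- i)" "i \<in> Om \<Longrightarrow> bar lam * mu i = bar (mu (- i))"
  by (auto simp: mu_def Om_iff)

lemma finite_Om [simp]: "finite Om"
  by (simp add: Omega_def Omega_plus_def Omega_minus_def)

lemma uminus_Om [simp]: "- i \<in> Om \<longleftrightarrow> i \<in> Om"
  by (simp add: Om_iff)

lemma Om_nz: "i \<in> Om \<Longrightarrow> i \<noteq> 0" "i \<in> Om \<Longrightarrow> i \<noteq> - i" "i \<in> Om \<Longrightarrow> - i \<noteq> i"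
  by (simp_all add: Om_iff)

text \<open>Two indices block at most two of the absolute values 1, 2, 3. The index is taken
  positive because \<open>f\<close>, unlike \<open>h\<close>, distinguishes the signs.\<close>

lemma third_index:
  obtains r where "r \<in> Om" "r > 0" "r \<noteq> i" "r \<noteq> - i" "r \<noteq> j" "r \<noteq> - j"
proof -
  have "\<not> {1, 2, 3} \<subseteq> {\<bar>i\<bar>, \<bar>j\<bar>}"
  proof
    assume "{1, 2, 3} \<subseteq> {\<bar>i\<bar>, \<bar>j\<bar>}"
    then have "card {1, 2, 3 :: int} \<le> card {\<bar>i\<bar>, \<bar>j\<bar>}"
      by (intro card_mono) auto
    also have "\<dots> \<le> 2"
      by (simp add: card_insert_if)
    finally show False by simp
  qed
  then obtain r where "r \<in> {1, 2, 3}" "r \<notin> {\<bar>i\<bar>, \<bar>j\<bar>}"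
    by blast
  then show thesis
    using three_le by (intro that[of r]) (auto simp: Om_iff)
qed

section \<open>The forms on coordinate functions\<close>

type_synonym (in -) 'b vect = "int \<Rightarrow> 'b"

text \<open>Vectors are functions on all integers, and operators leave the coordinates outside \<open>Om\<close> alone, so
  that the identity matrix acts as \<open>id\<close>.\<close>

definition scale :: "'a \<Rightarrow> 'a vect \<Rightarrow> 'a vect" where "scale x v = (\<lambda>i. x * v i)"

definition ev :: "int \<Rightarrow> 'a vect" where "ev i = (\<lambda>k. if k = i then 1 else 0)"

definition f :: "'a vect \<Rightarrow> 'a vect \<Rightarrow> 'a" where
  "f u v = (\<Sum>i\<in>Omega_plus n. bar (u i) * v (- i))"

definition h :: "'a vect \<Rightarrow> 'a vect \<Rightarrow> 'a" where
  "h u v = (\<Sum>i\<in>Om. mu i * bar (u i) * v (- i))"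

lemma scale_app [simp]: "scale x v i = x * v i"
  by (simp add: scale_def)

lemma ev_same [simp]: "ev i i = 1" and ev_other [simp]: "k \<noteq> i \<Longrightarrow> ev i k = 0"
  by (simp_all add: ev_def)

lemma scale_scale [simp]: "scale x (scale y v) = scale (x * y) v"
  by (auto simp: mult.assoc)

lemma scale_0 [simp]: "scale 0 v = 0" "scale x 0 = 0"
  by auto

lemma scale_1 [simp]: "scale 1 v = v"
  by auto

lemma scale_add: "scale x (u + v) = scale x u + scale x v" "scale (x + y) v = scale x v + scale y v"
  by (auto simp: algebra_simps)

lemma scale_diff: "scale x (u - v) = scale x u - scale x v" "scale (x - y) v = scale x v - scale y v"
  by (auto simp: algebra_simps)

lemma scale_minus: "scale x (- v) = - scale x v" "scale (- x) v = - scale x v"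
  by auto

lemma f_add [simp]: "f (u + u') v = f u v + f u' v" "f u (v + v') = f u v + f u v'"
  by (simp_all add: f_def algebra_simps sum.distrib)

lemma f_scale [simp]: "f (scale x u) v = bar x * f u v" "f u (scale x v) = x * f u v"
  by (simp_all add: f_def sum_distrib_left ac_simps)

lemma f_minus [simp]: "f (- u) v = - f u v" "f u (- v) = - f u v"
  by (simp_all add: f_def sum_negf)

lemma f_diff [simp]: "f (u - u') v = f u v - f u' v" "f u (v - v') = f u v - f u v'"
  by (simp_all add: f_def algebra_simps sum_subtractf)

lemma f_0 [simp]: "f 0 v = 0" "f v 0 = 0"
  by (simp_all add: f_def)

lemma h_add [simp]: "h (u + u') v = h u v + h u' v" "h u (v + v') = h u v + h u v'"
  by (simp_all add: h_def algebra_simps sum.distrib)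

lemma h_scale [simp]: "h (scale x u) v = bar x * h u v" "h u (scale x v) = x * h u v"
  by (simp_all add: h_def sum_distrib_left ac_simps)

lemma h_minus [simp]: "h (- u) v = - h u v" "h u (- v) = - h u v"
  by (simp_all add: h_def sum_negf)

lemma h_diff [simp]: "h (u - u') v = h u v - h u' v" "h u (v - v') = h u v - h u v'"
  by (simp_all add: h_def algebra_simps sum_subtractf)

lemma h_0 [simp]: "h 0 v = 0" "h v 0 = 0"
  by (simp_all add: h_def)

lemma h_f: "h u v = f u v + lam * bar (f v u)"
proof -
  have "h u v = (\<Sum>i\<in>Omega_plus n. mu i * bar (u i) * v (- i)) +
      (\<Sum>i\<in>Omega_minus n. mu i * bar (u i) * v (- i))"
    unfolding h_def Omega_def
    by (rule sum.union_disjoint) (auto simp: Omega_plus_def Omega_minus_def)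
  also have "(\<Sum>i\<in>Omega_plus n. mu i * bar (u i) * v (- i)) = f u v"
    unfolding f_def by (rule sum.cong) (auto simp: Omega_plus_def mu_def)
  also have "(\<Sum>i\<in>Omega_minus n. mu i * bar (u i) * v (- i)) =
      (\<Sum>i\<in>Omega_plus n. lam * (bar (u (- i)) * v i))"
    by (rule sum.reindex_bij_witness[of _ uminus uminus])
      (auto simp: Omega_plus_def Omega_minus_def mu_def)
  also have "\<dots> = lam * bar (f v u)"
    by (simp add: f_def sum_distrib_left ac_simps)
  finally show ?thesis .
qed

lemma h_swap: "h u v = lam * bar (h v u)"
  by (simp add: h_f algebra_simps)

lemma bar_h: "bar (h u v) = bar lam * h v u"
  by (subst (2) h_swap) simp

lemma h_zero_swap: "h u v = 0 \<Longrightarrow> h v u = 0"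
  by (subst h_swap) simp

lemma h_ev: "i \<in> Om \<Longrightarrow> h (ev i) v = mu i * v (- i)"
proof -
  assume i: "i \<in> Om"
  have "h (ev i) v = (\<Sum>k\<in>Om. if k = i then mu i * v (- i) else 0)"
    unfolding h_def by (rule sum.cong) (auto simp: ev_def)
  then show ?thesis using i by simp
qed

lemma h_ev': "i \<in> Om \<Longrightarrow> h v (ev i) = mu (- i) * bar (v (- i))"
  by (subst h_swap) (simp add: h_ev mu_bar flip: mult.assoc)

lemma f_ev': "i \<in> Om \<Longrightarrow> f v (ev i) = (if i < 0 then bar (v (- i)) else 0)"
proof -
  assume i: "i \<in> Om"
  have "f v (ev i) = (\<Sum>k\<in>Omega_plus n. if k = - i then bar (v (- i)) else 0)"
    unfolding f_def by (rule sum.cong) (auto simp: ev_def)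
  then show ?thesis using i by (auto simp: Om_iff Omega_plus_def)
qed

lemma f_ev: "i \<in> Om \<Longrightarrow> f (ev i) v = (if i > 0 then v (- i) else 0)"
proof -
  assume i: "i \<in> Om"
  have "f (ev i) v = (\<Sum>k\<in>Omega_plus n. if k = i then v (- i) else 0)"
    unfolding f_def by (rule sum.cong) (auto simp: ev_def)
  then show ?thesis using i by (auto simp: Om_iff Omega_plus_def)
qed

text \<open>Modulo \<open>Lam_min\<close> the value is a quadratic map with polar form
  \<open>h\<close>.\<close>

lemma f_sum_sq: "f (u + v) (u + v) = f u u + f v v + h u v + tr (f v u)"
  by (simp add: h_f tr_def)

definition supp :: "'a vect \<Rightarrow> bool" where "supp v \<longleftrightarrow> (\<forall>i. i \<notin> Om \<longrightarrow> v i = 0)"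

lemma supp_ops [simp]: "supp u \<Longrightarrow> supp v \<Longrightarrow> supp (u + v)" "supp u \<Longrightarrow> supp v \<Longrightarrow> supp (u - v)"
  "supp v \<Longrightarrow> supp (scale x v)" "supp v \<Longrightarrow> supp (- v)" "i \<in> Om \<Longrightarrow> supp (ev i)" "supp 0"
  by (auto simp: supp_def ev_def)

abbreviation ginv :: "('a vect \<Rightarrow> 'a vect) \<Rightarrow> 'a vect \<Rightarrow> 'a vect" where
  "ginv \<equiv> inv_into UNIV"

subsection \<open>Isometries and transvections\<close>

definition unitary :: "('a vect \<Rightarrow> 'a vect) \<Rightarrow> bool" where
  "unitary g \<longleftrightarrow> bij g \<and> (\<forall>u v. g (u + v) = g u + g v) \<and> (\<forall>x v. g (scale x v) = scale x (g v)) \<and>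
     (\<forall>u v. h (g u) (g v) = h u v) \<and> (\<forall>v. f (g v) (g v) - f v v \<in> Lam) \<and>
     (\<forall>v i. i \<notin> Om \<longrightarrow> g v i = v i)"

lemma unitary_bij: "unitary g \<Longrightarrow> bij g"
  and unitary_add: "unitary g \<Longrightarrow> g (u + v) = g u + g v"
  and unitary_scale: "unitary g \<Longrightarrow> g (scale x v) = scale x (g v)"
  and unitary_h: "unitary g \<Longrightarrow> h (g u) (g v) = h u v"
  and unitary_f: "unitary g \<Longrightarrow> f (g v) (g v) - f v v \<in> Lam"
  and unitary_out: "unitary g \<Longrightarrow> i \<notin> Om \<Longrightarrow> g v i = v i"
  by (auto simp: unitary_def)

lemma unitary_supp: "unitary g \<Longrightarrow> supp v \<Longrightarrow> supp (g v)"
  by (simp add: supp_def unitary_out)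

lemma unitary_minus: assumes g: "unitary g" shows "g (- v) = - g v"
  using unitary_scale[OF g, of "-1" v] by (simp add: scale_minus)

lemma unitary_diff: assumes g: "unitary g" shows "g (u - v) = g u - g v"
  using unitary_add[OF g, of u "- v"] by (simp add: unitary_minus[OF g])

lemmas unitary_lin = unitary_add unitary_scale unitary_minus unitary_diff

lemma unitary_inv_app: "unitary g \<Longrightarrow> ginv g (g v) = v" "unitary g \<Longrightarrow> g (ginv g v) = v"
  by (simp_all add: bij_is_inj bij_is_surj surj_f_inv_f unitary_bij)

lemma unitary_f_Lam: "unitary g \<Longrightarrow> f v v \<in> Lam \<Longrightarrow> f (g v) (g v) \<in> Lam"
  using unitary_f[of g v] add_Lam[of "f (g v) (g v) - f v v" "f v v"] by simp

lemma unitary_id [simp]: "unitary id"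
  by (simp add: unitary_def zero_Lam)

lemma unitary_comp [simp]: assumes g: "unitary g" and k: "unitary k" shows "unitary (g \<circ> k)"
  unfolding unitary_def
proof (intro conjI allI impI)
  show "bij (g \<circ> k)" using assms by (simp add: unitary_bij bij_comp)
  show "f ((g \<circ> k) v) ((g \<circ> k) v) - f v v \<in> Lam" for v
    using add_Lam[OF unitary_f[OF g, of "k v"] unitary_f[OF k, of v]] by simp
qed (simp_all add: unitary_add[OF g] unitary_scale[OF g] unitary_h[OF g] unitary_out[OF g]
      unitary_add[OF k] unitary_scale[OF k] unitary_h[OF k] unitary_out[OF k])

lemma unitary_eqI: "unitary g \<Longrightarrow> g u = g v \<Longrightarrow> u = v"
  by (drule unitary_bij, drule bij_is_inj, erule injD)

lemma unitary_inv [simp]: assumes g: "unitary g" shows "unitary (ginv g)"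
  unfolding unitary_def
proof (intro conjI allI impI)
  show "bij (ginv g)" using g by (simp add: unitary_bij bij_imp_bij_inv)
  show "ginv g (u + v) = ginv g u + ginv g v" for u v
    by (rule unitary_eqI[OF g]) (simp add: unitary_inv_app[OF g] unitary_add[OF g])
  show "ginv g (scale x v) = scale x (ginv g v)" for x v
    by (rule unitary_eqI[OF g]) (simp add: unitary_inv_app[OF g] unitary_scale[OF g])
  show "h (ginv g u) (ginv g v) = h u v" for u v
    using unitary_h[OF g, of "ginv g u" "ginv g v"] by (simp add: unitary_inv_app[OF g])
  show "f (ginv g v) (ginv g v) - f v v \<in> Lam" for v
    using uminus_Lam[OF unitary_f[OF g, of "ginv g v"]] by (simp add: unitary_inv_app[OF g])
  show "ginv g v i = v i" if "i \<notin> Om" for v i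
    using unitary_out[OF g that, of "ginv g v"] by (simp add: unitary_inv_app[OF g])
qed

lemma unitary_h_inv: assumes g: "unitary g"
  shows "h u (ginv g v) = h (g u) v" "h (ginv g u) v = h u (g v)"
  using unitary_h[OF g, of u "ginv g v"] unitary_h[OF g, of "ginv g u" v] by (simp_all add: unitary_inv_app[OF g])

text \<open>For orthogonal isotropic \<open>a\<close> and \<open>b\<close> this is the Eichler
  transvection. Conjugation by an isometry merely moves \<open>a\<close> and \<open>b\<close>, so
  short root elements and all their conjugates have this shape.\<close>

definition transv :: "'a vect \<Rightarrow> 'a vect \<Rightarrow> 'a \<Rightarrow> 'a vect \<Rightarrow> 'a vect" where
  "transv a b x v = v + scale (x * h b v) a - scale (bar lam * bar x * h a v) b"

definition long_transv :: "'a vect \<Rightarrow> 'a \<Rightarrow> 'a vect \<Rightarrow> 'a vect" where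
  "long_transv a s v = v + scale (s * h a v) a"

lemma transv_same: "transv a a x = long_transv a (x - bar lam * bar x)"
  by (rule ext) (simp add: transv_def long_transv_def scale_diff algebra_simps)

lemma transv_swap: "transv a b x = transv b a (- (bar lam * bar x))"
  by (rule ext) (simp add: transv_def scale_minus)

lemma transv_scale: "transv (scale r a) b x = transv a b (x * r)" "transv a (scale r b) x = transv a b (x * bar r)"
  by (rule ext, simp add: transv_def ac_simps)+

lemma transv_0 [simp]: "transv a b 0 = id"
  by (rule ext) (simp add: transv_def)

lemma long_transv_0 [simp]: "long_transv a 0 = id"
  by (rule ext) (simp add: long_transv_def)

lemma transv_conj: assumes g: "unitary g" shows "g \<circ> transv a b x \<circ> ginv g = transv (g a) (g b) x"
  by (rule ext) (simp add: transv_def unitary_lin[OF g] unitary_h_inv[OF g] unitary_inv_app[OF g])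

lemma long_transv_conj: assumes g: "unitary g" shows "g \<circ> long_transv a s \<circ> ginv g = long_transv (g a) s"
  by (rule ext) (simp add: long_transv_def unitary_lin[OF g] unitary_h_inv[OF g] unitary_inv_app[OF g])

lemma transv_comp_transv:
  assumes "h a a' = 0" "h a b' = 0" "h b a' = 0" "h b b' = 0"
  shows "transv a b x (transv a' b' x' v) = v + (scale (x * h b v) a - scale (bar lam * bar x * h a v) b) +
    (scale (x' * h b' v) a' - scale (bar lam * bar x' * h a' v) b')"
  using assms by (simp add: transv_def algebra_simps)

lemma transv_commute:
  assumes "h a a' = 0" "h a b' = 0" "h b a' = 0" "h b b' = 0"
  shows "transv a b x \<circ> transv a' b' x' = transv a' b' x' \<circ> transv a b x"
  by (rule ext) (simp add: transv_comp_transv assms h_zero_swap[OF assms(1)] h_zero_swap[OF assms(2)]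
      h_zero_swap[OF assms(3)] h_zero_swap[OF assms(4)])

lemma transv_add_left:
  assumes "h a a' = 0" "h a b = 0" "h a' b = 0" "h b b = 0"
  shows "transv (a + a') b x = transv a b x \<circ> transv a' b x"
  using assms h_zero_swap[OF assms(3)]
  by (intro ext) (simp add: transv_comp_transv, simp add: transv_def scale_add algebra_simps)

lemma transv_add_right:
  assumes "h b b' = 0" "h a b = 0" "h a b' = 0" "h a a = 0"
  shows "transv a (b + b') x = transv a b x \<circ> transv a b' x"
  using assms h_zero_swap[OF assms(2)]
  by (intro ext) (simp add: transv_comp_transv, simp add: transv_def scale_add algebra_simps)

lemma transv_add_coeff:
  assumes "h a b = 0" "h a a = 0" "h b b = 0"
  shows "transv a b x \<circ> transv a b y = transv a b (x + y)"
  using assms h_zero_swap[OF assms(1)]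
  by (intro ext) (simp add: transv_comp_transv, simp add: transv_def scale_add algebra_simps)

lemma long_transv_add_coeff:
  assumes "h a a = 0"
  shows "long_transv a x \<circ> long_transv a y = long_transv a (x + y)"
  using assms by (intro ext) (simp add: long_transv_def scale_add algebra_simps)

lemma transv_inverse:
  assumes "h a b = 0" "h a a = 0" "h b b = 0"
  shows "bij (transv a b x)" "ginv (transv a b x) = transv a b (- x)"
proof -
  have 1: "transv a b x \<circ> transv a b (- x) = id" "transv a b (- x) \<circ> transv a b x = id"
    by (simp_all add: transv_add_coeff[OF assms])
  then show "bij (transv a b x)" by (rule o_bij[rotated])
  show "ginv (transv a b x) = transv a b (- x)"
    by (rule inv_unique_comp) (use 1 in auto)
qed

lemma long_transv_inverse:
  assumes "h a a = 0"
  shows "bij (long_transv a x)" "ginv (long_transv a x) = long_transv a (- x)"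
proof -
  have 1: "long_transv a x \<circ> long_transv a (- x) = id" "long_transv a (- x) \<circ> long_transv a x = id"
    by (simp_all add: long_transv_add_coeff[OF assms])
  then show "bij (long_transv a x)" by (rule o_bij[rotated])
  show "ginv (long_transv a x) = long_transv a (- x)"
    by (rule inv_unique_comp) (use 1 in auto)
qed

lemma f_Lam_h: "f a a \<in> Lam \<Longrightarrow> h a a = 0"
  by (simp add: h_f Lam_bar)

lemma transv_unitary:
  assumes "h a b = 0" "f a a \<in> Lam" "f b b \<in> Lam" "supp a" "supp b"
  shows "unitary (transv a b x)"
  unfolding unitary_def
proof (intro conjI allI impI)
  have a: "h a a = 0" and b: "h b b = 0" and ba: "h b a = 0"
    using assms f_Lam_h h_zero_swap by auto
  show "bij (transv a b x)" using transv_inverse[OF assms(1) a b] by simp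
  show "transv a b x (u + v) = transv a b x u + transv a b x v" for u v
    by (simp add: transv_def algebra_simps scale_add)
  show "transv a b x (scale y v) = scale y (transv a b x v)" for y v
    by (simp add: transv_def algebra_simps scale_add scale_diff)
  show "h (transv a b x u) (transv a b x v) = h u v" for u v
    using a b assms(1) ba
    by (simp add: transv_def algebra_simps h_swap[of u a] h_swap[of u b])
  show "f (transv a b x v) (transv a b x v) - f v v \<in> Lam" for v
  proof -
    \<comment> \<open>The change of value is \<open>f ?w ?w + h v ?w\<close> plus a trace.
      Orthogonality of \<open>a\<close> and \<open>b\<close> makes the first term a sum of norm
      multiples of their values and a trace; the second is a trace because the two summands of
      \<open>?w\<close> are adjoint to each other.\<close>
    define X where "X = x * h b v"
    define Y where "Y = bar lam * bar x * h a v"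
    let ?w = "scale X a - scale Y b"
    have 1: "f ?w ?w = X * bar X * f a a + Y * bar Y * f b b + tr (- (bar Y * X * f b a))"
      using f_sum_sq[of "scale X a" "- scale Y b"] assms(1) by (simp add: algebra_simps)
    have 2: "h v ?w = tr (- (bar x * h a v * bar (h b v)))"
      by (simp add: tr_def X_def Y_def h_swap[of v a] h_swap[of v b] algebra_simps)
    have "f (transv a b x v) (transv a b x v) - f v v = f ?w ?w + h v ?w + tr (f ?w v)"
      using f_sum_sq[of v ?w] by (simp add: transv_def X_def Y_def algebra_simps)
    moreover have "\<dots> \<in> Lam"
      unfolding 1 2 by (intro add_Lam norm_Lam assms tr_Lam)
    ultimately show ?thesis by simp
  qed
  show "transv a b x v i = v i" if "i \<notin> Om" for v i
    using that assms by (simp add: transv_def supp_def)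
qed

text \<open>The factor \<open>bar lam\<close> compensates the \<open>lam\<close> in the swap of
  \<open>h\<close>: the polar term becomes a norm times \<open>z\<close>, so \<open>z\<close> ranges
  over \<open>Lam\<close> itself.\<close>

lemma long_transv_unitary:
  assumes "f a a \<in> Lam" "supp a" "z \<in> Lam"
  shows "unitary (long_transv a (bar lam * z))"
  unfolding unitary_def
proof (intro conjI allI impI)
  have a: "h a a = 0" using assms f_Lam_h by simp
  show "bij (long_transv a (bar lam * z))" using long_transv_inverse[OF a] by simp
  show "long_transv a (bar lam * z) (u + v) = long_transv a (bar lam * z) u + long_transv a (bar lam * z) v" for u v
    by (simp add: long_transv_def algebra_simps scale_add)
  show "long_transv a (bar lam * z) (scale y v) = scale y (long_transv a (bar lam * z) v)" for y v
    by (simp add: long_transv_def algebra_simps scale_add)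
  show "h (long_transv a (bar lam * z) u) (long_transv a (bar lam * z) v) = h u v" for u v
    using a by (simp add: long_transv_def algebra_simps Lam_bar'[OF assms(3)] bar_h)
  show "f (long_transv a (bar lam * z) v) (long_transv a (bar lam * z) v) - f v v \<in> Lam" for v
  proof -
    define X where "X = bar lam * z * h a v"
    have "h v a * X = h a v * bar (h a v) * z"
      by (subst h_swap) (simp add: X_def ac_simps)
    then have "f (long_transv a (bar lam * z) v) (long_transv a (bar lam * z) v) - f v v =
      X * bar X * f a a + h a v * bar (h a v) * z + tr (f (scale X a) v)"
      using f_sum_sq[of v "scale X a"] by (simp add: long_transv_def X_def algebra_simps)
    moreover have "\<dots> \<in> Lam"
      by (intro add_Lam norm_Lam assms tr_Lam)
    ultimately show ?thesis by simp
  qed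
  show "long_transv a (bar lam * z) v i = v i" if "i \<notin> Om" for v i
    using that assms by (simp add: long_transv_def supp_def)
qed

subsection \<open>The elementary group and products of conjugates\<close>

lemma lam_ac: "lam * (x * bar lam) = x" "lam * (x * (bar lam * y)) = x * y"
  "bar lam * (x * lam) = x" "bar lam * (x * (lam * y)) = x * y"
  by (metis lam_cancel mult.commute mult.left_commute)+

lemma mu_ac: "mu i * (x * bar (mu i)) = x" "mu i * (x * (bar (mu i) * y)) = x * y"
  "bar (mu i) * (x * mu i) = x" "bar (mu i) * (x * (mu i * y)) = x * y"
  by (metis mu_cancel mult.commute mult.left_commute)+

definition norm_one :: "'a \<Rightarrow> bool" where "norm_one u \<longleftrightarrow> u * bar u = 1"

lemma norm_one_simps [simp]: "norm_one 1" "norm_one (- u) \<longleftrightarrow> norm_one u" "norm_one lam"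
  "norm_one (mu i)" "norm_one (bar u) \<longleftrightarrow> norm_one u"
  by (simp_all add: norm_one_def mult.commute)

lemma norm_one_mult [simp]: "norm_one u \<Longrightarrow> norm_one v \<Longrightarrow> norm_one (u * v)"
  unfolding norm_one_def by (metis bar_mult' mult.assoc mult.left_commute mult.right_neutral)

lemma norm_one_cancel: "norm_one u \<Longrightarrow> u * (bar u * x) = x" "norm_one u \<Longrightarrow> bar u * (u * x) = x"
  "norm_one u \<Longrightarrow> u * (y * (bar u * x)) = y * x"
  unfolding norm_one_def by (metis mult.assoc mult.commute mult_1)+

text \<open>As \<open>h (ev j)\<close> reads coordinate \<open>- j\<close>, the second index is
  opposite to the usual one: \<open>S i j x\<close> is \<open>T_short\<close> at \<open>i\<close>,
  \<open>- j\<close> with parameter \<open>mu j * x\<close>. In this form the two indices play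
  symmetric roles and \<open>S i i\<close> is a long root element.\<close>

abbreviation S :: "int \<Rightarrow> int \<Rightarrow> 'a \<Rightarrow> 'a vect \<Rightarrow> 'a vect" where
  "S i j x \<equiv> transv (ev i) (ev j) x"

abbreviation L :: "int \<Rightarrow> 'a \<Rightarrow> 'a vect \<Rightarrow> 'a vect" where
  "L i z \<equiv> long_transv (ev i) (bar lam * z)"

abbreviation conjg :: "('a vect \<Rightarrow> 'a vect) \<Rightarrow> ('a vect \<Rightarrow> 'a vect) \<Rightarrow> 'a vect \<Rightarrow> 'a vect" where
  "conjg g k \<equiv> g \<circ> k \<circ> ginv g"

lemma h_ev_ev [simp]: "i \<in> Om \<Longrightarrow> i \<noteq> - j \<Longrightarrow> h (ev i) (ev j) = 0"
  by (cases "j = - i") (auto simp: h_ev)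

lemma h_ev_opp [simp]: "i \<in> Om \<Longrightarrow> h (ev i) (ev (- i)) = mu i" "i \<in> Om \<Longrightarrow> h (ev (- i)) (ev i) = mu (- i)"
  by (simp_all add: h_ev)

lemma f_ev_same [simp]: "i \<in> Om \<Longrightarrow> f (ev i) (ev i) = 0"
  by (simp add: f_ev Om_nz)

lemma h_ev_same [simp]: "i \<in> Om \<Longrightarrow> h (ev i) (ev i) = 0"
  by (simp add: Om_nz)

lemma S_unitary [simp]: "i \<in> Om \<Longrightarrow> j \<in> Om \<Longrightarrow> i \<noteq> - j \<Longrightarrow> unitary (S i j x)"
  by (rule transv_unitary) (simp_all add: zero_Lam)

lemma L_unitary [simp]: "i \<in> Om \<Longrightarrow> z \<in> Lam \<Longrightarrow> unitary (L i z)"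
  by (rule long_transv_unitary) (simp_all add: zero_Lam)

lemma S_inv: "i \<in> Om \<Longrightarrow> j \<in> Om \<Longrightarrow> i \<noteq> - j \<Longrightarrow> ginv (S i j x) = S i j (- x)"
  by (rule transv_inverse) simp_all

lemma L_inv: "i \<in> Om \<Longrightarrow> ginv (L i z) = L i (- z)"
  using long_transv_inverse(2)[of "ev i" "bar lam * z"] by simp

lemma S_add: "i \<in> Om \<Longrightarrow> j \<in> Om \<Longrightarrow> i \<noteq> - j \<Longrightarrow> S i j (x + y) = S i j x \<circ> S i j y"
  by (simp add: transv_add_coeff)

lemma L_add: "i \<in> Om \<Longrightarrow> L i (x + y) = L i x \<circ> L i y"
  by (simp add: long_transv_add_coeff algebra_simps)

inductive is_elementary :: "('a vect \<Rightarrow> 'a vect) \<Rightarrow> bool" where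
  "is_elementary id"
| "is_elementary g \<Longrightarrow> i \<in> Om \<Longrightarrow> j \<in> Om \<Longrightarrow> i \<noteq> j \<Longrightarrow> i \<noteq> - j \<Longrightarrow> is_elementary (S i j x \<circ> g)"
| "is_elementary g \<Longrightarrow> i \<in> Om \<Longrightarrow> z \<in> Lam \<Longrightarrow> is_elementary (L i z \<circ> g)"

definition elementary :: "('a vect \<Rightarrow> 'a vect) set" where "elementary = Collect is_elementary"

lemma elementary_id: "id \<in> elementary"
  and elementary_S_comp: "g \<in> elementary \<Longrightarrow> i \<in> Om \<Longrightarrow> j \<in> Om \<Longrightarrow> i \<noteq> j \<Longrightarrow> i \<noteq> - j \<Longrightarrow> S i j x \<circ> g \<in> elementary"
  and elementary_L_comp: "g \<in> elementary \<Longrightarrow> i \<in> Om \<Longrightarrow> z \<in> Lam \<Longrightarrow> L i z \<circ> g \<in> elementary"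
  unfolding elementary_def mem_Collect_eq by (fact is_elementary.intros)+

lemma elementary_induct [consumes 1, case_names elementary_id elementary_S_comp elementary_L_comp]:
  assumes "g \<in> elementary" "P id"
    "\<And>g i j x. g \<in> elementary \<Longrightarrow> P g \<Longrightarrow> i \<in> Om \<Longrightarrow> j \<in> Om \<Longrightarrow> i \<noteq> j \<Longrightarrow> i \<noteq> - j \<Longrightarrow> P (S i j x \<circ> g)"
    "\<And>g i z. g \<in> elementary \<Longrightarrow> P g \<Longrightarrow> i \<in> Om \<Longrightarrow> z \<in> Lam \<Longrightarrow> P (L i z \<circ> g)"
  shows "P g"
  using assms unfolding elementary_def mem_Collect_eq by (rule is_elementary.induct)

lemma elementary_S: "i \<in> Om \<Longrightarrow> j \<in> Om \<Longrightarrow> i \<noteq> - j \<Longrightarrow> S i j x \<in> elementary"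
proof (cases "i = j")
  case True
  moreover have "x - bar lam * bar x = bar lam * tr (lam * x)"
    by (simp add: tr_def right_diff_distrib)
  moreover assume "i \<in> Om"
  ultimately show ?thesis
    using elementary_L_comp[OF elementary_id, of i "tr (lam * x)"] by (simp add: transv_same)
qed (use elementary_S_comp[OF elementary_id, of i j x] in simp)

lemma elementary_L: "i \<in> Om \<Longrightarrow> z \<in> Lam \<Longrightarrow> L i z \<in> elementary"
  using elementary_L_comp[OF elementary_id, of i z] by simp

lemma elementary_unitary [simp]: assumes "g \<in> elementary" shows "unitary g"
  using assms
proof (rule elementary_induct)
  show "unitary id" by simp
  show "unitary (S i j x \<circ> g)" if "unitary g" "i \<in> Om" "j \<in> Om" "i \<noteq> - j" for g i j x
    using that by (intro unitary_comp) simp_all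
  show "unitary (L i z \<circ> g)" if "unitary g" "i \<in> Om" "z \<in> Lam" for g i z
    using that by (intro unitary_comp) simp_all
qed

lemma elementary_comp: assumes "g \<in> elementary" "k \<in> elementary" shows "g \<circ> k \<in> elementary"
  using assms(1)
proof (rule elementary_induct)
  show "id \<circ> k \<in> elementary" using assms by simp
  show "S i j x \<circ> g \<circ> k \<in> elementary" if "g \<circ> k \<in> elementary" "i \<in> Om" "j \<in> Om" "i \<noteq> j" "i \<noteq> - j" for g i j x
    using elementary_S_comp[OF that] by (simp add: comp_assoc)
  show "L i z \<circ> g \<circ> k \<in> elementary" if "g \<circ> k \<in> elementary" "i \<in> Om" "z \<in> Lam" for g i z
    using elementary_L_comp[OF that] by (simp add: comp_assoc)
qed

lemma ginv_comp: "unitary g \<Longrightarrow> unitary k \<Longrightarrow> ginv (g \<circ> k) = ginv k \<circ> ginv g"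
  by (simp add: o_inv_distrib unitary_bij)

lemma ginv_id [simp]: "ginv id = id"
  by (simp add: inv_id)

lemma ginv_ginv [simp]: "unitary g \<Longrightarrow> ginv (ginv g) = g"
  by (simp add: inv_inv_eq unitary_bij)

lemma elementary_inv: assumes "g \<in> elementary" shows "ginv g \<in> elementary"
  using assms
proof (rule elementary_induct)
  show "ginv id \<in> elementary" by (simp add: elementary_id)
  show "ginv (S i j x \<circ> g) \<in> elementary"
    if "g \<in> elementary" "ginv g \<in> elementary" "i \<in> Om" "j \<in> Om" "i \<noteq> - j" for g i j x
    using that by (simp add: ginv_comp S_inv elementary_comp elementary_S)
  show "ginv (L i z \<circ> g) \<in> elementary" if "g \<in> elementary" "ginv g \<in> elementary" "i \<in> Om" "z \<in> Lam" for g i z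
    using that by (simp add: ginv_comp L_inv elementary_comp elementary_L uminus_Lam del: mult_minus_right)
qed

lemma cancel: assumes g: "unitary g"
  shows "g \<circ> ginv g = id" "ginv g \<circ> g = id" "g \<circ> (ginv g \<circ> k) = k" "ginv g \<circ> (g \<circ> k) = k"
    "k \<circ> g \<circ> ginv g = k" "k \<circ> ginv g \<circ> g = k"
  by (auto simp: unitary_inv_app[OF g])

lemma conjg_comp: assumes g: "unitary g" shows "conjg g (k \<circ> l) = conjg g k \<circ> conjg g l"
  by (rule ext) (simp add: unitary_inv_app[OF g])

lemma conjg_conjg: "unitary g \<Longrightarrow> unitary k \<Longrightarrow> conjg (g \<circ> k) l = conjg g (conjg k l)"
  by (simp add: ginv_comp comp_assoc)

inductive conj_prod :: "('a vect \<Rightarrow> 'a vect) \<Rightarrow> nat \<Rightarrow> ('a vect \<Rightarrow> 'a vect) \<Rightarrow> bool"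
  for s :: "'a vect \<Rightarrow> 'a vect" where
  conj_prod_id: "conj_prod s 0 id"
| conj_prod_step: "conj_prod s m k \<Longrightarrow> g \<in> elementary \<Longrightarrow> t = s \<or> t = ginv s \<Longrightarrow> conj_prod s (Suc m) (conjg g t \<circ> k)"

lemma conj_prod_unitary: assumes s: "unitary s" and k: "conj_prod s m k" shows "unitary k"
  using k
proof (rule conj_prod.induct)
  show "unitary (conjg g t \<circ> k)" if "unitary k" "g \<in> elementary" "t = s \<or> t = ginv s" for k g t
    using that s by (intro unitary_comp) auto
  show "unitary id" by simp
qed

lemma conj_prod_comp: assumes "conj_prod s m k" "conj_prod s m' k'" shows "conj_prod s (m + m') (k \<circ> k')"
  using assms(1)
proof (rule conj_prod.induct)
  show "conj_prod s (Suc m + m') (conjg g t \<circ> k \<circ> k')"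
    if "conj_prod s (m + m') (k \<circ> k')" "g \<in> elementary" "t = s \<or> t = ginv s" for m k g t
    using conj_prod_step[OF that] by (simp add: comp_assoc)
  show "conj_prod s (0 + m') (id \<circ> k')" using assms(2) by simp
qed

lemma conj_prod_one: "g \<in> elementary \<Longrightarrow> t = s \<or> t = ginv s \<Longrightarrow> conj_prod s 1 (conjg g t)"
  using conj_prod_step[OF conj_prod_id, of g t s] by simp

lemma conj_prod_inv: assumes s: "unitary s" and k: "conj_prod s m k" shows "conj_prod s m (ginv k)"
  using k
proof (rule conj_prod.induct)
  show "conj_prod s 0 (ginv id)" by (simp add: conj_prod_id)
  show "conj_prod s (Suc m) (ginv (conjg g t \<circ> k))"
    if k: "conj_prod s m k" "conj_prod s m (ginv k)" and g: "g \<in> elementary" and "t = s \<or> t = ginv s" for m k g t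
  proof -
    have t: "unitary t" "ginv t = s \<or> ginv t = ginv s" using that s by auto
    have "conj_prod s (m + 1) (ginv k \<circ> conjg g (ginv t))"
      by (intro conj_prod_comp k conj_prod_one g t)
    moreover have "ginv (conjg g t \<circ> k) = ginv k \<circ> conjg g (ginv t)"
      using g t conj_prod_unitary[OF s k(1)] by (simp add: ginv_comp comp_assoc)
    ultimately show ?thesis by simp
  qed
qed

lemma conj_prod_conj: assumes e: "e \<in> elementary" and k: "conj_prod s m k" shows "conj_prod s m (conjg e k)"
  using k
proof (rule conj_prod.induct)
  show "conj_prod s 0 (conjg e id)"
    using cancel(1)[OF elementary_unitary[OF e]] by (simp add: conj_prod_id)
  show "conj_prod s (Suc m) (conjg e (conjg g t \<circ> k))"
    if k: "conj_prod s m (conjg e k)" and g: "g \<in> elementary" and t: "t = s \<or> t = ginv s" for m k g t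
  proof -
    have "conj_prod s (Suc m) (conjg (e \<circ> g) t \<circ> conjg e k)"
      by (intro conj_prod_step elementary_comp e g t k)
    then show ?thesis using e g by (simp only: conjg_comp conjg_conjg elementary_unitary)
  qed
qed

text \<open>\<open>s\<close> followed by \<open>ginv s\<close> has no effect. Counts can thus be
  raised in steps of two, whence the parity condition in \<open>conj_prod_mono\<close>.\<close>

lemma conj_prod_add2: assumes s: "unitary s" and k: "conj_prod s m k" shows "conj_prod s (m + 2) k"
proof -
  have "conj_prod s (Suc (Suc m)) (conjg id s \<circ> (conjg id (ginv s) \<circ> k))"
    by (intro conj_prod_step k elementary_id) auto
  moreover have "conjg id s \<circ> (conjg id (ginv s) \<circ> k) = k"
    by (simp add: cancel[OF s])
  ultimately show ?thesis by simp
qed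

lemma conj_prod_mono: assumes s: "unitary s" and k: "conj_prod s m k" and "m \<le> m'" "even (m' - m)"
  shows "conj_prod s m' k"
proof -
  obtain d where d: "m' - m = 2 * d" using assms by blast
  have "conj_prod s (m + 2 * d) k" for d
  proof (induction d)
    case (Suc d)
    then show ?case using conj_prod_add2[OF s Suc] by simp
  qed (simp add: k)
  from this[of d] show ?thesis using assms(3) d by (metis le_add_diff_inverse)
qed

text \<open>Each factor \<open>t\<close> or \<open>ginv t\<close> is replaced by its own
  \<open>a\<close> factors. This carries results about a commutator of \<open>s\<close> back to
  \<open>s\<close>.\<close>

lemma conj_prod_trans: assumes s: "unitary s" and t: "conj_prod s a t" and k: "conj_prod t m k" shows "conj_prod s (a * m) k"
  using k
proof (rule conj_prod.induct)
  show "conj_prod s (a * 0) id" by (simp add: conj_prod_id)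
  show "conj_prod s (a * Suc m) (conjg g u \<circ> k)"
    if k: "conj_prod s (a * m) k" and g: "g \<in> elementary" and u: "u = t \<or> u = ginv t" for m k g u
  proof -
    have "conj_prod s a u" using u t conj_prod_inv[OF s t] by auto
    from conj_prod_comp[OF conj_prod_conj[OF g this] k] show ?thesis by simp
  qed
qed

lemma conj_prod_ginv: assumes s: "unitary s" and k: "conj_prod (ginv s) m k" shows "conj_prod s m k"
  using conj_prod_trans[OF s conj_prod_inv[OF s conj_prod_one[OF elementary_id, of s s]] ] k by (auto simp: conj_prod_id)

lemma conj_prod_conjg: assumes s: "unitary s" and e: "e \<in> elementary" and k: "conj_prod (conjg e s) m k" shows "conj_prod s m k"
  using conj_prod_trans[OF s conj_prod_one[OF e, of s s] k] by simp

lemma conj_prod_commutator: assumes s: "unitary s" and k: "conj_prod s m k" and e: "e \<in> elementary"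
  shows "conj_prod s (2 * m) (k \<circ> conjg e (ginv k))"
  using conj_prod_comp[OF k conj_prod_conj[OF e conj_prod_inv[OF s k]]] by (simp add: mult_2)

lemma conj_prod_two: assumes s: "unitary s" and t: "t \<in> elementary" shows "conj_prod s 2 (ginv t \<circ> (s \<circ> t \<circ> ginv s))"
proof -
  have "conj_prod s (1 + 1) (conjg (ginv t) s \<circ> conjg id (ginv s))"
    by (intro conj_prod_comp conj_prod_one elementary_inv t elementary_id) auto
  then show ?thesis using t by (simp add: comp_assoc numeral_2_eq_2)
qed

text \<open>The commutator of \<open>T\<close> with the two-factor product of
  \<open>conj_prod_two\<close>, conjugated by \<open>t\<close>. The conjugation separates the roles:
  \<open>s \<circ> t \<circ> ginv s\<close> acts on the first root element, \<open>t\<close> on the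
  second.\<close>

lemma conj_prod_four: assumes s: "unitary s" and t: "t \<in> elementary" and T: "T \<in> elementary"
  shows "conj_prod s 4 (conjg (s \<circ> t \<circ> ginv s) T \<circ> conjg t (ginv T))"
proof -
  define z where "z = ginv t \<circ> (s \<circ> t \<circ> ginv s)"
  have ut: "unitary t" and uT: "unitary T" and uz: "unitary z" using s t T by (auto simp: z_def)
  have tz: "t \<circ> z = s \<circ> t \<circ> ginv s" by (simp add: z_def cancel[OF ut])
  have "conj_prod s 4 (conjg t (z \<circ> conjg T (ginv z)))"
    using conj_prod_conj[OF t conj_prod_commutator[OF s conj_prod_two[OF s t] T]] by (simp add: z_def)
  also have "conjg t (z \<circ> conjg T (ginv z)) = conjg (t \<circ> z) T \<circ> conjg t (ginv T)"
    using ut uT uz by (simp add: ginv_comp cancel comp_assoc)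
  finally show ?thesis by (simp only: tz)
qed

text \<open>Up to conjugation by \<open>ginv E\<close>, the commutator of \<open>E \<circ> K\<close>
  with \<open>B\<close> is the commutator of \<open>K\<close> and \<open>B\<close> times that of
  \<open>B\<close> and \<open>ginv E\<close>. When \<open>E\<close> and \<open>B\<close> lie in one
  Heisenberg group, the second is central.\<close>

lemma conj_prod_strip: assumes s: "unitary s" and k: "conj_prod s m (E \<circ> K)" and E: "E \<in> elementary" and K: "unitary K" and B: "B \<in> elementary"
  shows "conj_prod s (2 * m) (conjg K B \<circ> ginv B \<circ> (conjg B (ginv E) \<circ> E))"
proof -
  have "conj_prod s (2 * m) (conjg (ginv E) (E \<circ> K \<circ> conjg B (ginv (E \<circ> K))))"
    by (intro conj_prod_conj conj_prod_commutator s k elementary_inv E B)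
  also have "conjg (ginv E) (E \<circ> K \<circ> conjg B (ginv (E \<circ> K))) = conjg K B \<circ> ginv B \<circ> (conjg B (ginv E) \<circ> E)"
    using E K B by (simp add: ginv_comp cancel comp_assoc)
  finally show ?thesis .
qed

lemma conj_prod_cancel_left: assumes s: "unitary s" and a: "conj_prod s m a" and ab: "conj_prod s m' (a \<circ> b)"
  shows "conj_prod s (m + m') b"
  using conj_prod_comp[OF conj_prod_inv[OF s a] ab] by (simp add: cancel[OF conj_prod_unitary[OF s a]])

lemma conj_prod_cancel_right: assumes s: "unitary s" and b: "conj_prod s m b" and ab: "conj_prod s m' (a \<circ> b)"
  shows "conj_prod s (m' + m) a"
  using conj_prod_comp[OF ab conj_prod_inv[OF s b]] by (simp add: cancel[OF conj_prod_unitary[OF s b]])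

subsection \<open>Moving root elements\<close>

text \<open>\<open>ev i\<close> becomes \<open>ev i + ev k\<close>, then \<open>ev i\<close> is
  subtracted. No unit is left on \<open>ev k\<close>, so the parameters of moved root elements do
  not change.\<close>

lemma move_vec:
  assumes "i \<in> Om" "k \<in> Om" "k \<noteq> i" "k \<noteq> - i"
  obtains g where "g \<in> elementary" "g (ev i) = ev k" "\<And>j. j \<in> Om \<Longrightarrow> j \<noteq> i \<Longrightarrow> j \<noteq> - i \<Longrightarrow> j \<noteq> k \<Longrightarrow> j \<noteq> - k \<Longrightarrow> g (ev j) = ev j"
proof (rule that)
  let ?g = "S i (- k) (- bar (mu (- k))) \<circ> S k (- i) (bar (mu (- i)))"
  show "?g \<in> elementary"
    using assms by (intro elementary_comp elementary_S) auto
  show "?g (ev i) = ev k"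
    using assms Om_nz[OF assms(1)] Om_nz[OF assms(2)]
    by (intro ext) (simp add: transv_def)
  show "?g (ev j) = ev j" if "j \<in> Om" "j \<noteq> i" "j \<noteq> - i" "j \<noteq> k" "j \<noteq> - k" for j
    using assms that by (intro ext) (simp add: transv_def)
qed

lemma move_S:
  assumes s: "unitary s" and P: "conj_prod s m (S i j x)"
    and "i \<in> Om" "j \<in> Om" "i \<noteq> j" "i \<noteq> - j" "k \<in> Om" "k \<noteq> i" "k \<noteq> - i" "k \<noteq> j" "k \<noteq> - j"
  shows "conj_prod s m (S k j x)"
proof -
  obtain g where g: "g \<in> elementary" "g (ev i) = ev k" "g (ev j) = ev j"
    using move_vec[of i k] assms by (metis minus_minus)
  show ?thesis using conj_prod_conj[OF g(1) P] g by (simp add: transv_conj)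
qed

lemma move_S_first:
  assumes s: "unitary s" and P: "conj_prod s m (S i j x)"
    and ij: "i \<in> Om" "j \<in> Om" "i \<noteq> j" "i \<noteq> - j" and k: "k \<in> Om" "k \<noteq> j" "k \<noteq> - j"
  shows "conj_prod s m (S k j x)"
proof (cases "k = i \<or> k = - i")
  case True
  obtain r where r: "r \<in> Om" "r \<noteq> i" "r \<noteq> - i" "r \<noteq> j" "r \<noteq> - j"
    using third_index[of i j] by metis
  have "conj_prod s m (S r j x)" using move_S[OF s P ij] r by simp
  from move_S[OF s this, of k] show ?thesis using True r ij k by auto
qed (use move_S[OF s P ij k(1)] k in simp)

text \<open>The second index is moved like the first one after \<open>transv_swap\<close>. If
  \<open>k\<close> is the old second index or its opposite, that index is moved out of the way
  beforehand.\<close>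

lemma move_S_all:
  assumes s: "unitary s" and P: "conj_prod s m (S i j x)"
    and ij: "i \<in> Om" "j \<in> Om" "i \<noteq> j" "i \<noteq> - j" and kl: "k \<in> Om" "l \<in> Om" "k \<noteq> l" "k \<noteq> - l"
  shows "conj_prod s m (S k l x)"
proof -
  have fst: "conj_prod s m (S k' j' x)" if "conj_prod s m (S i' j' x)" "i' \<in> Om" "j' \<in> Om" "i' \<noteq> j'" "i' \<noteq> - j'"
    "k' \<in> Om" "k' \<noteq> j'" "k' \<noteq> - j'" for i' j' k'
    using move_S_first[OF s that] .
  have snd: "conj_prod s m (S i' k' x)" if "conj_prod s m (S i' j' x)" "i' \<in> Om" "j' \<in> Om" "i' \<noteq> j'" "i' \<noteq> - j'"
    "k' \<in> Om" "k' \<noteq> i'" "k' \<noteq> - i'" for i' j' k'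
  proof -
    have P': "conj_prod s m (S j' i' (- (bar lam * bar x)))"
      using that(1) by (subst (asm) transv_swap)
    have "conj_prod s m (S k' i' (- (bar lam * bar x)))"
      by (rule move_S_first[OF s P']) (use that in auto)
    then show ?thesis by (subst transv_swap)
  qed
  show ?thesis
  proof (cases "k = j \<or> k = - j")
    case True
    obtain r where r: "r \<in> Om" "r \<noteq> i" "r \<noteq> - i" "r \<noteq> j" "r \<noteq> - j"
      using third_index[of i j] by metis
    have "conj_prod s m (S i r x)" using snd[OF P] ij r by simp
    then have "conj_prod s m (S k r x)" using True r ij kl by (intro fst[of i r k]) auto
    then show ?thesis using True r ij kl by (intro snd[of k r l]) auto
  next
    case False
    have "conj_prod s m (S k j x)" using fst[OF P] ij kl False by simp
    then show ?thesis using False kl ij by (intro snd[of k j l]) auto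
  qed
qed

text \<open>Demanding all multiples of \<open>x\<close> makes the count invariant under multiplication by ring elements.\<close>

definition good :: "('a vect \<Rightarrow> 'a vect) \<Rightarrow> nat \<Rightarrow> 'a \<Rightarrow> bool" where
  "good s c x \<longleftrightarrow> (\<forall>r. \<forall>i\<in>Om. \<forall>j\<in>Om. i \<noteq> j \<longrightarrow> i \<noteq> - j \<longrightarrow> conj_prod s c (S i j (x * r)))"

lemma goodI:
  assumes "unitary s" "i \<in> Om" "j \<in> Om" "i \<noteq> j" "i \<noteq> - j" "\<And>r. conj_prod s c (S i j (x * r))"
  shows "good s c x"
  unfolding good_def using assms(2-) move_S_all[OF assms(1)] by blast

lemma goodD:
  "good s c x \<Longrightarrow> i \<in> Om \<Longrightarrow> j \<in> Om \<Longrightarrow> i \<noteq> j \<Longrightarrow> i \<noteq> - j \<Longrightarrow> conj_prod s c (S i j (x * r))"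
  by (simp add: good_def)

lemma goodD1:
  "good s c x \<Longrightarrow> i \<in> Om \<Longrightarrow> j \<in> Om \<Longrightarrow> i \<noteq> j \<Longrightarrow> i \<noteq> - j \<Longrightarrow> conj_prod s c (S i j x)"
  using goodD[of s c x i j 1] by simp

lemma good_mult: "good s c x \<Longrightarrow> good s c (x * r)"
  by (simp add: good_def mult.assoc)

lemma good_mult': "good s c x \<Longrightarrow> good s c (r * x)"
  by (simp add: good_mult mult.commute[of r])

lemma good_minus: "good s c (- x) \<longleftrightarrow> good s c x"
  using good_mult[of s c x "-1"] good_mult[of s c "-x" "-1"] by auto

lemma good_unit: "good s c (u * x) \<Longrightarrow> u' * u = 1 \<Longrightarrow> good s c x"
  using good_mult'[of s c "u * x" u'] by (simp flip: mult.assoc)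

lemma good_bar: assumes "good s c x" shows "good s c (bar x)"
  unfolding good_def
proof (intro allI ballI impI)
  fix r i j assume "i \<in> Om" "j \<in> Om" "i \<noteq> j" "i \<noteq> - j"
  then have "conj_prod s c (S j i (x * (- (bar lam * bar r))))"
    by (intro goodD[OF assms]) auto
  then show "conj_prod s c (S i j (bar x * r))"
    by (subst transv_swap) (simp add: ac_simps)
qed

lemma good_bar_iff: "good s c (bar x) \<longleftrightarrow> good s c x"
  using good_bar[of s c x] good_bar[of s c "bar x"] by auto

lemma good_add: "good s c x \<Longrightarrow> good s c' y \<Longrightarrow> good s (c + c') (x + y)"
  by (simp add: good_def distrib_right S_add conj_prod_comp)

lemma good_diff: "good s c x \<Longrightarrow> good s c' y \<Longrightarrow> good s (c + c') (x - y)"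
  using good_add[of s c x c' "- y"] by (simp add: good_minus)

lemma good_0: "good s 0 0"
  by (simp add: good_def conj_prod_id)

lemma good_sum:
  assumes "finite T" "\<And>t. t \<in> T \<Longrightarrow> good s (c t) (x t)"
  shows "good s (sum c T) (sum x T)"
  using assms by (induction T rule: finite_induct) (simp_all add: good_0 good_add)

lemma good_trans: "unitary s \<Longrightarrow> conj_prod s a t \<Longrightarrow> good t c x \<Longrightarrow> good s (a * c) x"
  unfolding good_def using conj_prod_trans by blast

lemma good_ginv: "unitary s \<Longrightarrow> good (ginv s) c x \<Longrightarrow> good s c x"
  unfolding good_def using conj_prod_ginv by blast

lemma good_conjg: "unitary s \<Longrightarrow> e \<in> elementary \<Longrightarrow> good (conjg e s) c x \<Longrightarrow> good s c x"
  unfolding good_def using conj_prod_conjg by blast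

section \<open>Long root elements with a trace as parameter\<close>

definition trace_good :: "('a vect \<Rightarrow> 'a vect) \<Rightarrow> nat \<Rightarrow> 'a \<Rightarrow> bool" where
  "trace_good s c z \<longleftrightarrow> (\<forall>i\<in>Om. conj_prod s c (L i (tr z)))"

text \<open>Replacing \<open>ev p\<close> by \<open>ev p + ev m\<close> turns \<open>S m p\<close>
  into its product with \<open>S m m\<close>, which is a long root element; dividing by the original
  factor gives twice the count.\<close>

lemma trace_good_good:
  assumes s: "unitary s" and x: "good s c x" shows "trace_good s (2 * c) (x * r)"
  unfolding trace_good_def
proof
  fix m assume m: "m \<in> Om"
  obtain p where p: "p \<in> Om" "p \<noteq> m" "p \<noteq> - m"
    using third_index[of m m] by metis
  let ?y = "x * (bar lam * r)"
  let ?g = "S m (- p) (bar (mu (- p)))"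
  have g: "?g \<in> elementary" using m p by (intro elementary_S) auto
  have gp: "?g (ev p) = ev p + ev m"
    using m p by (intro ext) (simp add: transv_def)
  have gm: "?g (ev m) = ev m"
    using m p by (intro ext) (simp add: transv_def)
  have P: "conj_prod s c (S m p ?y)"
    using m p by (intro goodD[OF x]) auto
  have "conj_prod s (c + c) (ginv (S m p ?y) \<circ> conjg ?g (S m p ?y))"
    by (intro conj_prod_comp conj_prod_inv s conj_prod_conj g P)
  also have "conjg ?g (S m p ?y) = S m p ?y \<circ> S m m ?y"
    unfolding transv_conj[OF elementary_unitary[OF g]] gp gm
    using m p Om_nz[OF m] by (intro transv_add_right) auto
  also have "ginv (S m p ?y) \<circ> (S m p ?y \<circ> S m m ?y) = S m m ?y"
    using m p by (intro cancel) auto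
  also have "S m m ?y = L m (tr (x * r))"
  proof -
    have "bar lam * bar ?y = bar lam * (lam * bar (x * r))"
      by (simp add: ac_simps)
    moreover have "?y = bar lam * (x * r)"
      by (simp add: ac_simps)
    ultimately have "?y - bar lam * bar ?y = bar lam * tr (x * r)"
      by (simp only: tr_def right_diff_distrib)
    then show ?thesis unfolding transv_same by (rule arg_cong)
  qed
  finally show "conj_prod s (2 * c) (L m (tr (x * r)))" by (simp add: mult_2)
qed

lemma trace_good_add: "trace_good s c x \<Longrightarrow> trace_good s c' y \<Longrightarrow> trace_good s (c + c') (x + y)"
  by (simp add: trace_good_def tr_add L_add conj_prod_comp)

text \<open>\<open>tr (bar x * r')\<close> equals \<open>tr (- (x * lam * bar r'))\<close>, so
  multiples of \<open>x\<close> and of \<open>bar x\<close> are paid for together.\<close>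

lemma trace_good_pair:
  assumes "unitary s" "good s c x" shows "trace_good s (2 * c) (x * r + bar x * r')"
proof -
  have "tr (x * r + bar x * r') = tr (x * (r - lam * bar r'))"
    by (simp add: tr_def algebra_simps lam_ac)
  then show ?thesis using trace_good_good[OF assms, of "r - lam * bar r'"] by (simp add: trace_good_def)
qed

lemma move_L:
  assumes P: "conj_prod s c (L m z)" and "m \<in> Om" "k \<in> Om"
  shows "conj_prod s c (L k z)"
proof -
  have 1: "conj_prod s c (L k' z)" if P: "conj_prod s c (L m' z)" and mk: "m' \<in> Om" "k' \<in> Om" "k' \<noteq> m'" "k' \<noteq> - m'" for m' k'
  proof -
    obtain g where g: "g \<in> elementary" "g (ev m') = ev k'"
      using move_vec[OF mk] by blast
    show ?thesis using conj_prod_conj[OF g(1) P] g by (simp add: long_transv_conj)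
  qed
  obtain r where r: "r \<in> Om" "r \<noteq> m" "r \<noteq> - m" "r \<noteq> k" "r \<noteq> - k"
    using third_index[of m k] by metis
  show ?thesis using 1[OF 1[OF P, of r], of k] assms r by auto
qed

subsection \<open>The unipotent radical of the stabiliser of a basis vector\<close>

text \<open>Heisenberg coordinates: \<open>w\<close> is the vector part and \<open>t\<close> the
  central coordinate. The cocycle of the group law is \<open>- (bar lam * h w w')\<close>.\<close>

definition radical :: "int \<Rightarrow> 'a vect \<Rightarrow> 'a \<Rightarrow> 'a vect \<Rightarrow> 'a vect" where
  "radical m w t v = v + scale (h w v) (ev m) - scale (bar lam * h (ev m) v) w + scale (t * h (ev m) v) (ev m)"

lemma radical_comp:
  assumes "m \<in> Om" "h (ev m) w = 0" "h (ev m) w' = 0"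
  shows "radical m w t \<circ> radical m w' t' = radical m (w + w') (t + t' - bar lam * h w w')"
proof
  fix v
  have "h w (ev m) = 0" using assms(2) by (rule h_zero_swap)
  with assms show "(radical m w t \<circ> radical m w' t') v = radical m (w + w') (t + t' - bar lam * h w w') v"
    by (intro ext) (simp add: radical_def algebra_simps)
qed

lemma radical_id [simp]: "radical m 0 0 = id"
  by (rule ext) (simp add: radical_def)

lemma transv_radical: "transv (ev m) w x = radical m (scale (bar x) w) 0"
  by (rule ext)+ (simp add: transv_def radical_def algebra_simps)

lemma long_transv_radical: "long_transv (ev m) t = radical m 0 t"
  by (rule ext)+ (simp add: long_transv_def radical_def)

lemma radical_ev_self: "m \<in> Om \<Longrightarrow> radical m (scale x (ev m)) 0 = L m (tr (- x))"
  by (rule ext)+ (simp add: long_transv_def radical_def tr_def algebra_simps lam_ac)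

lemma radical_L: assumes "m \<in> Om" "h (ev m) w = 0" shows "radical m w t \<circ> L m z = radical m w (t + bar lam * z)"
  using radical_comp[OF assms, of 0 t "bar lam * z"] by (simp add: long_transv_radical)

text \<open>The central coordinate at which \<open>lam * t + f w w\<close> vanishes; there a radical
  element is a product of short root elements with no long factor left over.\<close>

definition short_coeff :: "'a vect \<Rightarrow> 'a" where "short_coeff w = - (bar lam * f w w)"

text \<open>Under \<open>f\<close> the vector \<open>ev p\<close> pairs with \<open>w\<close> from
  one side only, depending on the sign of \<open>p\<close>. The new factor is put on the side where
  the cocycle agrees with the change of \<open>f w w\<close>.\<close>

lemma radical_short_coeff_add_ev:
  assumes "m \<in> Om" "p \<in> Om" "p \<noteq> m" "p \<noteq> - m" "h (ev m) w = 0" "w p = 0"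
  shows "radical m (w + scale x (ev p)) (short_coeff (w + scale x (ev p))) =
    (if p < 0 then radical m w (short_coeff w) \<circ> S m p (bar x) else S m p (bar x) \<circ> radical m w (short_coeff w))"
proof -
  have 1: "h (ev m) (scale x (ev p)) = 0" using assms by simp
  have 2: "f (ev p) w = 0" if "p < 0" using that assms by (simp add: f_ev)
  have 3: "f w (ev p) = 0" if "\<not> p < 0" using that assms by (simp add: f_ev')
  show ?thesis
    using 2 3 radical_comp[OF assms(1) 1 assms(5), of 0 "short_coeff w"] radical_comp[OF assms(1) assms(5) 1, of "short_coeff w" 0] assms(2)
    by (auto simp: transv_radical short_coeff_def h_f algebra_simps)
qed

text \<open>The counting predicate \<open>Q\<close> is abstract so that one induction serves both
  for membership in \<open>elementary\<close>, with zero counts, and for numbers of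
  conjugates.\<close>

lemma radical_short_coeff_induct:
  assumes D: "finite D" and m: "m \<in> Om"
    and "D \<subseteq> Om - {m, - m}" "\<And>p. p \<notin> D \<Longrightarrow> w p = 0"
    and id: "Q 0 id" and S: "\<And>p. p \<in> D \<Longrightarrow> Q (c p) (S m p (bar (w p)))"
    and comp: "\<And>a b g k. Q a g \<Longrightarrow> Q b k \<Longrightarrow> Q (a + b :: nat) (g \<circ> k)"
  shows "Q (sum c D) (radical m w (short_coeff w))"
  using D assms(3,4) S
proof (induction D arbitrary: w rule: finite_induct)
  case empty
  then have w: "w = 0" by auto
  have "radical m w (short_coeff w) = id" unfolding w short_coeff_def by (simp only: f_0 mult_zero_right minus_zero radical_id)
  with id show "Q (sum c {}) (radical m w (short_coeff w))" by (simp only: sum.empty)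
next
  case (insert p D)
  let ?w = "w(p := 0)"
  have w: "w = ?w + scale (w p) (ev p)" by (auto simp: ev_def)
  have p: "p \<in> Om" "p \<noteq> m" "p \<noteq> - m" using insert by auto
  have IH: "Q (sum c D) (radical m ?w (short_coeff ?w))"
  proof (rule insert.IH)
    show "Q (c q) (S m q (bar (?w q)))" if "q \<in> D" for q
      using that insert.prems(3)[of q] insert.hyps by (cases "q = p") auto
  qed (use insert.prems insert.hyps in auto)
  have "(- m) \<notin> insert p D" using insert.prems by auto
  then have hm: "h (ev m) ?w = 0" using m insert.prems(2)[of "- m"] by (simp add: h_ev)
  have S: "Q (c p) (S m p (bar (w p)))" using insert by auto
  show ?case
    using comp[OF IH S] comp[OF S IH] radical_short_coeff_add_ev[OF m p hm, of "w p"] insert.hyps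
    by (subst w, subst (2) w) (simp add: add.commute split: if_splits)
qed

lemma radical_short_coeff_elementary:
  assumes "m \<in> Om" "supp w" "w m = 0" "w (- m) = 0"
  shows "radical m w (short_coeff w) \<in> elementary"
proof -
  note ind = radical_short_coeff_induct[where c = "\<lambda>_. 0" and Q = "\<lambda>_ g. g \<in> elementary" and D = "Om - {m, - m}" and m = m and w = w]
  show ?thesis
  proof (rule ind)
    show "w p = 0" if "p \<notin> Om - {m, - m}" for p
      using that assms by (auto simp: supp_def)
    show "S m p (bar (w p)) \<in> elementary" if "p \<in> Om - {m, - m}" for p
      using that assms by (intro elementary_S) auto
  qed (use assms in \<open>auto simp: elementary_id elementary_comp\<close>)
qed

lemma radical_short_coeff_conj_prod:
  assumes "m \<in> Om" "D \<subseteq> Om - {m, - m}" "\<And>p. p \<notin> D \<Longrightarrow> w p = 0" "\<And>p. p \<in> D \<Longrightarrow> good s (c p) (w p)"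
  shows "conj_prod s (sum c D) (radical m w (short_coeff w))"
proof (rule radical_short_coeff_induct[where Q = "conj_prod s"])
  show "finite D" using assms(2) finite_subset[OF _ finite_Om] by auto
  show "conj_prod s (c p) (S m p (bar (w p)))" if "p \<in> D" for p
    using that assms by (intro goodD1 good_bar) auto
qed (use assms in \<open>auto simp: conj_prod_id conj_prod_comp\<close>)

text \<open>\<open>lam\<close> times the excess of \<open>t\<close> over
  \<open>short_coeff w\<close> is a long root parameter.\<close>

lemma radical_elementary:
  assumes "m \<in> Om" "supp w" "w m = 0" "w (- m) = 0" "lam * t + f w w \<in> Lam"
  shows "radical m w t \<in> elementary"
proof -
  have "radical m w t = radical m w (short_coeff w) \<circ> L m (lam * t + f w w)"
    using assms by (subst radical_L) (auto simp: h_ev short_coeff_def algebra_simps lam_ac)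
  then show ?thesis using assms by (simp add: elementary_comp radical_short_coeff_elementary elementary_L)
qed

text \<open>Projection onto the orthogonal complement of the hyperbolic plane of \<open>ev m\<close>
  and \<open>ev (- m)\<close>. In the radical, an \<open>ev m\<close> component contributes just a
  long root factor.\<close>

definition cut :: "int \<Rightarrow> 'a vect \<Rightarrow> 'a vect" where
  "cut m v = (\<lambda>i. if i = m \<or> i = - m then 0 else v i)"

lemma cut_simps [simp]: "cut m v m = 0" "cut m v (- m) = 0" "i \<noteq> m \<Longrightarrow> i \<noteq> - m \<Longrightarrow> cut m v i = v i"
  by (simp_all add: cut_def)

lemma cut_supp [simp]: "supp v \<Longrightarrow> supp (cut m v)"
  by (simp add: supp_def cut_def)

lemma h_cut [simp]: "m \<in> Om \<Longrightarrow> h (ev m) (cut m v) = 0"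
  by (simp add: h_ev)

lemma cut_split: "m \<in> Om \<Longrightarrow> v (- m) = 0 \<Longrightarrow> v = cut m v + scale (v m) (ev m)"
  by (auto simp: cut_def ev_def Om_nz)

lemma f_cut: "m \<in> Om \<Longrightarrow> v (- m) = 0 \<Longrightarrow> f v v = f (cut m v) (cut m v)"
  by (subst (1 2) cut_split[of m v]) (simp_all add: f_ev f_ev' Om_nz)

lemma radical_cut:
  assumes "m \<in> Om" "v (- m) = 0"
  shows "radical m v 0 = radical m (cut m v) 0 \<circ> L m (tr (- v m))"
proof -
  have "h (cut m v) (ev m) = 0" using assms h_zero_swap h_cut by blast
  then have "radical m (cut m v) 0 \<circ> radical m (scale (v m) (ev m)) 0 = radical m (cut m v + scale (v m) (ev m)) 0"
    using assms by (subst radical_comp) simp_all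
  also have "cut m v + scale (v m) (ev m) = v" using cut_split[of m v] assms by simp
  finally show ?thesis unfolding radical_ev_self[OF assms(1)] by (rule sym)
qed

lemma radical_zero_elementary:
  assumes "m \<in> Om" "supp v" "v (- m) = 0" "f v v \<in> Lam"
  shows "radical m v 0 \<in> elementary"
  unfolding radical_cut[of m v, OF assms(1,3)]
  using assms f_cut[of m v, OF assms(1,3)] by (intro elementary_comp elementary_L radical_elementary) auto

lemma transv_ev_elementary:
  assumes "m \<in> Om" "supp v" "v (- m) = 0" "f v v \<in> Lam"
  shows "transv (ev m) v x \<in> elementary"
  unfolding transv_radical using assms norm_Lam[OF assms(4), of "bar x"]
  by (intro radical_zero_elementary) (auto simp: ac_simps)

text \<open>Only opposite indices are excluded: coinciding ones are allowed, and the corresponding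
  factor is then a long root element.\<close>

lemma transv_two_elementary:
  assumes "i \<in> Om" "j \<in> Om" "k \<in> Om" "l \<in> Om"
    "i \<noteq> - j" "i \<noteq> - k" "i \<noteq> - l" "j \<noteq> - k" "j \<noteq> - l" "k \<noteq> - l"
  shows "transv (scale x (ev i) + scale y (ev j)) (scale z (ev k) + scale w (ev l)) t =
     S i k (t * bar z * x) \<circ> S i l (t * bar w * x) \<circ> (S j k (t * bar z * y) \<circ> S j l (t * bar w * y))"
    "transv (scale x (ev i) + scale y (ev j)) (scale z (ev k) + scale w (ev l)) t \<in> elementary"
proof -
  show 1: "transv (scale x (ev i) + scale y (ev j)) (scale z (ev k) + scale w (ev l)) t =
     S i k (t * bar z * x) \<circ> S i l (t * bar w * x) \<circ> (S j k (t * bar z * y) \<circ> S j l (t * bar w * y))"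
  proof -
    have "transv (scale x (ev i) + scale y (ev j)) (scale z (ev k) + scale w (ev l)) t =
        transv (scale x (ev i)) (scale z (ev k) + scale w (ev l)) t \<circ> transv (scale y (ev j)) (scale z (ev k) + scale w (ev l)) t"
      using assms by (intro transv_add_left) auto
    also have "transv (scale x (ev i)) (scale z (ev k) + scale w (ev l)) t =
        transv (scale x (ev i)) (scale z (ev k)) t \<circ> transv (scale x (ev i)) (scale w (ev l)) t"
      using assms by (intro transv_add_right) auto
    also have "transv (scale y (ev j)) (scale z (ev k) + scale w (ev l)) t =
        transv (scale y (ev j)) (scale z (ev k)) t \<circ> transv (scale y (ev j)) (scale w (ev l)) t"
      using assms by (intro transv_add_right) auto
    finally show ?thesis by (simp only: transv_scale mult.assoc mult.commute[of x] mult.commute[of y])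
  qed
  show "transv (scale x (ev i) + scale y (ev j)) (scale z (ev k) + scale w (ev l)) t \<in> elementary"
    unfolding 1 using assms by (intro elementary_comp elementary_S)
qed

subsection \<open>Products of two entries of a column\<close>

text \<open>\<open>C\<close> fixes \<open>ev m\<close>, hence commutes with the uncontrolled long
  root factor, which cancels in the commutator with \<open>C\<close>.\<close>

lemma conj_prod_kill_long:
  assumes s: "unitary s" and P: "conj_prod s c (G \<circ> long_transv (ev m) t)" and m: "m \<in> Om" and G: "unitary G"
    and C: "C \<in> elementary" "C (ev m) = ev m"
  shows "conj_prod s (2 * c) (G \<circ> conjg C (ginv G))"
proof -
  have t: "bij (long_transv (ev m) t)" "ginv (long_transv (ev m) t) = long_transv (ev m) (- t)"
    using m by (simp_all add: long_transv_inverse)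
  have t': "long_transv (ev m) t \<circ> long_transv (ev m) (- t) = id"
    using m by (simp add: long_transv_add_coeff)
  have "ginv (G \<circ> long_transv (ev m) t) = long_transv (ev m) (- t) \<circ> ginv G"
    using G t by (simp add: o_inv_distrib unitary_bij)
  moreover have "conjg C (long_transv (ev m) (- t)) = long_transv (ev m) (- t)"
    using C by (simp add: long_transv_conj)
  ultimately have "G \<circ> long_transv (ev m) t \<circ> conjg C (ginv (G \<circ> long_transv (ev m) t)) =
      G \<circ> long_transv (ev m) t \<circ> (long_transv (ev m) (- t) \<circ> conjg C (ginv G))"
    using C by (simp only: conjg_comp elementary_unitary)
  also have "\<dots> = G \<circ> (long_transv (ev m) t \<circ> long_transv (ev m) (- t)) \<circ> conjg C (ginv G)"
    by (simp only: comp_assoc)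
  finally have "G \<circ> long_transv (ev m) t \<circ> conjg C (ginv (G \<circ> long_transv (ev m) t)) = G \<circ> conjg C (ginv G)"
    by (simp add: t')
  then show ?thesis using conj_prod_commutator[OF s P C(1)] by simp
qed

text \<open>If \<open>\<tau>\<close> fixes the column \<open>\<sigma> e\<^sub>m\<close>, then \<open>\<sigma>\<^sup>-\<^sup>1 \<tau> \<sigma>\<close> normalises the unipotent radical attached to
  \<open>e\<^sub>m\<close>, which is Heisenberg with centre the long root subgroup.  Hence commuting twice with elements
  of the radical leaves only a matrix in \<open>\<tau>\<close>, up to a central factor.\<close>

lemma conj_prod_eight:
  assumes s: "unitary s" and m: "m \<in> Om" and t: "t \<in> elementary" "t (s (ev m)) = s (ev m)"
    and q: "q \<in> Om" "q \<noteq> m" "q \<noteq> - m" and p: "p \<in> Om" "p \<noteq> m" "p \<noteq> - m"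
    and K: "K = transv (t (ev m)) (t (ev q)) (- 1)"
  shows "\<exists>z. conj_prod s 8 (transv (K (ev m)) (K (ev p)) 1 \<circ> S m p (- 1) \<circ> long_transv (ev m) z)"
proof -
  define x where "x = ginv s \<circ> t \<circ> s"
  have ux: "unitary x" using s t by (simp add: x_def)
  have xm: "x (ev m) = ev m"
    using t(2) by (simp add: x_def unitary_inv_app[OF s])
  define E where "E = transv (ev m) (x (ev q)) 1"
  let ?w = "x (ev q)"
  have hw: "h (ev m) ?w = 0"
    using unitary_h[OF ux, of "ev m" "ev q"] xm m q by simp
  have w0: "?w (- m) = 0"
    using hw m mu_cancel(2)[of m "?w (- m)"] by (simp add: h_ev)
  have fw: "f ?w ?w \<in> Lam"
    using q by (intro unitary_f_Lam[OF ux]) (simp add: zero_Lam)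
  have E: "E \<in> elementary"
    unfolding E_def using m q w0 fw by (intro transv_ev_elementary unitary_supp[OF ux]) auto
  have K': "conjg t (S m q (- 1)) = K"
    using t by (simp add: transv_conj K)
  have uK: "unitary K" unfolding K'[symmetric] using t m q by (intro unitary_comp unitary_inv) auto
  have B: "S m p 1 \<in> elementary" using m p by (intro elementary_S) auto
  have T: "S m q 1 \<in> elementary" using m q by (intro elementary_S) auto
  \<comment> \<open>Using \<open>ginv s\<close> in place of \<open>s\<close> makes \<open>x\<close>,
    which fixes \<open>ev m\<close>, act on the first root element; this puts \<open>E\<close> into
    the radical.\<close>
  have "conj_prod (ginv s) 4 (conjg (ginv s \<circ> t \<circ> ginv (ginv s)) (S m q 1) \<circ> conjg t (ginv (S m q 1)))"
    by (rule conj_prod_four[OF unitary_inv[OF s] t(1) T])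
  also have "conjg (ginv s \<circ> t \<circ> ginv (ginv s)) (S m q 1) = E"
    using s transv_conj[OF ux, of "ev m" "ev q" 1] by (simp add: E_def xm flip: x_def)
  also have "ginv (S m q 1) = S m q (- 1)" using m q by (intro S_inv) auto
  finally have "conj_prod s 4 (E \<circ> K)" unfolding K' by (rule conj_prod_ginv[OF s])
  from conj_prod_strip[OF s this E uK B]
  have P: "conj_prod s 8 (conjg K (S m p 1) \<circ> ginv (S m p 1) \<circ> (conjg (S m p 1) (ginv E) \<circ> E))" by simp
  have "ginv E = transv (ev m) ?w (- 1)"
    unfolding E_def using m hw f_Lam_h[OF fw] by (intro transv_inverse) auto
  moreover have "ginv (S m p 1) = S m p (- 1)" using m p by (intro S_inv) auto
  moreover have "h (ev m) (- ?w) = 0" "h (ev m) (- ev p) = 0" "h (ev m) (ev p) = 0"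
    using hw m p by simp_all
  \<comment> \<open>A commutator in the Heisenberg group of \<open>ev m\<close>: the vector parts
    add up to 0 and a central element remains.\<close>
  moreover have "\<exists>z. radical m (ev p) 0 \<circ> radical m (- ?w) 0 \<circ> radical m (- ev p) 0 \<circ> radical m ?w 0 = radical m 0 z"
    using calculation m hw by (simp add: radical_comp) blast
  ultimately have "\<exists>z. conjg (S m p 1) (ginv E) \<circ> E = long_transv (ev m) z"
    by (simp add: E_def transv_radical scale_minus long_transv_radical)
  with P show ?thesis using uK \<open>ginv (S m p 1) = S m p (- 1)\<close> by (auto simp: transv_conj)
qed

text \<open>With \<open>q = - u\<close>, the eight-factor lemma leaves \<open>S m (- u)\<close>,
  whose parameter is the wanted product up to a unit, times a long root element. The commutator with
  \<open>S u p\<close> removes the latter and brings in an arbitrary multiplier.\<close>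

lemma good_entries:
  assumes s: "unitary s" and m: "m \<in> Om" and p: "p \<in> Om" "p \<noteq> m" "p \<noteq> - m" and u: "u \<in> Om" "u \<noteq> m" "u \<noteq> - m"
    and pu: "p \<noteq> u" "p \<noteq> - u"
  shows "good s 16 (s (ev m) p * bar (s (ev m) u))"
proof (rule goodI[OF s m p(1) p(2)[symmetric]])
  show "m \<noteq> - p" using p by auto
  have ne: "m \<noteq> p" "m \<noteq> - p" "- m \<noteq> p" "m \<noteq> u" "m \<noteq> - u" "- m \<noteq> u" "u \<noteq> p" "u \<noteq> - p" "- u \<noteq> p" "- p \<noteq> u"
    "- p \<noteq> m" "- u \<noteq> m"
    using p u pu by auto
  note neq = ne p u pu m Om_nz[OF m] Om_nz[OF p(1)] Om_nz[OF u(1)]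
  define c where "c = s (ev m)"
  define p1 where "p1 = h (ev (- p)) c"
  define p2 where "p2 = h (ev (- u)) c"
  define p0 where "p0 = h (ev (- m)) c"
  \<comment> \<open>Koszul syzygies of the pairs of entries at \<open>p\<close>, \<open>u\<close>
    and at \<open>m\<close>, \<open>p\<close>: both vectors are orthogonal to the column
    \<open>c\<close>, so \<open>t\<close> fixes \<open>c\<close>.\<close>
  define a where "a = scale (bar p2) (ev (- p)) + scale (- bar p1) (ev (- u))"
  define b where "b = scale (bar p1) (ev (- m)) + scale (- bar p0) (ev (- p))"
  define t where "t = transv a b 1"
  have t: "t \<in> elementary"
    unfolding t_def a_def b_def by (rule transv_two_elementary) (auto simp: neq)
  have "h a c = 0" "h b c = 0"
    by (simp_all add: a_def b_def flip: p0_def p1_def p2_def)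
  then have tc: "t c = c" by (auto simp: t_def transv_def)
  have tm: "t (ev m) = ev m + scale (p1 * mu (- m)) a"
    by (simp add: neq t_def transv_def a_def b_def)
  have tu: "t (ev (- u)) = ev (- u)"
    by (simp add: neq t_def transv_def a_def b_def)
  define K where "K = transv (t (ev m)) (t (ev (- u))) (- 1)"
  define y where "y = bar lam * (mu (- p) * bar (p1 * mu (- m) * bar p2))"
  have Km: "K (ev m) = ev m"
    by (intro ext) (simp add: neq K_def tm tu transv_def a_def)
  have Kp: "K (ev p) = ev p + scale y (ev (- u))"
    by (intro ext) (simp add: neq K_def tm tu transv_def a_def y_def ac_simps)
  obtain z where "conj_prod s 8 (transv (K (ev m)) (K (ev p)) 1 \<circ> S m p (- 1) \<circ> long_transv (ev m) z)"
    using conj_prod_eight[OF s m t _ _ _ _ _ _ _ K_def, of p] tc by (auto simp: neq c_def)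
  moreover have "transv (K (ev m)) (K (ev p)) 1 = S m (- u) (bar y) \<circ> S m p 1"
    unfolding Km Kp by (subst add.commute, subst transv_add_right) (simp_all add: neq transv_scale)
  moreover have "S m (- u) (bar y) \<circ> S m p 1 \<circ> S m p (- 1) = S m (- u) (bar y)"
    by (simp add: neq comp_assoc transv_add_coeff)
  ultimately have P8: "conj_prod s 8 (S m (- u) (bar y) \<circ> long_transv (ev m) z)" by simp
  have "p1 = mu (- p) * c p" "p2 = mu (- u) * c u"
    using p u by (simp_all add: p1_def p2_def h_ev)
  then have y: "bar y = lam * bar (mu (- p)) * mu (- p) * mu (- m) * bar (mu (- u)) * (c p * bar (c u))"
    by (simp add: y_def ac_simps)
  \<comment> \<open>\<open>U\<close> collects all units, and \<open>r\<close> below undoes them so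
    that the multiplier \<open>r0\<close> stays arbitrary.\<close>
  define U where "U = lam * bar (mu (- p)) * mu (- p) * mu (- m) * bar (mu (- u)) * lam * bar (mu u)"
  have U: "norm_one U" by (simp add: U_def)
  fix r0
  define r where "r = bar U * r0"
  define C where "C = S u p r"
  have C: "C \<in> elementary" unfolding C_def by (intro elementary_S) (auto simp: neq)
  have Cm: "C (ev m) = ev m"
    by (intro ext) (simp add: neq C_def transv_def)
  have Cu: "C (ev (- u)) = ev (- u) + scale (- (bar lam * bar r * mu u)) (ev p)"
    by (intro ext) (simp add: neq C_def transv_def)
  have "conj_prod s (2 * 8) (S m (- u) (bar y) \<circ> conjg C (ginv (S m (- u) (bar y))))"
    by (rule conj_prod_kill_long[OF s P8 m _ C Cm]) (simp add: neq)
  also have "ginv (S m (- u) (bar y)) = S m (- u) (- bar y)"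
    by (intro S_inv) (auto simp: neq)
  also have "conjg C (S m (- u) (- bar y)) = S m (- u) (- bar y) \<circ> S m p (bar y * lam * r * bar (mu u))"
    unfolding transv_conj[OF elementary_unitary[OF C]] Cm Cu by (subst transv_add_right) (simp_all add: neq transv_scale ac_simps)
  also have "S m (- u) (bar y) \<circ> (S m (- u) (- bar y) \<circ> S m p (bar y * lam * r * bar (mu u))) =
      S m p (bar y * lam * r * bar (mu u))"
    by (simp add: neq transv_add_coeff flip: comp_assoc)
  also have "bar y * lam * r * bar (mu u) = U * (c p * bar (c u) * (bar U * r0))"
    unfolding y U_def r_def by (simp only: ac_simps)
  also have "\<dots> = s (ev m) p * bar (s (ev m) u) * r0"
    using U by (simp add: norm_one_cancel c_def)
  finally show "conj_prod s 16 (S m p (s (ev m) p * bar (s (ev m) u) * r0))" by simp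
qed

text \<open>With an entry at \<open>m\<close> in both syzygies, \<open>K\<close> no longer fixes
  \<open>ev m\<close>: \<open>A\<close> contains an unwanted term with coefficient \<open>g\<close>.
  A commutator with \<open>C\<close> removes the long root factor, and a second one with
  \<open>C2\<close> cancels everything that involves \<open>g\<close>.\<close>

lemma good_entries_diag:
  assumes s: "unitary s" and m: "m \<in> Om" and u: "u \<in> Om" "u \<noteq> m" "u \<noteq> - m"
  shows "good s 32 (s (ev m) u * bar (s (ev m) m))"
proof -
  obtain p where p: "p \<in> Om" "p \<noteq> m" "p \<noteq> - m" "p \<noteq> u" "p \<noteq> - u"
    using third_index[of m u] by metis
  have ne: "m \<noteq> p" "m \<noteq> - p" "- m \<noteq> p" "m \<noteq> u" "m \<noteq> - u" "- m \<noteq> u" "u \<noteq> p" "u \<noteq> - p" "- u \<noteq> p" "- p \<noteq> u"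
    "- p \<noteq> m" "- u \<noteq> m"
    using p u by auto
  note neq = ne p u m Om_nz[OF m] Om_nz[OF p(1)] Om_nz[OF u(1)]
  define c where "c = s (ev m)"
  define p1 where "p1 = h (ev (- p)) c"
  define p2 where "p2 = h (ev (- u)) c"
  define p0 where "p0 = h (ev (- m)) c"
  define a where "a = scale (bar p2) (ev (- m)) + scale (- bar p0) (ev (- u))"
  define b where "b = scale (bar p1) (ev (- m)) + scale (- bar p0) (ev (- p))"
  define t where "t = transv a b 1"
  have t: "t \<in> elementary"
    unfolding t_def a_def b_def by (rule transv_two_elementary) (auto simp: neq)
  have "h a c = 0" "h b c = 0"
    by (simp_all add: a_def b_def flip: p0_def p1_def p2_def)
  then have tc: "t c = c" by (auto simp: t_def transv_def)
  define am where "am = t (ev m)"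
  have am: "am = ev m + scale (p1 * mu (- m)) a - scale (bar lam * p2 * mu (- m)) b"
    by (simp add: neq am_def t_def transv_def a_def b_def ac_simps)
  have tu: "t (ev (- u)) = ev (- u)"
    by (simp add: neq t_def transv_def a_def b_def)
  define K where "K = transv (t (ev m)) (t (ev (- u))) (- 1)"
  define g where "g = bar lam * h am (ev m)"
  define y where "y = bar lam * h am (ev p)"
  define A where "A = ev m + scale g (ev (- u))"
  define D where "D = ev p + scale y (ev (- u))"
  have Km: "K (ev m) = A"
    unfolding K_def am_def[symmetric] tu A_def g_def by (intro ext) (simp add: neq transv_def)
  have Kp: "K (ev p) = D"
    unfolding K_def am_def[symmetric] tu D_def y_def by (intro ext) (simp add: neq transv_def)
  obtain z where P8: "conj_prod s 8 (transv A D 1 \<circ> S m p (- 1) \<circ> long_transv (ev m) z)"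
    using conj_prod_eight[OF s m t _ _ _ _ _ _ _ K_def, of p] tc by (auto simp: neq c_def Km Kp)
  define rho where "rho = - (bar lam * mu u)"
  define A1 where "A1 = A + scale (g * rho) (ev p)"
  define D1 where "D1 = D + scale (y * rho) (ev p)"
  note hz = A_def D_def A1_def D1_def
  have o: "h A A = 0" "h A D = 0" "h D D = 0" "h D A = 0"
    "h A1 A1 = 0" "h A1 D1 = 0" "h D1 D1 = 0" "h D1 A1 = 0"
    by (simp_all add: neq hz)
  have o': "h A A1 = 0" "h A D1 = 0" "h D A1 = 0" "h D D1 = 0"
    by (simp_all add: neq hz)
  have fA: "f A A \<in> Lam" "f D D \<in> Lam"
    by (simp_all add: neq A_def D_def f_ev zero_Lam)
  have supp: "supp A" "supp D"
    by (simp_all add: neq A_def D_def)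
  have uAD: "unitary (transv A D 1)"
    using o fA supp by (intro transv_unitary) auto
  have invAD: "ginv (transv A D 1) = transv A D (- 1)"
    using o by (intro transv_inverse) auto
  have uG: "unitary (transv A D 1 \<circ> S m p (- 1))"
    using uAD by (intro unitary_comp S_unitary) (auto simp: neq)
  have invG: "ginv (transv A D 1 \<circ> S m p (- 1)) = S m p 1 \<circ> transv A D (- 1)"
  proof -
    have "ginv (S m p (- 1)) = S m p (- (- 1))" by (intro S_inv) (auto simp: neq)
    then show ?thesis using uAD by (simp add: neq ginv_comp invAD)
  qed
  define C where "C = S u p 1"
  have C: "C \<in> elementary" unfolding C_def by (intro elementary_S) (auto simp: neq)
  have Cm: "C (ev m) = ev m" "C (ev p) = ev p"
    by (intro ext; simp add: neq C_def transv_def)+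
  have Cu: "C (ev (- u)) = ev (- u) + scale rho (ev p)"
    by (intro ext) (simp add: neq C_def transv_def rho_def)
  have CA: "C A = A1" "C D = D1"
    unfolding A1_def D1_def A_def D_def unitary_lin[OF elementary_unitary[OF C]] Cm Cu
    by (simp_all add: scale_add add.assoc)
  have "conj_prod s (2 * 8) (transv A D 1 \<circ> S m p (- 1) \<circ> conjg C (ginv (transv A D 1 \<circ> S m p (- 1))))"
    by (rule conj_prod_kill_long[OF s P8 m uG C Cm(1)])
  also have "conjg C (ginv (transv A D 1 \<circ> S m p (- 1))) = S m p 1 \<circ> transv A1 D1 (- 1)"
    using C by (simp only: invG conjg_comp elementary_unitary transv_conj Cm CA)
  also have "transv A D 1 \<circ> S m p (- 1) \<circ> (S m p 1 \<circ> transv A1 D1 (- 1)) =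
      transv A D 1 \<circ> (S m p (- 1) \<circ> S m p 1) \<circ> transv A1 D1 (- 1)"
    by (simp only: comp_assoc)
  also have "S m p (- 1) \<circ> S m p 1 = id"
    by (simp add: neq transv_add_coeff)
  finally have P16: "conj_prod s (2 * 8) (transv A D 1 \<circ> transv A1 D1 (- 1))" by (simp only: comp_id)
  have y: "bar y = norm_one_u * (c u * bar (c m))"
    if "norm_one_u = lam * bar (mu (- p)) * bar lam * mu (- u) * mu (- m) * bar (mu (- m))" for norm_one_u
  proof -
    have p: "p2 = mu (- u) * c u" "p0 = mu (- m) * c m"
      using u m by (simp_all add: p2_def p0_def h_ev)
    have "am (- p) = bar lam * p2 * mu (- m) * bar p0"
      by (simp add: neq am a_def b_def)
    then have "bar y = lam * (bar (mu (- p)) * (bar lam * p2 * mu (- m) * bar p0))"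
      by (simp add: neq y_def h_ev')
    then show ?thesis by (simp only: that p bar_mult' ac_simps)
  qed
  define U where "U = - (bar lam * mu (- m)) *
    (lam * bar (mu (- p)) * bar lam * mu (- u) * mu (- m) * bar (mu (- m))) * - (lam * bar (mu u))"
  have U: "norm_one U" by (simp add: U_def)
  have mp: "- u \<in> Om" "p \<in> Om" "- u \<noteq> p" "- u \<noteq> - p" by (auto simp: neq)
  show ?thesis
  proof (rule goodI[OF s mp])
    fix r0
    define r where "r = bar (bar U * r0)"
    define nu where "nu = - (bar lam * bar r * mu (- m))"
    \<comment> \<open>Among the basis vectors in \<open>A\<close>, \<open>D\<close>,
      \<open>A1\<close> and \<open>D1\<close> only \<open>ev m\<close> is altered, by the multiple
      \<open>?N\<close> of \<open>ev (- u)\<close>. As \<open>?N\<close> is orthogonal to these four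
      vectors, only the transvection along \<open>?N\<close> and \<open>D1 - D\<close>
      survives.\<close>
    define C2 where "C2 = S (- m) (- u) r"
    have C2: "C2 \<in> elementary" unfolding C2_def by (intro elementary_S) (auto simp: neq)
    have C2m: "C2 (ev m) = ev m + scale nu (ev (- u))"
      by (intro ext) (simp add: neq C2_def transv_def nu_def)
    have C2u: "C2 (ev (- u)) = ev (- u)" "C2 (ev p) = ev p"
      by (intro ext; simp add: neq C2_def transv_def)+
    let ?N = "scale nu (ev (- u))"
    have C2A: "C2 A = A + ?N" "C2 D = D" "C2 A1 = A1 + ?N" "C2 D1 = D1"
      unfolding A1_def D1_def A_def D_def unitary_lin[OF elementary_unitary[OF C2]] C2m C2u
      by (simp_all add: add_ac)
    have N: "h ?N A = 0" "h ?N D = 0" "h ?N A1 = 0" "h ?N D1 = 0" "h A ?N = 0" "h A1 ?N = 0" "h D ?N = 0"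
      by (simp_all add: neq hz)
    have inv1: "ginv (transv A D 1 \<circ> transv A1 D1 (- 1)) = transv A1 D1 1 \<circ> transv A D (- 1)"
    proof -
      have "bij (transv A D 1)" "bij (transv A1 D1 (- 1))" "ginv (transv A1 D1 (- 1)) = transv A1 D1 (- (- 1))"
        using o by (intro transv_inverse; simp)+
      then show ?thesis by (simp add: o_inv_distrib invAD)
    qed
    have "conj_prod s (2 * (2 * 8)) (transv A D 1 \<circ> transv A1 D1 (- 1) \<circ> conjg C2 (ginv (transv A D 1 \<circ> transv A1 D1 (- 1))))"
      by (rule conj_prod_commutator[OF s P16 C2])
    also have "conjg C2 (ginv (transv A D 1 \<circ> transv A1 D1 (- 1))) = transv (A1 + ?N) D1 1 \<circ> transv (A + ?N) D (- 1)"
      using C2 by (simp only: inv1 conjg_comp elementary_unitary transv_conj C2A)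
    also have "transv (A1 + ?N) D1 1 = transv A1 D1 1 \<circ> transv ?N D1 1"
      using o N by (intro transv_add_left) auto
    also have "transv (A + ?N) D (- 1) = transv A D (- 1) \<circ> transv ?N D (- 1)"
      using o N by (intro transv_add_left) auto
    also have "transv A D 1 \<circ> transv A1 D1 (- 1) \<circ> (transv A1 D1 1 \<circ> transv ?N D1 1 \<circ> (transv A D (- 1) \<circ> transv ?N D (- 1))) =
        transv A D 1 \<circ> (transv A1 D1 (- 1) \<circ> transv A1 D1 1) \<circ> (transv ?N D1 1 \<circ> transv A D (- 1)) \<circ> transv ?N D (- 1)"
      by (simp only: comp_assoc)
    also have "transv A1 D1 (- 1) \<circ> transv A1 D1 1 = id"
      using o by (simp add: transv_add_coeff)
    also have "transv ?N D1 1 \<circ> transv A D (- 1) = transv A D (- 1) \<circ> transv ?N D1 1"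
      using N o' by (intro transv_commute) (auto intro: h_zero_swap)
    also have "transv A D 1 \<circ> id \<circ> (transv A D (- 1) \<circ> transv ?N D1 1) \<circ> transv ?N D (- 1) =
        (transv A D 1 \<circ> transv A D (- 1)) \<circ> transv ?N D1 1 \<circ> transv ?N D (- 1)"
      by (simp only: comp_assoc id_comp)
    also have "transv A D 1 \<circ> transv A D (- 1) = id"
      using o by (simp add: transv_add_coeff)
    also have "transv ?N D1 1 = transv ?N (scale (y * rho) (ev p)) 1 \<circ> transv ?N D 1"
      unfolding D1_def by (subst add.commute, intro transv_add_right) (simp_all add: neq D_def)
    also have "id \<circ> (transv ?N (scale (y * rho) (ev p)) 1 \<circ> transv ?N D 1) \<circ> transv ?N D (- 1) =
        transv ?N (scale (y * rho) (ev p)) 1 \<circ> (transv ?N D 1 \<circ> transv ?N D (- 1))"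
      by (simp only: comp_assoc id_comp)
    also have "transv ?N D 1 \<circ> transv ?N D (- 1) = id"
      using o N by (simp add: neq transv_add_coeff)
    also have "transv ?N (scale (y * rho) (ev p)) 1 \<circ> id = S (- u) p (bar y * bar rho * nu)"
      by (simp add: transv_scale)
    also have "bar y * bar rho * nu = U * (c u * bar (c m) * (bar U * r0))"
      unfolding y[OF refl] U_def rho_def nu_def r_def
      by (simp only: bar_mult' bar_uminus bar_bar mult_minus_left mult_minus_right minus_minus ac_simps)
    also have "\<dots> = s (ev m) u * bar (s (ev m) m) * r0"
      using U by (simp add: norm_one_cancel c_def)
    finally show "conj_prod s 32 (S (- u) p (s (ev m) u * bar (s (ev m) m) * r0))" by simp
  qed
qed

subsection \<open>Entries of a matrix\<close>

text \<open>With \<open>z\<close> an entry of column \<open>m\<close>, the commutator \<open>\<tau>\<close> of \<open>\<sigma>\<close> with a root element of parameter \<open>- z\<close>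
  has, modulo products of \<open>z\<close> or \<open>bar z\<close> with other entries, a column with a unit on the diagonal and a unit
  multiple of \<open>bar z\<close> off it.  Applying the previous lemma to \<open>\<tau>\<close> instead of \<open>\<sigma>\<close> isolates \<open>z\<close>.\<close>

lemma good_entry:
  assumes s: "unitary s" and m: "m \<in> Om" and i: "i \<in> Om" "i \<noteq> m" "i \<noteq> - m"
  shows "good s 160 (s (ev m) i)"
proof -
  obtain k where k: "k \<in> Om" "k \<noteq> m" "k \<noteq> - m" "k \<noteq> i" "k \<noteq> - i"
    using third_index[of m i] by metis
  have ne: "m \<noteq> k" "m \<noteq> - k" "- m \<noteq> k" "m \<noteq> i" "m \<noteq> - i" "- m \<noteq> i" "i \<noteq> k" "i \<noteq> - k" "- i \<noteq> k" "- k \<noteq> i"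
    "- k \<noteq> m" "- i \<noteq> m"
    using k i by auto
  note neq = ne i k m Om_nz[OF m] Om_nz[OF i(1)] Om_nz[OF k(1)]
  define c where "c = s (ev m)"
  define z where "z = c i"
  define d where "d = s (ev k)"
  define T where "T = S k m (- z)"
  have T: "T \<in> elementary" unfolding T_def by (intro elementary_S) (auto simp: neq)
  have invT: "ginv T = S k m z" unfolding T_def by (subst S_inv) (auto simp: neq)
  define t where "t = T \<circ> (s \<circ> ginv T \<circ> ginv s)"
  have t2: "conj_prod s 2 t" using conj_prod_two[OF s elementary_inv[OF T]] T by (simp add: t_def)
  have ut: "unitary t" using conj_prod_unitary[OF s t2] .
  define X where "X = z * (mu k * bar (c k))"
  define Y where "Y = bar lam * bar z * (mu k * bar (d k))"
  define w where "w = ev (- k) + scale X d - scale Y c"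
  have "s \<circ> S k m z \<circ> ginv s = transv d c z"
    by (simp only: transv_conj[OF s] c_def d_def)
  then have "t (ev (- k)) = T (transv d c z (ev (- k)))"
    by (simp add: t_def invT)
  then have w: "t (ev (- k)) = T w"
    by (simp add: neq transv_def w_def X_def Y_def h_ev')
  have tm: "t (ev (- k)) m = w m + bar lam * bar z * mu k * w (- k)"
    and tk: "t (ev (- k)) (- k) = w (- k)"
    by (simp_all add: neq w T_def transv_def h_ev)
  have wk: "w (- k) = 1 + X * d (- k) - Y * c (- k)" and wm: "w m = X * d m - Y * c m"
    by (simp_all add: neq w_def)
  \<comment> \<open>The diagonal case for column \<open>- k\<close> of \<open>t\<close>, at the
    entries \<open>m\<close> and \<open>- k\<close>; the factor 2 comes from the two conjugates that
    make up \<open>t\<close>.\<close>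
  have A2: "good s (2 * 32) ((w m + bar lam * bar z * mu k * w (- k)) * bar (w (- k)))"
    using good_trans[OF s t2 good_entries_diag[OF ut, of "- k" m]] by (simp add: neq tm tk)
  have g1: "good s 16 (z * bar (c k))" and g2: "good s 16 (bar z * c k)"
    and g3: "good s 16 (z * bar (c (- k)))" and g4: "good s 16 (bar z * c (- k))"
    and g5: "good s 32 (bar z * c m)"
    using good_entries[OF s m i, of k] good_entries[OF s m i, of "- k"] good_entries_diag[OF s m i]
      good_bar[of s _ "z * bar (c k)"] good_bar[of s _ "z * bar (c (- k))"]
      good_bar[of s _ "z * bar (c m)"]
    by (simp_all add: neq z_def c_def)
  define W where "W = X * d (- k) - Y * c (- k)"
  have W: "w (- k) = 1 + W" by (simp add: wk W_def)
  have eq: "(w m + bar lam * bar z * mu k * w (- k)) * bar (w (- k)) =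
      bar lam * mu k * bar z + (w m * (1 + bar W) + bar lam * mu k * bar z * (W + bar W + W * bar W))"
    by (simp add: W algebra_simps)
  \<comment> \<open>Writing \<open>W + bar W + W * bar W\<close> as
    \<open>W * (1 + bar W) + bar W\<close> lets each of the five good products occur once, so the
    error costs 4 * 16 + 32.\<close>
  have "w m * (1 + bar W) + bar lam * mu k * bar z * (W + bar W + W * bar W) =
     (z * bar (c k)) * (mu k * d m * (1 + bar W) + bar lam * mu k * bar z * (mu k * d (- k)) * (1 + bar W)) +
     (bar z * c k) * (bar lam * mu k * bar z * bar (mu k * d (- k))) +
     (z * bar (c (- k))) * (- (bar lam * mu k * bar z * (lam * bar (mu k) * d k))) +
     (bar z * c (- k)) * (- (bar lam * mu k * bar z * (bar lam * mu k * bar (d k))) * (1 + bar W)) +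
     (bar z * c m) * (- (bar lam * mu k * bar (d k)) * (1 + bar W))"
    (is "_ = ?R")
  proof -
    let ?P = "mu k * d (- k)" and ?Q = "bar lam * mu k * bar (d k)" and ?E = "bar lam * mu k * bar z"
    have eW: "(z * bar (c k)) * ?P - (bar z * c (- k)) * ?Q = W"
      by (simp add: W_def X_def Y_def ac_simps)
    have ebW: "(bar z * c k) * bar ?P - (z * bar (c (- k))) * (lam * bar (mu k) * d k) = bar W"
      unfolding W_def X_def Y_def bar_diff bar_mult' bar_bar by (simp only: ac_simps)
    have ewm: "(z * bar (c k)) * (mu k * d m) - (bar z * c m) * ?Q = w m"
      by (simp add: wm X_def Y_def ac_simps)
    have alg: "(a * M - e * q) * V + E * ((a * p - g * q) * V + (b * p' - c * q')) =
        a * (M * V + E * p * V) + b * (E * p') + c * (- (E * q')) + g * (- (E * q) * V) + e * (- q * V)"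
      for a b c e g p p' q q' E M V :: 'a
      by (simp add: algebra_simps)
    have "w m * (1 + bar W) + ?E * (W + bar W + W * bar W) = w m * (1 + bar W) + ?E * (W * (1 + bar W) + bar W)"
      by (simp add: algebra_simps)
    then show ?thesis
      by (simp only: alg[of "z * bar (c k)" "mu k * d m" "bar z * c m" ?Q "1 + bar W" ?E ?P "bar z * c (- k)"
            "bar z * c k" "bar ?P" "z * bar (c (- k))" "lam * bar (mu k) * d k", symmetric] eW ebW ewm)
  qed
  moreover have "good s (16 + 16 + 16 + 16 + 32) ?R"
    by (intro good_add good_mult g1 g2 g3 g4 g5)
  ultimately have "good s (64 + 96) (bar lam * mu k * bar z)"
    using good_diff[OF A2] unfolding eq by fastforce
  then have "good s 160 (bar lam * mu k * bar z)" by simp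
  then have "good s 160 (bar z)"
    by (rule good_unit[of _ _ "bar lam * mu k" _ "lam * bar (mu k)"]) (simp add: ac_simps lam_ac mu_ac)
  then show ?thesis by (simp add: good_bar_iff z_def c_def)
qed

text \<open>Conjugation by \<open>g\<close> adds row \<open>i\<close> to row \<open>j\<close>,
  replaces column \<open>i\<close> by its difference with column \<open>j\<close>, and keeps column
  \<open>- i\<close>. An off-diagonal entry in row \<open>j\<close> of the conjugate thereby
  involves the entries wanted next.\<close>

lemma conj_vecs:
  assumes i: "i \<in> Om" and j: "j \<in> Om" "j \<noteq> i" "j \<noteq> - i"
  obtains g where "g \<in> elementary" "\<And>v. g v j = v j + v i" "ginv g (ev i) = ev i - ev j" "ginv g (ev (- i)) = ev (- i)"
proof (rule that)
  have ne: "i \<noteq> j" "i \<noteq> - j" "- i \<noteq> j" "- j \<noteq> i" using j by auto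
  let ?g = "S j (- i) (bar (mu (- i)))"
  show "?g \<in> elementary" using ne i j by (intro elementary_S) auto
  show "?g v j = v j + v i" for v
    using ne i j Om_nz[OF i] Om_nz[OF j(1)] by (simp add: transv_def h_ev)
  have inv: "ginv ?g = S j (- i) (- bar (mu (- i)))"
    using ne i j by (intro S_inv) auto
  show "ginv ?g (ev i) = ev i - ev j" "ginv ?g (ev (- i)) = ev (- i)"
    unfolding inv using ne i j Om_nz[OF i] Om_nz[OF j(1)] by (intro ext; simp add: transv_def)+
qed

lemma good_entry_opp:
  assumes s: "unitary s" and i: "i \<in> Om"
  shows "good s 320 (s (ev (- i)) i)"
proof -
  obtain j where j: "j \<in> Om" "j \<noteq> i" "j \<noteq> - i"
    using third_index[of i i] by metis
  obtain g where g: "g \<in> elementary" "\<And>v. g v j = v j + v i" "ginv g (ev (- i)) = ev (- i)"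
    using conj_vecs[OF i j] by metis
  have u: "unitary (conjg g s)" using g s by (intro unitary_comp unitary_inv) auto
  have "good s 160 (conjg g s (ev (- i)) j)"
    using i j by (intro good_conjg[OF s g(1)] good_entry[OF u]) auto
  then have "good s 160 (s (ev (- i)) j + s (ev (- i)) i)"
    by (simp add: g)
  moreover have "good s 160 (s (ev (- i)) j)"
    using i j by (intro good_entry[OF s]) auto
  ultimately show ?thesis
    using good_diff[of s 160 "s (ev (- i)) j + s (ev (- i)) i" 160 "s (ev (- i)) j"] by simp
qed

text \<open>The entry in row \<open>j\<close> and column \<open>i\<close> of the conjugate is the
  wanted difference up to two off-diagonal entries of \<open>s\<close>; hence three times
  160.\<close>

lemma good_diag_diff:
  assumes s: "unitary s" and i: "i \<in> Om" and j: "j \<in> Om" "j \<noteq> i" "j \<noteq> - i"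
  shows "good s 480 (s (ev i) i - s (ev j) j)"
proof -
  obtain g where g: "g \<in> elementary" "\<And>v. g v j = v j + v i" "ginv g (ev i) = ev i - ev j"
    using conj_vecs[OF i j] by metis
  have u: "unitary (conjg g s)" using g s by (intro unitary_comp unitary_inv) auto
  have "good s 160 (conjg g s (ev i) j)"
    using i j by (intro good_conjg[OF s g(1)] good_entry[OF u]) auto
  then have "good s 160 ((s (ev i) i - s (ev j) j) + s (ev i) j - s (ev j) i)"
    by (simp add: g unitary_lin[OF s] algebra_simps)
  moreover have "good s 160 (s (ev i) j)" "good s 160 (s (ev j) i)"
    using i j by (auto intro!: good_entry[OF s])
  ultimately have "good s (160 + 160 + 160)
      (((s (ev i) i - s (ev j) j) + s (ev i) j - s (ev j) i) - s (ev i) j + s (ev j) i)"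
    by (intro good_add good_diff)
  then show ?thesis by simp
qed

lemma good_diag_diff_opp:
  assumes s: "unitary s" and i: "i \<in> Om"
  shows "good s 960 (s (ev i) i - s (ev (- i)) (- i))"
proof -
  obtain j where j: "j \<in> Om" "j \<noteq> i" "j \<noteq> - i"
    using third_index[of i i] by metis
  have "good s (480 + 480) ((s (ev i) i - s (ev j) j) + (s (ev j) j - s (ev (- i)) (- i)))"
    using i j by (intro good_add good_diag_diff[OF s]) auto
  then show ?thesis by simp
qed

subsection \<open>Multiples of good elements in the unipotent radical\<close>

text \<open>An element of the radical whose vector is a multiple \<open>x w\<close> costs a number of conjugates independent of
  \<open>w\<close>, because a suitable conjugation turns the root element with parameter \<open>bar x\<close> into it.\<close>

lemma conj_prod_scaled_radical:
  assumes s: "unitary s" and m: "m \<in> Om" and w: "supp w" "w m = 0" "w (- m) = 0" and eta: "eta \<in> Lam" and x: "good s c x"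
  shows "conj_prod s (3 * c) (radical m (scale x w) (bar lam * (x * bar x * (eta - f w w))))"
proof -
  obtain r where r: "r \<in> Om" "r > 0" "r \<noteq> m" "r \<noteq> - m"
    using third_index[of m m] by metis
  have neq: "m \<noteq> r" "- r \<noteq> m" "- m \<noteq> r" "m \<noteq> - r" using r by auto
  define w' where "w' = cut r w"
  have w': "w' m = 0" "w' (- m) = 0" "w' r = 0" "w' (- r) = 0" "supp w'"
    using neq w by (simp_all add: w'_def)
  have split: "w = scale (w r) (ev r) + w' + scale (w (- r)) (ev (- r))"
    using r Om_nz[OF r(1)] by (intro ext) (auto simp: w'_def cut_def ev_def)
  have fw: "f w w = f w' w' + bar (w r) * w (- r)"
    by (subst (1 2) split) (use r w' in \<open>simp add: f_ev f_ev' Om_nz\<close>)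
  \<comment> \<open>This makes \<open>eta\<close> the value of \<open>b\<close> below, and
    \<open>eta\<close> in \<open>Lam\<close> is what makes \<open>R\<close> elementary.\<close>
  define t where "t = eta - f w' w'"
  define R where "R = radical (- r) (- w') (bar lam * t)"
  have R: "R \<in> elementary"
    unfolding R_def using r w' eta by (intro radical_elementary) (simp_all add: t_def)
  define b where "b = ev r + w' + scale t (ev (- r))"
  have Rr: "R (ev r) = b"
    using r w' neq by (intro ext) (simp add: R_def radical_def b_def h_ev' ac_simps lam_ac)
  have Rm: "R (ev m) = ev m"
    using m r w' neq by (intro ext) (simp add: R_def radical_def h_ev')
  have "conj_prod s c (conjg R (S m r (bar x)))"
    using neq m r by (intro conj_prod_conj R goodD1 good_bar x) auto
  then have P1: "conj_prod s c (radical m (scale x b) 0)"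
    by (simp only: transv_conj[OF elementary_unitary[OF R]] Rr Rm) (simp add: transv_radical)
  have hm: "h (ev m) b = 0" using m r w' neq by (simp add: b_def h_ev)
  \<comment> \<open>\<open>scale x b\<close> and \<open>scale x w\<close> differ only at
    \<open>r\<close> and \<open>- r\<close>; two short root elements with multiples of
    \<open>x\<close> as parameters make up for that.\<close>
  let ?a2 = "scale (x * (w r - 1)) (ev r)" and ?a3 = "scale (x * (w (- r) - t)) (ev (- r))"
  have P2: "conj_prod s c (radical m ?a2 0)" and P3: "conj_prod s c (radical m ?a3 0)"
    using goodD1[OF good_bar[OF good_mult[OF x]], of m r "w r - 1"]
      goodD1[OF good_bar[OF good_mult[OF x]], of m "- r" "w (- r) - t"] neq m r
    by (simp_all add: transv_radical)
  have "conj_prod s (c + c + c) (radical m ?a2 0 \<circ> radical m (scale x b) 0 \<circ> radical m ?a3 0)"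
    by (intro conj_prod_comp P1 P2 P3)
  also have "radical m ?a2 0 \<circ> radical m (scale x b) 0 \<circ> radical m ?a3 0 =
      radical m (?a2 + scale x b + ?a3) (- bar lam * h ?a2 (scale x b) - bar lam * h (?a2 + scale x b) ?a3)"
    using m r hm neq by (subst radical_comp) (simp_all add: radical_comp)
  also have "?a2 + scale x b + ?a3 = scale x w"
    by (subst split) (auto simp: b_def algebra_simps)
  also have "?a2 + scale x b = scale (x * w r) (ev r) + scale x w' + scale (x * t) (ev (- r))"
    by (auto simp: b_def algebra_simps)
  also have "- bar lam * h ?a2 (scale x b) - bar lam * h (scale (x * w r) (ev r) + scale x w' + scale (x * t) (ev (- r))) ?a3 =
      bar lam * (x * bar x * (eta - f w w))"
    using r w' neq Om_nz[OF r(1)] by (simp add: b_def fw t_def h_ev h_ev' algebra_simps)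
  finally have "conj_prod s (c + c + c) (radical m (scale x w) (bar lam * (x * bar x * (eta - f w w))))" .
  moreover have "c + c + c = 3 * c" by simp
  ultimately show ?thesis by (simp only:)
qed

text \<open>The norm difference is \<open>x * bar x\<close> plus cross terms. Times
  \<open>Y\<close>, the former is the cocycle between multiples of \<open>ev r\<close> and
  \<open>ev (- r)\<close>, and the cross terms are a trace, supplied by the \<open>ev m\<close>
  coordinate of \<open>b\<close>. One conjugated short root element gives both, up to two short
  factors.\<close>

lemma conj_prod_norm_shift:
  assumes s: "unitary s" and m: "m \<in> Om" and Y: "Y \<in> Lam" and x: "good s c x" and xY: "good s c' (x * Y)"
  shows "conj_prod s (2 * c + c') (L m (((th + x) * bar (th + x) - th * bar th) * Y))"
proof -
  obtain r where r: "r \<in> Om" "r > 0" "r \<noteq> m" "r \<noteq> - m"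
    using third_index[of m m] by metis
  have neq: "m \<noteq> r" "- r \<noteq> m" "- m \<noteq> r" "m \<noteq> - r" using r by auto
  define R where "R = radical (- r) (scale (bar th * Y) (ev m)) (bar lam * Y)"
  have R: "R \<in> elementary"
    unfolding R_def using r m neq Y by (intro radical_elementary) simp_all
  define b where "b = ev r + scale Y (ev (- r)) + scale (- (bar th * Y)) (ev m)"
  have Rr: "R (ev r) = b"
    using r m neq by (intro ext) (simp add: R_def radical_def b_def ac_simps)
  have Rm: "R (ev m) = ev m"
    using m r neq by (intro ext) (simp add: R_def radical_def)
  have "conj_prod s c (conjg R (S m r (bar x)))"
    using neq m r by (intro conj_prod_conj R goodD1 good_bar x) auto
  then have P1: "conj_prod s c (radical m (scale x b) 0)"
    by (simp only: transv_conj[OF elementary_unitary[OF R]] Rr Rm) (simp add: transv_radical)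
  let ?a1 = "scale x (ev r)" and ?a2 = "scale (x * Y) (ev (- r))" and ?a3 = "scale (- (x * bar th * Y)) (ev m)"
  have P2: "conj_prod s c (radical m ?a1 0)" and P3: "conj_prod s c' (radical m ?a2 0)"
    using goodD1[OF good_bar[OF x], of m r] goodD1[OF good_bar[OF xY], of m "- r"] neq m r
    by (simp_all add: transv_radical)
  let ?z = "x * bar x * Y" and ?Z = "((th + x) * bar (th + x) - th * bar th) * Y"
  have t: "tr (x * bar th * Y) = (x * bar th + bar x * th) * Y"
  proof -
    have "lam * bar (x * bar th * Y) = bar x * th * (lam * bar Y)"
      by (simp add: ac_simps)
    then show ?thesis unfolding tr_def Lam_bar[OF Y] by (simp add: algebra_simps)
  qed
  have h12: "h (ev m) ?a1 = 0" "h (ev m) ?a2 = 0" "h (ev m) (?a1 + ?a2) = 0" "h ?a1 ?a2 = ?z"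
    using m r neq by (simp_all add: ac_simps)
  have "radical m ?a1 0 \<circ> radical m ?a2 0 \<circ> L m ?Z = radical m (?a1 + ?a2) (0 + 0 - bar lam * ?z) \<circ> L m ?Z"
    by (simp only: radical_comp[OF m h12(1,2)] h12(4))
  also have "\<dots> = radical m (?a1 + ?a2) (0 + 0 - bar lam * ?z + bar lam * ?Z)"
    by (rule radical_L[OF m h12(3)])
  also have "0 + 0 - bar lam * ?z + bar lam * ?Z = 0 + bar lam * tr (x * bar th * Y)"
    unfolding t by (simp add: algebra_simps)
  also have "radical m (?a1 + ?a2) (0 + bar lam * tr (x * bar th * Y)) = radical m (?a1 + ?a2) 0 \<circ> L m (tr (x * bar th * Y))"
    by (rule radical_L[OF m h12(3), symmetric])
  also have "L m (tr (x * bar th * Y)) = radical m ?a3 0"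
    using m by (simp add: radical_ev_self)
  also have "radical m (?a1 + ?a2) 0 \<circ> radical m ?a3 0 = radical m (scale x b) 0"
  proof -
    have "?a1 + ?a2 + ?a3 = scale x b" by (auto simp: b_def algebra_simps)
    then show ?thesis using m r neq by (subst radical_comp) (simp_all del: minus_mult_left)
  qed
  finally have eq: "radical m ?a1 0 \<circ> radical m ?a2 0 \<circ> L m ?Z = radical m (scale x b) 0" .
  have "conj_prod s c (radical m ?a1 0 \<circ> radical m ?a2 0 \<circ> L m ?Z)"
    unfolding eq by (rule P1)
  then have "conj_prod s (c + c' + c) (L m ?Z)"
    by (rule conj_prod_cancel_left[OF s conj_prod_comp[OF P2 P3]])
  moreover have "c + c' + c = 2 * c + c'" by simp
  ultimately show ?thesis by (simp only:)
qed

lemma card_Om: "card Om = 2 * n"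
proof -
  have "card Om = card (Omega_plus n) + card (Omega_minus n)"
    unfolding Omega_def by (rule card_Un_disjoint) (auto simp: Omega_plus_def Omega_minus_def)
  then show ?thesis by (simp add: Omega_plus_def Omega_minus_def)
qed

text \<open>In the relation \<open>h (s (ev i)) (s (ev (- i))) = mu i\<close> every summand but one
  contains off-diagonal entries; the total is 320 + 160 * (2 * n - 2).\<close>

lemma good_diag_norm:
  assumes s: "unitary s" and i: "i \<in> Om"
  shows "good s (320 * n) (1 - bar (s (ev i) i) * s (ev (- i)) (- i))"
proof -
  let ?F = "\<lambda>p. mu p * bar (s (ev i) p) * s (ev (- i)) (- p)"
  have "mu i = (\<Sum>p\<in>Om. ?F p)"
    using unitary_h[OF s, of "ev i" "ev (- i)"] i by (simp add: h_def[of "s (ev i)"])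
  also have "\<dots> = ?F i + (\<Sum>p\<in>Om - {i}. ?F p)"
    using i by (simp add: sum.remove)
  finally have eq: "mu i * (1 - bar (s (ev i) i) * s (ev (- i)) (- i)) = (\<Sum>p\<in>Om - {i}. ?F p)"
    by (simp add: algebra_simps)
  have "good s (if p = - i then 320 else 160) (?F p)" if "p \<in> Om - {i}" for p
  proof (cases "p = - i")
    case True
    then show ?thesis using good_mult'[OF good_entry_opp[OF s i]] by simp
  next
    case False
    then have "good s 160 (bar (s (ev i) p))"
      using that i by (intro good_bar good_entry[OF s]) auto
    then show ?thesis using False by (simp add: good_mult good_mult')
  qed
  then have "good s (\<Sum>p\<in>Om - {i}. if p = - i then 320 else 160) (\<Sum>p\<in>Om - {i}. ?F p)"
    by (intro good_sum) auto
  also have "(\<Sum>p\<in>Om - {i}. if p = - i then 320 else 160) = 320 + (\<Sum>p\<in>Om - {i} - {- i}. (160 :: nat))"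
    using i Om_nz[OF i] by (subst sum.remove[of _ "- i"]) (auto intro!: sum.cong)
  also have "\<dots> = 320 * n"
  proof -
    have "card (Om - {i} - {- i}) = 2 * n - 2"
      using i Om_nz[OF i] by (simp add: card_Diff_singleton card_Om)
    then show ?thesis using three_le by simp
  qed
  finally have "good s (320 * n) (mu i * (1 - bar (s (ev i) i) * s (ev (- i)) (- i)))"
    by (simp only: eq)
  then show ?thesis by (rule good_unit[where u' = "bar (mu i)"]) simp
qed

text \<open>Each of the \<open>n\<close> summands contains an off-diagonal entry of column
  \<open>j\<close>; the one belonging to \<open>j\<close> and \<open>- j\<close> costs 320.\<close>

lemma good_value:
  assumes s: "unitary s" and j: "j \<in> Om"
  shows "good s (160 * n + 160) (f (s (ev j)) (s (ev j)))"
proof -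
  let ?c = "s (ev j)"
  have aj: "\<bar>j\<bar> \<in> Omega_plus n" using j by (auto simp: Om_iff Omega_plus_def)
  have O: "p \<in> Om" "p > 0" if "p \<in> Omega_plus n" for p
    using that by (auto simp: Om_iff Omega_plus_def)
  have opp: "good s 320 (?c (- j))"
    using good_entry_opp[OF s, of "- j"] j by simp
  have "good s (if p = \<bar>j\<bar> then 320 else 160) (bar (?c p) * ?c (- p))" if "p \<in> Omega_plus n" for p
  proof (cases "p = \<bar>j\<bar>")
    case True
    then consider "p = j" | "p = - j" by linarith
    then show ?thesis
      by cases (use True opp in \<open>simp_all add: good_mult good_mult' good_bar\<close>)
  next
    case False
    then have "good s 160 (?c (- p))"
      using O[OF that] j by (intro good_entry[OF s]) auto
    then show ?thesis using False by (simp add: good_mult')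
  qed
  then have "good s (\<Sum>p\<in>Omega_plus n. if p = \<bar>j\<bar> then 320 else 160) (f ?c ?c)"
    unfolding f_def by (intro good_sum) (auto simp: Omega_plus_def)
  also have "(\<Sum>p\<in>Omega_plus n. if p = \<bar>j\<bar> then 320 else 160) = 320 + (\<Sum>p\<in>Omega_plus n - {\<bar>j\<bar>}. (160 :: nat))"
    using aj by (subst sum.remove[of _ "\<bar>j\<bar>"]) (auto simp: Omega_plus_def intro!: sum.cong)
  also have "\<dots> = 160 * n + 160"
    using aj three_le by (simp add: card_Diff_singleton, simp add: Omega_plus_def)
  finally show ?thesis .
qed

text \<open>Up to units, row \<open>i\<close> of \<open>s\<close> is the image under
  \<open>bar\<close> of column \<open>- i\<close> of \<open>ginv s\<close>.\<close>

lemma good_row_entries: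
  assumes s: "unitary s" and i: "i \<in> Om" and q: "q \<in> Om" "q \<noteq> i" "q \<noteq> - i"
  shows "r \<in> Om \<Longrightarrow> r \<noteq> i \<Longrightarrow> r \<noteq> - i \<Longrightarrow> q \<noteq> r \<Longrightarrow> q \<noteq> - r \<Longrightarrow> good s 16 (s (ev q) i * bar (s (ev r) i))"
    and "good s 32 (s (ev i) i * bar (s (ev q) i))"
proof -
  let ?c = "ginv s (ev (- i))"
  have e: "s (ev k) i = mu i * bar (mu k) * bar (?c (- k))" if k: "k \<in> Om" for k
  proof -
    have "h (ev k) ?c = h (s (ev k)) (ev (- i))"
      by (rule unitary_h_inv[OF s])
    then have "mu k * ?c (- k) = mu i * bar (s (ev k) i)"
      using i k by (simp add: h_ev h_ev')
    then have "bar (mu k * ?c (- k)) = bar (mu i * bar (s (ev k) i))" by simp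
    then have "mu i * (bar (mu k) * bar (?c (- k))) = s (ev k) i" by simp
    then show ?thesis by (simp add: ac_simps)
  qed
  have us: "unitary (ginv s)" using s by simp
  show "good s 16 (s (ev q) i * bar (s (ev r) i))"
    if "r \<in> Om" "r \<noteq> i" "r \<noteq> - i" "q \<noteq> r" "q \<noteq> - r"
  proof -
    have "good s 16 (?c (- r) * bar (?c (- q)))"
      using that i q by (intro good_ginv[OF s] good_entries[OF us]) auto
    from good_mult'[OF this, of "mu i * bar (mu q) * (bar (mu i) * mu r)"]
    show ?thesis unfolding e[OF q(1)] e[OF that(1)] by (simp only: bar_mult' bar_bar ac_simps)
  qed
  have "good s 32 (?c (- q) * bar (?c (- i)))"
    using i q by (intro good_ginv[OF s] good_entries_diag[OF us]) auto
  from good_mult'[OF this, of "mu i * bar (mu i) * (bar (mu i) * mu q)"]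
  show "good s 32 (s (ev i) i * bar (s (ev q) i))" unfolding e[OF q(1)] e[OF i] by (simp only: bar_mult' bar_bar ac_simps)
qed

subsection \<open>The value of a column\<close>

lemma lam_ac_deep: "lam * (x * (y * bar lam)) = x * y" "lam * (x * (y * (bar lam * z))) = x * (y * z)"
  "lam * (x * (y * (z * (bar lam * w)))) = x * (y * (z * w))"
proof -
  have "lam * (x * (y * bar lam)) = (lam * bar lam) * (x * y)"
    "lam * (x * (y * (bar lam * z))) = (lam * bar lam) * (x * (y * z))"
    "lam * (x * (y * (z * (bar lam * w)))) = (lam * bar lam) * (x * (y * (z * w)))"
    by (simp_all only: ac_simps)
  then show "lam * (x * (y * bar lam)) = x * y" "lam * (x * (y * (bar lam * z))) = x * (y * z)"
    "lam * (x * (y * (z * (bar lam * w)))) = x * (y * (z * w))"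
    by (simp_all only: lam_unit mult_1_left)
qed

lemma f_sum_four:
  "f (u0 + u1 + u2 + u3) (u0 + u1 + u2 + u3) = f u0 u0 + f u1 u1 + f u2 u2 + f u3 u3 +
    (h u0 u1 + h (u0 + u1) u2 + h (u0 + u1 + u2) u3) +
    tr (f u1 u0 + f u2 (u0 + u1) + f u3 (u0 + u1 + u2))"
  by (simp add: h_f tr_def algebra_simps)

lemma radical_comp_four:
  assumes "m \<in> Om" "h (ev m) u0 = 0" "h (ev m) u1 = 0" "h (ev m) u2 = 0" "h (ev m) u3 = 0"
  shows "radical m u0 0 \<circ> (radical m u1 s1 \<circ> radical m u2 s2 \<circ> radical m u3 s3 \<circ> L m z) = radical m (u0 + u1 + u2 + u3)
    (s1 + s2 + s3 + bar lam * z - bar lam * (h u0 u1 + h (u0 + u1) u2 + h (u0 + u1 + u2) u3))"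
proof -
  have "radical m u0 0 \<circ> (radical m u1 s1 \<circ> radical m u2 s2 \<circ> radical m u3 s3 \<circ> L m z) =
      radical m u0 0 \<circ> radical m u1 s1 \<circ> radical m u2 s2 \<circ> radical m u3 s3 \<circ> L m z"
    by (simp only: comp_assoc)
  also have "\<dots> = radical m (u0 + u1 + u2 + u3)
    (s1 + s2 + s3 + bar lam * z - bar lam * (h u0 u1 + h (u0 + u1) u2 + h (u0 + u1 + u2) u3))"
    using assms by (simp add: radical_comp radical_L) (simp add: algebra_simps)
  finally show ?thesis .
qed

lemma tr_scale: "x * bar x * tr z = tr (x * bar x * z)"
  by (simp add: tr_def algebra_simps)

lemma tr_diff: "tr (x - y) = tr x - tr y"
  by (simp add: tr_def algebra_simps)

lemma cut_lin: "cut m (u + v) = cut m u + cut m v" "cut m (u - v) = cut m u - cut m v"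
  "cut m (scale x v) = scale x (cut m v)"
  by (auto simp: cut_def)

text \<open>The count is (4 + 192) for \<open>Re\<close>, (640 n + 192) + 144 + 960 for its three
  vector parts, 1696 for the trace, 96 for passing to \<open>th\<close>, and 800 n + 1120 for
  passing from \<open>th\<close> to 1. Positivity of \<open>p\<close> makes \<open>f\<close> vanish
  when its second argument is \<open>ev p\<close>.\<close>

lemma conj_prod_value:
  assumes s: "unitary s" and j: "j \<in> Om" and m: "m \<in> Om" "m > 0" "m \<noteq> j" "m \<noteq> - j"
    and p: "p \<in> Om" "p > 0" "p \<noteq> m" "p \<noteq> - m" "p \<noteq> j" "p \<noteq> - j"
  shows "conj_prod s (1440 * n + 4404) (L m (f (s (ev j)) (s (ev j))))"
proof -
  have ne: "j \<noteq> m" "j \<noteq> - m" "- m \<noteq> j" "- j \<noteq> m" "m \<noteq> p" "m \<noteq> - p" "- p \<noteq> m" "- m \<noteq> p" "j \<noteq> p" "j \<noteq> - p"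
    "- p \<noteq> j" "- j \<noteq> p" "- m \<noteq> m" "- p \<noteq> p" "- j \<noteq> j" "j \<noteq> - j" "- m \<noteq> - p" "- p \<noteq> - m"
    using m p Om_nz[OF j] by auto
  note neq = ne m p j Om_nz[OF j] Om_nz[OF m(1)] Om_nz[OF p(1)]
  define Cj where "Cj = s (ev j)"
  define Cm where "Cm = s (ev (- m))"
  define Cp where "Cp = s (ev (- p))"
  \<comment> \<open>Up to sign the coefficients are entries of row \<open>- m\<close>, arranged so
    that \<open>A\<close> and \<open>B\<close> vanish at \<open>- m\<close>; therefore
    \<open>x\<close> below fixes \<open>ev m\<close>.\<close>
  define al where "al = Cm (- m)"
  define be where "be = - Cj (- m)"
  define be' where "be' = - Cp (- m)"
  define A where "A = scale al Cj + scale be Cm"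
  define B where "B = scale al Cp + scale be' Cm"
  define Y where "Y = f Cj Cj"
  have supps: "supp Cj" "supp Cm" "supp Cp"
    by (simp_all add: neq Cj_def Cm_def Cp_def unitary_supp[OF s])
  have Lams: "Y \<in> Lam" "f Cm Cm \<in> Lam" "f Cp Cp \<in> Lam"
    by (auto simp: neq Y_def Cj_def Cm_def Cp_def zero_Lam intro!: unitary_f_Lam[OF s])
  have hC: "h Cj Cm = 0" "h Cj Cp = 0" "h Cm Cp = 0" "h Cp Cm = 0" "h Cm Cj = 0" "h Cm Cm = 0"
    by (simp_all add: neq Cj_def Cm_def Cp_def unitary_h[OF s])
  have AB0: "A (- m) = 0" "B (- m) = 0"
    by (simp_all add: A_def B_def al_def be_def be'_def)
  have hAB: "h A B = 0" using hC by (simp add: A_def B_def)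
  have suppAB: "supp A" "supp B" using supps by (simp_all add: A_def B_def)

  have Bm1: "good s 160 be" and Ajp: "good s 160 (Cj (- p))" and Ajm: "good s 160 (Cj m)" and Ajj: "good s 320 (Cj (- j))"
    using good_entry_opp[OF s, of "- j"]
    by (auto simp: neq be_def Cj_def good_minus intro!: good_entry[OF s])
  have g_al_be': "good s 32 (al * bar be')"
  proof -
    have "good s 32 (Cm (- m) * bar (Cp (- m)))"
      unfolding Cm_def Cp_def by (rule good_row_entries(2)[OF s]) (auto simp: neq)
    then show ?thesis by (simp add: al_def be'_def good_minus)
  qed
  have g_be_al: "good s 32 (be * bar al)"
  proof -
    have "good s 32 (Cm (- m) * bar (Cj (- m)))"
      unfolding Cm_def Cj_def by (rule good_row_entries(2)[OF s]) (auto simp: neq)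
    from good_bar[OF this] show ?thesis by (simp add: al_def be_def good_minus mult.commute)
  qed
  have g_be_be': "good s 16 (be * bar be')"
  proof -
    have "good s 16 (Cj (- m) * bar (Cp (- m)))"
      unfolding Cj_def Cp_def by (rule good_row_entries(1)[OF s]) (auto simp: neq)
    then show ?thesis by (simp add: be'_def be_def good_minus)
  qed

  define t where "t = transv (scale al (ev j) + scale be (ev (- m))) (scale al (ev (- p)) + scale be' (ev (- m))) 1"
  \<comment> \<open>The factor free of \<open>be\<close> and \<open>be'\<close> is split off. The
    other three have parameters treated already and cost 32 each.\<close>
  define t0 where "t0 = S j (- p) (1 * bar al * al)"
  define pi where "pi = S j (- m) (1 * bar be' * al) \<circ>
    (S (- m) (- p) (1 * bar al * be) \<circ> S (- m) (- m) (1 * bar be' * be))"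
  have t: "t \<in> elementary"
    unfolding t_def by (rule transv_two_elementary(2)) (auto simp: neq)
  have t_split: "t = t0 \<circ> pi"
    unfolding t_def t0_def pi_def by (subst transv_two_elementary(1)) (auto simp: neq comp_assoc)
  have t0: "t0 \<in> elementary" unfolding t0_def by (intro elementary_S) (auto simp: neq)
  have P_pi: "conj_prod s 96 pi"
  proof -
    have 1: "conj_prod s 32 (S j (- m) (1 * bar be' * al))"
      using goodD1[OF g_al_be', of j "- m"] by (simp add: neq mult.commute)
    have 2: "conj_prod s 32 (S (- m) (- p) (1 * bar al * be))"
      using goodD1[OF g_be_al, of "- m" "- p"] by (simp add: neq mult.commute)
    have "trace_good s (2 * 16) (be * bar be' * lam)"
      by (rule trace_good_good[OF s g_be_be'])
    then have "conj_prod s 32 (L (- m) (tr (be * bar be' * lam)))"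
      by (simp add: neq trace_good_def)
    moreover have "S (- m) (- m) (1 * bar be' * be) = L (- m) (tr (be * bar be' * lam))"
      unfolding transv_same by (rule arg_cong[where f = "long_transv _"]) (simp add: tr_def algebra_simps lam_ac)
    ultimately have 3: "conj_prod s 32 (S (- m) (- m) (1 * bar be' * be))" by simp
    from conj_prod_comp[OF 1 conj_prod_comp[OF 2 3]] show ?thesis by (simp add: pi_def)
  qed
  have u_pi: "unitary pi" using conj_prod_unitary[OF s P_pi] .

  \<comment> \<open>The multiplier of the column will be
    \<open>bar y * al * bar al * bar (Cp (- p))\<close> up to \<open>lam\<close> and a good term. Up
    to \<open>bar\<close>, each of the three factors after \<open>bar y\<close> is close to
    \<open>al\<close>, to which \<open>bar (s (ev m) m)\<close> is nearly inverse: hence the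
    cube.\<close>
  define y where "y = bar (s (ev m) m) ^ 3"
  define T where "T = S m p y"
  have T: "T \<in> elementary" unfolding T_def by (intro elementary_S) (auto simp: neq)
  have iT: "ginv T = S m p (- y)" unfolding T_def by (intro S_inv) (auto simp: neq)

  define x where "x = s \<circ> t \<circ> ginv s"
  have x: "x = transv A B 1"
    unfolding x_def t_def transv_conj[OF s]
    by (simp add: unitary_lin[OF s] A_def B_def Cj_def Cm_def Cp_def)
  have ux: "unitary x" using s t by (simp add: x_def)
  define H where "H = h B (ev p)"
  define H' where "H' = h A (ev p)"
  define v where "v = ev p + scale H A - scale (bar lam * H') B"
  have xm: "x (ev m) = ev m"
    using AB0 by (simp add: neq x transv_def h_ev')
  have xp: "x (ev p) = v"
    by (simp add: x transv_def v_def H_def H'_def)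
  have P4: "conj_prod s 4 (transv (ev m) v y \<circ> conjg t (ginv T))"
    using conj_prod_four[OF s t T] unfolding x_def[symmetric]
    by (simp only: T_def transv_conj[OF ux] xm xp)

  define A0 where "A0 = al * bar al * lam"
  \<comment> \<open>\<open>D\<close> takes off the expected \<open>j\<close>-th coordinate of the
    radical vector, which stems from a diagonal entry of \<open>s\<close> and is not good by
    itself.\<close>
  define D where "D = transv (ev m) (ev p + scale A0 (ev j)) y"
  have t0v: "t0 (ev m) = ev m" "t0 (ev p) = ev p + scale A0 (ev j)"
    by (intro ext; simp add: neq t0_def transv_def A0_def ac_simps)+
  have hD: "h (ev m) (ev p + scale A0 (ev j)) = 0" "h (ev p + scale A0 (ev j)) (ev p + scale A0 (ev j)) = 0"
    by (simp_all add: neq)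
  have D_inv: "conjg t0 (ginv T) = ginv D" "ginv D = transv (ev m) (ev p + scale A0 (ev j)) (- y)"
  proof -
    show i: "ginv D = transv (ev m) (ev p + scale A0 (ev j)) (- y)"
      unfolding D_def using hD by (intro transv_inverse) (auto simp: neq)
    show "conjg t0 (ginv T) = ginv D"
      by (simp only: iT i transv_conj[OF elementary_unitary[OF t0]] t0v)
  qed
  have D: "D \<in> elementary"
    unfolding D_def by (intro transv_ev_elementary) (simp_all add: neq f_ev zero_Lam)
  define ka where "ka = conjg t0 (pi \<circ> conjg (ginv T) (ginv pi))"
  have P_ka: "conj_prod s (2 * 96) ka"
    unfolding ka_def by (intro conj_prod_conj t0 conj_prod_commutator s P_pi elementary_inv T)
  have K: "conjg t (ginv T) = ka \<circ> ginv D"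
  proof -
    have "conjg t (ginv T) = conjg t0 (conjg pi (ginv T))"
      unfolding t_split using t0 u_pi by (intro conjg_conjg) auto
    also have "conjg pi (ginv T) = (pi \<circ> conjg (ginv T) (ginv pi)) \<circ> ginv T"
      using T u_pi by (simp add: comp_assoc cancel)
    also have "conjg t0 \<dots> = ka \<circ> conjg t0 (ginv T)"
      unfolding ka_def using t0 by (intro conjg_comp) auto
    finally show ?thesis unfolding D_inv(1) .
  qed

  \<comment> \<open>The vector is split by the way its parts are removed: \<open>u0\<close> belongs
    to \<open>D\<close>, \<open>u1\<close> has good coordinates, and \<open>u2\<close> and
    \<open>u3\<close> are good multiples of arbitrary vectors, which cost three times their
    multiplier.\<close>
  define u0 where "u0 = scale (bar y) (ev p) + scale (bar y * A0) (ev j)"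
  define u1 where "u1 = scale (bar y * H * al) (cut m Cj) - scale (bar y * A0) (ev j)"
  define x2 where "x2 = bar y * H * be"
  define u2 where "u2 = scale x2 (cut m Cm)"
  define x3 where "x3 = - (bar y * bar lam * H')"
  define u3 where "u3 = scale x3 (cut m B)"
  have fB: "f B B \<in> Lam"
    using unitary_f_Lam[OF s, of "scale al (ev (- p)) + scale be' (ev (- m))"]
    by (simp add: neq unitary_lin[OF s] B_def Cp_def Cm_def f_ev zero_Lam)
  define s2 where "s2 = bar lam * (x2 * bar x2 * (f Cm Cm - f (cut m Cm) (cut m Cm)))"
  define s3 where "s3 = bar lam * (x3 * bar x3 * (f B B - f (cut m B) (cut m B)))"
  define hs where "hs = h u0 u1 + h (u0 + u1) u2 + h (u0 + u1 + u2) u3"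
  \<comment> \<open>Comparison of the central coordinates forces this long root parameter; the last
    summand comes from the \<open>ev m\<close> coordinate of \<open>v\<close>.\<close>
  define Z where "Z = hs - lam * (short_coeff u1 + s2 + s3) + tr (- (bar y * v m))"
  have hu: "h (ev m) u0 = 0" "h (ev m) u1 = 0" "h (ev m) u2 = 0" "h (ev m) u3 = 0"
    by (simp_all add: neq u0_def u1_def u2_def u3_def)
  have v0: "v (- m) = 0" using AB0 by (simp add: neq v_def)
  have cp: "cut m (ev p) = ev p"
    by (auto simp: neq cut_def ev_def)
  have usum: "u0 + u1 + u2 + u3 = cut m (scale (bar y) v)"
    unfolding v_def A_def cut_lin cp u0_def u1_def u2_def u3_def x2_def x3_def
    by (simp add: scale_add scale_diff scale_minus cut_lin algebra_simps)
  define Re where "Re = radical m u1 (short_coeff u1) \<circ> radical m u2 s2 \<circ> radical m u3 s3 \<circ> L m Z"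
  have D_radical: "D = radical m u0 0"
    by (simp add: D_def transv_radical u0_def scale_add)
  have E: "transv (ev m) v y = D \<circ> Re"
  proof -
    have "transv (ev m) v y = radical m (cut m (scale (bar y) v)) 0 \<circ> L m (tr (- (bar y * v m)))"
      unfolding transv_radical using v0 by (subst radical_cut) (auto simp: neq)
    also have "\<dots> = radical m (cut m (scale (bar y) v)) (bar lam * tr (- (bar y * v m)))"
      by (subst radical_L) (auto simp: neq)
    also have "bar lam * tr (- (bar y * v m)) = short_coeff u1 + s2 + s3 + bar lam * Z - bar lam * hs"
      by (simp add: Z_def algebra_simps lam_ac)
    finally show ?thesis
      unfolding Re_def D_radical radical_comp_four[OF m(1) hu] usum hs_def .
  qed
  have P_Re: "conj_prod s (4 + 2 * 96) Re"
  proof -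
    \<comment> \<open>The conjugation brings \<open>D\<close> and \<open>ginv D\<close> together,
      leaving \<open>Re\<close> next to the known error \<open>ka\<close>.\<close>
    have "conj_prod s 4 (conjg (ginv D) (transv (ev m) v y \<circ> conjg t (ginv T)))"
      by (intro conj_prod_conj elementary_inv D P4)
    also have "conjg (ginv D) (transv (ev m) v y \<circ> conjg t (ginv T)) = Re \<circ> ka"
      unfolding E K using D by (simp add: comp_assoc cancel)
    finally show ?thesis by (rule conj_prod_cancel_right[OF s P_ka])
  qed

  have H_eq: "H = lam * bar (B (- p))" and H'_eq: "H' = lam * bar (A (- p))"
    by (simp_all add: neq H_def H'_def h_ev')
  have gH': "good s 320 H'"
  proof -
    have "good s (160 + 160) (Cj (- p) * al + be * Cm (- p))"
      by (intro good_add good_mult Ajp Bm1)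
    then show ?thesis unfolding H'_eq
      by (intro good_mult' good_bar) (simp add: A_def mult.commute)
  qed
  have gHbe: "good s 48 (H * be)"
  proof -
    have "good s (32 + 16) (be * bar al * (lam * bar (Cp (- p))) + be * bar be' * (lam * bar (Cm (- p))))"
      by (intro good_add good_mult g_be_al g_be_be')
    moreover have "H * be = be * bar al * (lam * bar (Cp (- p))) + be * bar be' * (lam * bar (Cm (- p)))"
      by (simp add: H_eq B_def algebra_simps)
    ultimately show ?thesis by simp
  qed

  \<comment> \<open>The norm multiples of \<open>f Cm Cm\<close> and \<open>f B B\<close> are
    cancelled by \<open>s2\<close> and \<open>s3\<close>. Beyond the multiple of \<open>Y\<close>,
    only traces are left.\<close>
  have Z_eq: "Z = (bar y * H * al) * bar (bar y * H * al) * Y + tr (y * bar y * (- (H' * bar H) +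
      f (scale (- (bar lam * H')) B) (scale H A) + H * bar H * f (scale be Cm) (scale al Cj)) -
      (f u1 u0 + f u2 (u0 + u1) + f u3 (u0 + u1 + u2)) - bar y * v m)"
  proof -
    define F where "F = f u1 u0 + f u2 (u0 + u1) + f u3 (u0 + u1 + u2)"
    have fu0: "f u0 u0 = 0" by (simp add: neq u0_def f_ev)
    have f2: "lam * s2 = x2 * bar x2 * f Cm Cm - f u2 u2"
      unfolding s2_def u2_def lam_cancel f_scale by (simp add: algebra_simps)
    have f3: "lam * s3 = x3 * bar x3 * f B B - f u3 u3"
      unfolding s3_def u3_def lam_cancel f_scale by (simp add: algebra_simps)
    have f1: "lam * short_coeff u1 = - f u1 u1" by (simp add: short_coeff_def)
    have "f (cut m (scale (bar y) v)) (cut m (scale (bar y) v)) = y * bar y * f v v"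
      using f_cut[of m "scale (bar y) v"] v0 by (simp add: neq ac_simps)
    then have "y * bar y * f v v = f u0 u0 + f u1 u1 + f u2 u2 + f u3 u3 + hs + tr F"
      using f_sum_four[of u0 u1 u2 u3] unfolding usum hs_def F_def by (simp only:)
    then have hs: "hs = y * bar y * f v v - f u1 u1 - f u2 u2 - f u3 u3 - tr F"
      by (simp add: fu0 eq_diff_eq ac_simps)
    have fA: "f A A = al * bar al * Y + be * bar be * f Cm Cm + tr (f (scale be Cm) (scale al Cj))"
      unfolding A_def f_sum_sq by (simp add: hC Y_def ac_simps)
    have hp: "h (ev p) A = lam * bar H'" "h (ev p) B = lam * bar H"
      unfolding H_def H'_def by (rule h_swap)+
    have "\<not> p < 0" using p(2) by simp
    then have fp: "f A (ev p) = 0" "f B (ev p) = 0" by (simp_all add: neq f_ev')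
    let ?w = "scale (- (bar lam * H')) B"
    have "v = ev p + (scale H A + ?w)" by (simp add: v_def scale_minus)
    then have "f v v = f (scale H A + ?w) (scale H A + ?w) + h (ev p) (scale H A + ?w) + tr (f (scale H A + ?w) (ev p))"
      using f_sum_sq[of "ev p" "scale H A + ?w"] by (simp add: neq)
    also have "f (scale H A + ?w) (ev p) = 0" by (simp add: fp)
    also have "h (ev p) (scale H A + ?w) = tr (- (H' * bar H))"
      by (simp add: hp tr_def algebra_simps lam_ac)
    also have "f (scale H A + ?w) (scale H A + ?w) = H * bar H * f A A + H' * bar H' * f B B + tr (f ?w (scale H A))"
      unfolding f_sum_sq by (simp add: hAB algebra_simps lam_ac)
    finally have fv: "f v v = H * bar H * f A A + H' * bar H' * f B B + tr (f ?w (scale H A) - H' * bar H)"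
      by (simp add: tr_add tr_diff) (simp add: tr_def)
    have "Z = y * bar y * f v v - x2 * bar x2 * f Cm Cm - x3 * bar x3 * f B B - tr F + tr (- (bar y * v m))"
      unfolding Z_def hs distrib_left f1 f2 f3 by simp
    also have "x3 * bar x3 = y * bar y * (H' * bar H')"
      by (simp add: x3_def ac_simps lam_ac lam_ac_deep)
    also have "x2 * bar x2 = y * bar y * (H * bar H) * (be * bar be)"
      by (simp add: x2_def algebra_simps)
    finally have "Z = (bar y * H * al) * bar (bar y * H * al) * Y + y * bar y * (H * bar H) * tr (f (scale be Cm) (scale al Cj))
        + y * bar y * tr (f ?w (scale H A) - H' * bar H) - tr F + tr (- (bar y * v m))"
      by (simp add: fv fA algebra_simps)
    also have "y * bar y * (H * bar H) * tr (f (scale be Cm) (scale al Cj)) = tr (y * bar y * (H * bar H) * f (scale be Cm) (scale al Cj))"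
      using tr_scale[of "y * H"] by (simp add: ac_simps)
    also have "y * bar y * tr (f ?w (scale H A) - H' * bar H) = tr (y * bar y * (f ?w (scale H A) - H' * bar H))"
      by (rule tr_scale)
    finally have Zf: "Z = (bar y * H * al) * bar (bar y * H * al) * Y + tr (y * bar y * (H * bar H) * f (scale be Cm) (scale al Cj))
        + tr (y * bar y * (f ?w (scale H A) - H' * bar H)) - tr F + tr (- (bar y * v m))" .
    have tW: "y * bar y * (- (H' * bar H) + f ?w (scale H A) + H * bar H * f (scale be Cm) (scale al Cj)) - F - bar y * v m =
        y * bar y * (H * bar H) * f (scale be Cm) (scale al Cj) + y * bar y * (f ?w (scale H A) - H' * bar H) - F + - (bar y * v m)"
      by (simp add: algebra_simps del: f_scale)
    have add5: "a + b + c - d + e = a + (b + c - d + e)" for a b c d e :: 'a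
      by (simp add: algebra_simps)
    show ?thesis
      unfolding F_def[symmetric] tW by (simp only: Zf tr_add tr_diff add5)
  qed

  have g_u1j: "good s (480 + 320 * n + 32) (u1 j)"
  proof -
    \<comment> \<open>\<open>Cp (- p)\<close> is exchanged for the diagonal entry at
      \<open>- j\<close>, whose \<open>bar\<close> is inverse to \<open>Cj j\<close> up to
      \<open>?k\<close>. Thus \<open>H * al * Cj j\<close> agrees with \<open>A0\<close> up to good
      terms.\<close>
    let ?d = "Cp (- p) - s (ev (- j)) (- j)" and ?k = "1 - bar (s (ev (- j)) (- j)) * Cj j"
    have 1: "good s 480 ?d"
      unfolding Cp_def by (intro good_diag_diff[OF s]) (auto simp: neq)
    have 2: "good s (320 * n) ?k"
      using good_diag_norm[OF s, of "- j"] by (simp add: neq Cj_def)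
    have "good s (480 + 320 * n + 32) (bar ?d * (bar y * lam * al * bar al * Cj j) +
        ?k * - (bar y * lam * al * bar al) + al * bar be' * (bar y * lam * bar (Cm (- p)) * Cj j))"
      by (intro good_add good_mult good_bar 1 2 g_al_be')
    moreover have "u1 j = bar ?d * (bar y * lam * al * bar al * Cj j) +
        ?k * - (bar y * lam * al * bar al) + al * bar be' * (bar y * lam * bar (Cm (- p)) * Cj j)"
      by (simp add: neq u1_def H_eq B_def A0_def algebra_simps)
    ultimately show ?thesis by simp
  qed
  define cst where "cst q = (if q = j then 480 + 320 * n + 32 else if q = - j then 320 else 160)" for q
  have g_u1: "good s (cst q) (u1 q)" if q: "q \<in> Om - {m, - m}" for q
  proof (cases "q = j")
    case True
    then show ?thesis using g_u1j by (simp add: cst_def)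
  next
    case False
    then have "u1 q = bar y * H * al * Cj q" using q by (simp add: u1_def)
    moreover have "good s (cst q) (Cj q)"
      using False q Ajj good_entry[OF s j, of q] by (auto simp: neq cst_def Cj_def)
    ultimately show ?thesis by (simp add: good_mult')
  qed
  have sum_cst: "sum cst (Om - {m, - m}) = 640 * n + 192"
  proof -
    let ?D = "Om - {m, - m}"
    have j1: "j \<in> ?D" and j2: "- j \<in> ?D - {j}" by (auto simp: neq)
    have "sum cst ?D = cst j + (cst (- j) + sum cst (?D - {j} - {- j}))"
      using sum.remove[OF _ j1, of cst] sum.remove[OF _ j2, of cst] by simp
    also have "sum cst (?D - {j} - {- j}) = (\<Sum>q\<in>?D - {j} - {- j}. 160)"
      by (rule sum.cong) (auto simp: cst_def)
    also have "card (?D - {j} - {- j}) = 2 * n - 4"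
    proof -
      have "?D - {j} - {- j} = Om - {m, - m, j, - j}" by auto
      moreover have "card {m, - m, j, - j} = 4" by (simp add: neq card_insert_if)
      ultimately show ?thesis by (simp add: neq card_Diff_subset card_Om)
    qed
    then have "(\<Sum>q\<in>?D - {j} - {- j}. 160 :: nat) = (2 * n - 4) * 160" by simp
    finally show ?thesis using three_le by (simp add: neq cst_def)
  qed
  have P_u1: "conj_prod s (640 * n + 192) (radical m u1 (short_coeff u1))"
  proof -
    have "u1 q = 0" if "q \<notin> Om - {m, - m}" for q
      using that supps by (auto simp: neq u1_def supp_def cut_def ev_def)
    then have "conj_prod s (sum cst (Om - {m, - m})) (radical m u1 (short_coeff u1))"
      using g_u1 by (intro radical_short_coeff_conj_prod m(1)) auto
    then show ?thesis by (simp only: sum_cst)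
  qed
  have P_u2: "conj_prod s (3 * 48) (radical m u2 s2)"
    unfolding u2_def s2_def
  proof (rule conj_prod_scaled_radical[OF s m(1)])
    show "good s 48 x2" using good_mult'[OF gHbe, of "bar y"] by (simp add: x2_def mult.assoc)
  qed (use supps Lams in simp_all)
  have P_u3: "conj_prod s (3 * 320) (radical m u3 s3)"
    unfolding u3_def s3_def
  proof (rule conj_prod_scaled_radical[OF s m(1)])
    show "good s 320 x3" using good_mult'[OF gH', of "- (bar y * bar lam)"] by (simp add: x3_def)
  qed (use suppAB fB in simp_all)
  have P_Z: "conj_prod s (640 * n + 192 + 3 * 48 + 3 * 320 + (4 + 2 * 96)) (L m Z)"
    using P_Re unfolding Re_def by (rule conj_prod_cancel_left[OF s conj_prod_comp[OF conj_prod_comp[OF P_u1 P_u2] P_u3]])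

  define W where "W = y * bar y * (- (H' * bar H) +
      f (scale (- (bar lam * H')) B) (scale H A) + H * bar H * f (scale be Cm) (scale al Cj)) -
      (f u1 u0 + f u2 (u0 + u1) + f u3 (u0 + u1 + u2)) - bar y * v m"
  define e where "e = (if j < 0 then 1 else 0 :: 'a)"
  \<comment> \<open>Each group consists of multiples of one good element and of its
    \<open>bar\<close>; the zero terms serve to give the last two groups the shape of
    \<open>trace_good_pair\<close>.\<close>
  have W: "W = (H' * (bar y * bar lam * B m - y * bar y * bar H) +
        bar H' * (y * lam * f (cut m B) (u0 + u1 + u2) - y * bar y * lam * H * f B A)) +
      ((H * be) * - (bar y * Cm m) +
        bar (H * be) * (y * bar y * H * al * f Cm Cj - y * f (cut m Cm) (u0 + u1))) +
      (Cj (- j) * 0 + bar (Cj (- j)) * - (bar y * A0 * e * y * bar H * bar al)) +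
      (Cj m * - (bar y * H * al) + bar (Cj m) * 0)"
  proof -
    have "\<not> p < 0" using p(2) by simp
    then have "f u1 u0 = bar y * A0 * e * (y * bar H * bar al * bar (Cj (- j)))"
      by (simp add: neq u0_def f_ev' e_def u1_def)
    moreover have "f u2 (u0 + u1) = y * bar (H * be) * f (cut m Cm) (u0 + u1)"
      unfolding u2_def x2_def f_scale by (simp add: ac_simps)
    moreover have "f u3 (u0 + u1 + u2) = - (y * lam * bar H') * f (cut m B) (u0 + u1 + u2)"
      unfolding u3_def x3_def f_scale by (simp add: ac_simps)
    moreover have "v m = H * (al * Cj m + be * Cm m) - bar lam * H' * B m"
      by (simp add: neq v_def A_def)
    moreover have "f (scale (- (bar lam * H')) B) (scale H A) = - (lam * bar H' * H * f B A)"
      by (simp add: ac_simps)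
    moreover have "f (scale be Cm) (scale al Cj) = bar be * al * f Cm Cj"
      by (simp add: ac_simps)
    ultimately show ?thesis
      unfolding W_def by (simp only:) (simp add: algebra_simps del: f_add)
  qed
  have "trace_good s (2 * 320 + 2 * 48 + 2 * 320 + 2 * 160) W"
    unfolding W by (intro trace_good_add trace_good_pair s gH' gHbe Ajj Ajm)
  then have P_W: "conj_prod s (2 * 320 + 2 * 48 + 2 * 320 + 2 * 160) (L m (tr W))"
    using m by (simp add: trace_good_def)
  \<comment> \<open>The part of the multiplier that remains when \<open>be'\<close> is dropped from
    \<open>B (- p)\<close>; \<open>g\<close> is the good remainder.\<close>
  define th where "th = bar y * lam * al * bar al * bar (Cp (- p))"
  define g where "g = al * bar be' * (bar y * lam * bar (Cm (- p)))"
  have thg: "bar y * H * al = th + g"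
    by (simp add: th_def g_def H_eq B_def algebra_simps)
  have gg: "good s 32 g" unfolding g_def by (intro good_mult g_al_be')
  have "L m Z = L m ((th + g) * bar (th + g) * Y) \<circ> L m (tr W)"
    unfolding Z_eq thg W_def[symmetric] using m by (intro L_add)
  then have P1: "conj_prod s (640 * n + 192 + 3 * 48 + 3 * 320 + (4 + 2 * 96) + (2 * 320 + 2 * 48 + 2 * 320 + 2 * 160))
      (L m ((th + g) * bar (th + g) * Y))"
    using P_Z by (intro conj_prod_cancel_right[OF s P_W]) (simp only:)
  have "(th + g) * bar (th + g) * Y = th * bar th * Y + ((th + g) * bar (th + g) - th * bar th) * Y"
    by (simp add: algebra_simps)
  then have "L m ((th + g) * bar (th + g) * Y) = L m (th * bar th * Y) \<circ> L m (((th + g) * bar (th + g) - th * bar th) * Y)"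
    using L_add[OF m(1)] by (simp only:)
  then have P2: "conj_prod s (640 * n + 192 + 3 * 48 + 3 * 320 + (4 + 2 * 96) + (2 * 320 + 2 * 48 + 2 * 320 + 2 * 160) + (2 * 32 + 32))
      (L m (th * bar th * Y))"
    using P1 by (intro conj_prod_cancel_right[OF s conj_prod_norm_shift[OF s m(1) Lams(1) gg good_mult[OF gg], of th]]) (simp only:)

  define q where "q = s (ev m) m"
  define k where "k = 1 - bar q * al"
  define d where "d = Cp (- p) - al"
  \<comment> \<open>With \<open>z = bar q * al\<close> and \<open>k = 1 - z\<close>, the first
    summand is \<open>z ^ 3 - 1\<close>; the second exchanges one \<open>al\<close> for
    \<open>Cp (- p)\<close>.\<close>
  define w where "w = k * - (1 + bar q * al + (bar q * al) * (bar q * al)) + d * (bar q * bar q * bar q * al * al)"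
  have gk: "good s (320 * n) k"
    using good_diag_norm[OF s m(1)] by (simp add: k_def q_def al_def Cm_def)
  have gd: "good s 480 d"
    unfolding d_def Cp_def al_def Cm_def by (intro good_diag_diff[OF s]) (auto simp: neq)
  have gw: "good s (320 * n + 480) w"
    unfolding w_def by (intro good_add good_mult gk gd)
  \<comment> \<open>Paying through \<open>Y\<close> rather than through \<open>w\<close> is cheaper
    here.\<close>
  have gY: "good s (160 * n + 160) (w * Y)"
    unfolding Y_def Cj_def by (intro good_mult' good_value s j)
  have w1: "1 + w = y * al * al * Cp (- p)"
    by (simp add: w_def k_def d_def y_def q_def power3_eq_cube algebra_simps)
  have th: "th * bar th * Y = 1 * bar 1 * Y + ((1 + w) * bar (1 + w) - 1 * bar 1) * Y"
  proof -
    have "th * bar th = (1 + w) * bar (1 + w)"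
    proof -
      have "th * bar th = (lam * bar lam) * ((y * al * al * Cp (- p)) * bar (y * al * al * Cp (- p)))"
        unfolding th_def bar_mult' bar_bar by (simp only: ac_simps)
      then show ?thesis unfolding w1 lam_unit mult_1_left .
    qed
    then show ?thesis by (simp add: algebra_simps)
  qed
  have "L m (th * bar th * Y) = L m (1 * bar 1 * Y) \<circ> L m (((1 + w) * bar (1 + w) - 1 * bar 1) * Y)"
    unfolding th using m by (intro L_add)
  then have "conj_prod s (640 * n + 192 + 3 * 48 + 3 * 320 + (4 + 2 * 96) + (2 * 320 + 2 * 48 + 2 * 320 + 2 * 160) + (2 * 32 + 32) +
      (2 * (320 * n + 480) + (160 * n + 160))) (L m (1 * bar 1 * Y))"
    using P2 by (intro conj_prod_cancel_right[OF s conj_prod_norm_shift[OF s m(1) Lams(1) gw gY, of 1]]) (simp only:)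
  then show ?thesis by (simp add: Y_def Cj_def algebra_simps)
qed

subsection \<open>Matrices as operators\<close>

definition unpos :: "nat \<Rightarrow> int" where
  "unpos r = (if r < n then int r + 1 else int r - 2 * int n)"

lemma unpos_Om: "r < 2 * n \<Longrightarrow> unpos r \<in> Om"
  by (auto simp: unpos_def Om_iff)

lemma pos_less: "i \<in> Om \<Longrightarrow> pos n i < 2 * n"
  by (auto simp: pos_def Om_iff)

lemma pos_less_n: "i \<in> Om \<Longrightarrow> pos n i < n \<longleftrightarrow> i > 0"
  by (auto simp: pos_def Om_iff)

lemma unpos_pos: "i \<in> Om \<Longrightarrow> unpos (pos n i) = i"
  by (auto simp: pos_def unpos_def Om_iff)

lemma pos_unpos: "r < 2 * n \<Longrightarrow> pos n (unpos r) = r"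
  by (auto simp: pos_def unpos_def)

lemma pos_eq_iff: "i \<in> Om \<Longrightarrow> j \<in> Om \<Longrightarrow> pos n i = pos n j \<longleftrightarrow> i = j"
  by (metis unpos_pos)

lemma pos_uminus: "i \<in> Om \<Longrightarrow> pos n (- i) = 2 * n - 1 - pos n i"
  by (auto simp: pos_def Om_iff)

lemma sum_pos: "(\<Sum>r = 0..<2 * n. F r) = (\<Sum>i\<in>Om. F (pos n i))"
  by (rule sum.reindex_bij_witness[of _ "pos n" unpos]) (auto simp: unpos_Om pos_less unpos_pos pos_unpos)

definition act :: "'a mat \<Rightarrow> 'a vect \<Rightarrow> 'a vect" where
  "act A v = (\<lambda>i. if i \<in> Om then (\<Sum>j\<in>Om. entry n A i j * v j) else v i)"

abbreviation M :: "'a mat set" where "M \<equiv> carrier_mat (2 * n) (2 * n)"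

lemma entry_mult:
  assumes "A \<in> M" "B \<in> M" "i \<in> Om" "j \<in> Om"
  shows "entry n (A * B) i j = (\<Sum>k\<in>Om. entry n A i k * entry n B k j)"
  using assms pos_less by (auto simp: entry_def scalar_prod_def sum_pos)

lemma act_mult: assumes "A \<in> M" "B \<in> M" shows "act (A * B) = act A \<circ> act B"
proof (intro ext)
  fix v i
  show "act (A * B) v i = (act A \<circ> act B) v i"
  proof (cases "i \<in> Om")
    case True
    then have "act (A * B) v i = (\<Sum>j\<in>Om. \<Sum>k\<in>Om. entry n A i k * entry n B k j * v j)"
      by (simp add: act_def entry_mult[OF assms] sum_distrib_right)
    also have "\<dots> = (\<Sum>k\<in>Om. \<Sum>j\<in>Om. entry n A i k * entry n B k j * v j)"
      by (rule sum.swap)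
    also have "\<dots> = (act A \<circ> act B) v i"
      using True by (simp add: act_def sum_distrib_left mult.assoc)
    finally show ?thesis .
  qed (simp add: act_def)
qed

lemma act_one: "act (1\<^sub>m (2 * n)) = id"
proof (intro ext)
  fix v :: "'a vect" and i
  have "(\<Sum>j\<in>Om. entry n (1\<^sub>m (2 * n)) i j * v j) = (\<Sum>j\<in>Om. if j = i then v i else 0)" if "i \<in> Om"
    using that by (intro sum.cong refl) (simp add: entry_def pos_less pos_eq_iff)
  then show "act (1\<^sub>m (2 * n)) v i = id v i" by (simp add: act_def)
qed

lemma act_ev: "i \<in> Om \<Longrightarrow> j \<in> Om \<Longrightarrow> act A (ev j) i = entry n A i j"
proof -
  assume "i \<in> Om" "j \<in> Om"
  moreover have "(\<Sum>k\<in>Om. entry n A i k * ev j k) = (\<Sum>k\<in>Om. if k = j then entry n A i j else 0)"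
    by (rule sum.cong) (auto simp: ev_def)
  ultimately show ?thesis by (simp add: act_def)
qed

lemma act_inj: assumes "A \<in> M" "B \<in> M" "act A = act B" shows "A = B"
proof (rule eq_matI)
  fix r c assume "r < dim_row B" "c < dim_col B"
  then have rc: "r < 2 * n" "c < 2 * n" using assms by auto
  then have "entry n A (unpos r) (unpos c) = entry n B (unpos r) (unpos c)"
    using assms(3) act_ev[OF unpos_Om unpos_Om] by metis
  then show "A $$ (r, c) = B $$ (r, c)" using rc by (simp add: entry_def pos_unpos)
qed (use assms in auto)

abbreviation G :: "'a mat monoid" where "G \<equiv> GL (2 * n)"

lemma group_G: "group G"
proof -
  interpret ring "ring_mat TYPE('a) (2 * n) ()" by (rule ring_mat)
  show ?thesis unfolding GL_def by (rule units_group)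
qed

lemma G_simps [simp]: "x \<otimes>\<^bsub>G\<^esub> y = x * y" "\<one>\<^bsub>G\<^esub> = 1\<^sub>m (2 * n)"
  by (simp_all add: GL_def units_of_mult units_of_one ring_mat_simps)

lemma G_M: "A \<in> carrier G \<Longrightarrow> A \<in> M"
  by (simp add: GL_def units_of_carrier Units_def ring_mat_simps)

lemma G_I: "A \<in> M \<Longrightarrow> B \<in> M \<Longrightarrow> act A \<circ> act B = id \<Longrightarrow> act B \<circ> act A = id \<Longrightarrow> A \<in> carrier G"
  using act_inj[of "A * B" "1\<^sub>m (2 * n)"] act_inj[of "B * A" "1\<^sub>m (2 * n)"]
  by (auto simp: GL_def units_of_carrier Units_def ring_mat_simps act_mult act_one)

lemma G_closed: "A \<in> carrier G \<Longrightarrow> B \<in> carrier G \<Longrightarrow> A * B \<in> carrier G"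
  using monoid.m_closed[OF group.is_monoid[OF group_G], of A B] by simp

lemma G_inv: assumes A: "A \<in> carrier G"
  shows "inv\<^bsub>G\<^esub> A \<in> carrier G" "act (inv\<^bsub>G\<^esub> A) = ginv (act A)" "bij (act A)"
proof -
  show i: "inv\<^bsub>G\<^esub> A \<in> carrier G" using group.inv_closed[OF group_G A] .
  have "act A \<circ> act (inv\<^bsub>G\<^esub> A) = id" "act (inv\<^bsub>G\<^esub> A) \<circ> act A = id"
    using group.r_inv[OF group_G A] group.l_inv[OF group_G A] act_mult[OF G_M[OF A] G_M[OF i]]
      act_mult[OF G_M[OF i] G_M[OF A]] by (simp_all add: act_one)
  then show "act (inv\<^bsub>G\<^esub> A) = ginv (act A)" "bij (act A)"
    by (metis inv_unique_comp, metis o_bij)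
qed

definition vec_of :: "'a vect \<Rightarrow> 'a vec" where "vec_of v = vec (2 * n) (\<lambda>r. v (unpos r))"

lemma vec_of_carrier: "vec_of v \<in> carrier_vec (2 * n)"
  by (simp add: vec_of_def)

lemma vec_of_pos: "i \<in> Om \<Longrightarrow> vec_of v $ pos n i = v i"
  by (simp add: vec_of_def pos_less unpos_pos)

lemma mult_vec_of: assumes "A \<in> M" shows "A *\<^sub>v vec_of v = vec_of (act A v)"
proof (rule eq_vecI)
  fix r assume "r < dim_vec (vec_of (act A v))"
  then have r: "r < 2 * n" by (simp add: vec_of_def)
  then have "(A *\<^sub>v vec_of v) $ r = (\<Sum>c = 0..<2 * n. A $$ (r, c) * vec_of v $ c)"
    using assms by (auto simp: scalar_prod_def vec_of_def)
  also have "\<dots> = (\<Sum>j\<in>Om. A $$ (r, pos n j) * v j)"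
    unfolding sum_pos by (intro sum.cong) (auto simp: vec_of_pos)
  also have "\<dots> = vec_of (act A v) $ r"
    using r by (simp add: vec_of_def act_def unpos_Om entry_def pos_unpos)
  finally show "(A *\<^sub>v vec_of v) $ r = vec_of (act A v) $ r" .
qed (use assms in \<open>auto simp: vec_of_def\<close>)

text \<open>The lower block is kept as a multiple \<open>x\<close> of \<open>skew_id\<close>:
  \<open>x = lam\<close> gives \<open>h\<close>, and \<open>x = 0\<close> gives
  \<open>f\<close>.\<close>

lemma block_form:
  "map_vec bar (vec_of u) \<bullet> (four_block_mat (0\<^sub>m n n) (skew_id n) (x \<cdot>\<^sub>m skew_id n) (0\<^sub>m n n) *\<^sub>v vec_of v) =
    (\<Sum>i\<in>Om. (if i > 0 then 1 else x) * bar (u i) * v (- i))"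
proof -
  let ?B = "four_block_mat (0\<^sub>m n n) (skew_id n) (x \<cdot>\<^sub>m skew_id n) (0\<^sub>m n n)"
  have B: "?B \<in> M" by (simp add: skew_id_def mult_2)
  have e: "entry n ?B i j = (if j = - i then (if i > 0 then 1 else x) else 0)" if "i \<in> Om" "j \<in> Om" for i j
  proof -
    have less: "pos n i < 2 * n" "pos n j < 2 * n" using that pos_less by auto
    have nz: "i \<noteq> 0" "j \<noteq> 0" using that Om_nz by auto
    have sum: "j = - i \<longleftrightarrow> pos n i + pos n j + 1 = 2 * n"
      using pos_eq_iff[of j "- i"] pos_uminus[of i] that less by auto
    have lt: "pos n i < n \<longleftrightarrow> i > 0" "pos n j < n \<longleftrightarrow> j > 0"
      using that pos_less_n by auto
    have sgn: "j = - i \<Longrightarrow> (j > 0) = (\<not> i > 0)" using nz by auto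
    have "entry n ?B i j = (if i > 0 then (if j > 0 then 0 else if j = - i then 1 else 0)
        else (if j > 0 then x * (if j = - i then 1 else 0) else 0))"
      using less lt(1)[symmetric] lt(2)[symmetric] unfolding entry_def sum lt(1)[symmetric] lt(2)[symmetric]
      by (simp add: skew_id_def) linarith
    then show ?thesis using sgn by auto
  qed
  have "act ?B v i = (if i > 0 then 1 else x) * v (- i)" if i: "i \<in> Om" for i
  proof -
    have "(\<Sum>j\<in>Om. entry n ?B i j * v j) =
        (\<Sum>j\<in>Om. if j = - i then (if i > 0 then 1 else x) * v (- i) else 0)"
      by (rule sum.cong) (simp_all add: e i)
    then show ?thesis using i by (simp add: act_def)
  qed
  then show ?thesis
    unfolding mult_vec_of[OF B]
    by (auto simp: scalar_prod_def vec_of_def sum_pos pos_less unpos_pos intro!: sum.cong)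
qed

lemma h_form_vec_of: "h_form bar lam n (vec_of u) (vec_of v) = h u v"
  unfolding h_form_def block_form h_def mu_def ..

lemma f_form_vec_of: "f_form bar n (vec_of u) (vec_of v) = f u v"
proof -
  have "(0\<^sub>m n n :: 'a mat) = 0 \<cdot>\<^sub>m skew_id n"
    by (rule eq_matI) (auto simp: skew_id_def)
  then have "f_form bar n (vec_of u) (vec_of v) = (\<Sum>i\<in>Om. (if i > 0 then 1 else 0) * bar (u i) * v (- i))"
    using block_form[of u 0 v] by (simp add: f_form_def)
  also have "\<dots> = f u v"
    unfolding f_def by (rule sum.mono_neutral_cong_right) (auto simp: Omega_def Omega_plus_def Omega_minus_def)
  finally show ?thesis .
qed

lemma U_unitary: assumes "\<sigma> \<in> U bar lam Lam n" shows "unitary (act \<sigma>)" "\<sigma> \<in> carrier G"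
proof -
  show G: "\<sigma> \<in> carrier G" using assms by (simp add: U_def)
  note M = G_M[OF G]
  have U: "h_form bar lam n (\<sigma> *\<^sub>v vec_of u) (\<sigma> *\<^sub>v vec_of v) = h_form bar lam n (vec_of u) (vec_of v)"
    "q_form bar Lam n (\<sigma> *\<^sub>v vec_of v) = q_form bar Lam n (vec_of v)" for u v
    using assms vec_of_carrier by (auto simp: U_def)
  show "unitary (act \<sigma>)"
    unfolding unitary_def
  proof (intro conjI allI impI)
    show "bij (act \<sigma>)" by (rule G_inv[OF G])
    show "act \<sigma> (u + v) = act \<sigma> u + act \<sigma> v" for u v
      by (auto simp: act_def distrib_left sum.distrib)
    show "act \<sigma> (scale x v) = scale x (act \<sigma> v)" for x v
      by (auto simp: act_def sum_distrib_left ac_simps)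
    show "h (act \<sigma> u) (act \<sigma> v) = h u v" for u v
      using U(1)[of u v] by (simp add: mult_vec_of[OF M] h_form_vec_of)
    show "f (act \<sigma> v) (act \<sigma> v) - f v v \<in> Lam" for v
    proof -
      have "(\<lambda>x. f (act \<sigma> v) (act \<sigma> v) + x) ` Lam = (\<lambda>x. f v v + x) ` Lam"
        using U(2)[of v] by (simp add: mult_vec_of[OF M] q_form_def f_form_vec_of)
      moreover have "f (act \<sigma> v) (act \<sigma> v) + 0 \<in> (\<lambda>x. f (act \<sigma> v) (act \<sigma> v) + x) ` Lam"
        using zero_Lam by (rule imageI)
      ultimately obtain x where "x \<in> Lam" "f (act \<sigma> v) (act \<sigma> v) + 0 = f v v + x" by auto
      then show ?thesis by simp
    qed
    show "act \<sigma> v i = v i" if "i \<notin> Om" for v i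
      using that by (simp add: act_def)
  qed
qed

lemma column_vec_of: assumes "\<sigma> \<in> M" "j \<in> Om" shows "column n \<sigma> j = vec_of (act \<sigma> (ev j))"
proof (rule eq_vecI)
  fix r assume "r < dim_vec (vec_of (act \<sigma> (ev j)))"
  then have "r < 2 * n" by (simp add: vec_of_def)
  then show "column n \<sigma> j $ r = vec_of (act \<sigma> (ev j)) $ r"
    using assms by (simp add: column_def vec_of_def act_ev unpos_Om entry_def pos_unpos pos_less)
qed (use assms in \<open>auto simp: vec_of_def column_def\<close>)

lemma T_short_M [simp]: "T_short bar lam n k l x \<in> M"
  by (rule carrier_matI) (simp_all add: T_short_def mat_unit_def)

lemma T_long_M [simp]: "T_long n k x \<in> M"
  by (simp add: T_long_def mat_unit_def)

lemma act_one_plus: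
  assumes "i \<in> Om" "\<And>j. j \<in> Om \<Longrightarrow> entry n A i j = (if j = i then 1 else 0) + (if j = b then y else 0)" "b \<in> Om"
  shows "act A v i = v i + y * v b"
proof -
  have "act A v i = (\<Sum>j\<in>Om. (if j = i then v i else 0) + (if j = b then y * v b else 0))"
    unfolding act_def using assms(1,2) by (auto intro!: sum.cong simp: algebra_simps)
  then show ?thesis using assms by (simp add: sum.distrib)
qed

text \<open>The factor \<open>bar (mu (- l))\<close> cancels the unit with which
  \<open>h (ev (- l))\<close> reads coordinate \<open>l\<close>.\<close>

lemma act_T_short:
  assumes kl: "k \<in> Om" "l \<in> Om" "k \<noteq> l" "k \<noteq> - l"
  shows "act (T_short bar lam n k l x) = S k (- l) (bar (mu (- l)) * x)"
proof (intro ext)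
  fix v i
  define cc where "cc = lam_pow bar lam ((eps n l - eps n k) div 2) * bar x"
  have c: "cc = bar lam * (mu (- l) * bar x) * mu k"
    using kl by (auto simp: cc_def eps_def lam_pow_def mu_def Om_iff Omega_plus_def ac_simps lam_ac)
  have e: "entry n (T_short bar lam n k l x) i j = (if j = i then 1 else 0) +
      (if i = k \<and> j = l then x else 0) - (if i = - l \<and> j = - k then cc else 0)" if "i \<in> Om" "j \<in> Om" for j
    using that kl pos_less by (auto simp: T_short_def entry_def mat_unit_def pos_eq_iff cc_def)
  have S: "S k (- l) (bar (mu (- l)) * x) v i = v i + x * v l * ev k i - cc * v (- k) * ev (- l) i"
    using kl by (simp add: transv_def h_ev c ac_simps)
  consider "i \<notin> Om" | "i = k" | "i = - l" | "i \<in> Om" "i \<noteq> k" "i \<noteq> - l" by blast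
  then show "act (T_short bar lam n k l x) v i = S k (- l) (bar (mu (- l)) * x) v i"
  proof cases
    case 1
    then show ?thesis unfolding S using kl by (auto simp: act_def ev_def)
  next
    case 2
    have "act (T_short bar lam n k l x) v i = v i + x * v l"
      by (rule act_one_plus) (use 2 kl e in auto)
    then show ?thesis unfolding S using 2 kl by simp
  next
    case 3
    have "act (T_short bar lam n k l x) v i = v i + (- cc) * v (- k)"
      by (rule act_one_plus) (use 3 kl e in auto)
    then show ?thesis unfolding S using 3 kl by simp
  next
    case 4
    have "act (T_short bar lam n k l x) v i = v i + 0 * v l"
      by (rule act_one_plus) (use 4 kl e in auto)
    then show ?thesis unfolding S using 4 kl by simp
  qed
qed

lemma act_T_long:
  assumes k: "k \<in> Om"
  shows "act (T_long n k (lam_pow bar lam (- ((eps n k + 1) div 2)) * z)) = L k z"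
proof (intro ext)
  fix v i
  define cc where "cc = lam_pow bar lam (- ((eps n k + 1) div 2)) * z"
  have c: "cc = bar lam * z * mu k"
    using k by (auto simp: cc_def eps_def lam_pow_def mu_def Om_iff Omega_plus_def ac_simps lam_ac)
  have e: "entry n (T_long n k cc) i j = (if j = i then 1 else 0) + (if i = k \<and> j = - k then cc else 0)"
    if "i \<in> Om" "j \<in> Om" for j
    using that k pos_less by (auto simp: T_long_def entry_def mat_unit_def pos_eq_iff)
  have L: "L k z v i = v i + cc * v (- k) * ev k i"
    using k by (simp add: long_transv_def h_ev c ac_simps)
  consider "i \<notin> Om" | "i = k" | "i \<in> Om" "i \<noteq> k" by blast
  then have "act (T_long n k cc) v i = L k z v i"
  proof cases
    case 1
    then show ?thesis unfolding L using k by (auto simp: act_def ev_def)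
  next
    case 2
    have "act (T_long n k cc) v i = v i + cc * v (- k)"
      by (rule act_one_plus) (use 2 k e in auto)
    then show ?thesis unfolding L using 2 by simp
  next
    case 3
    have "act (T_long n k cc) v i = v i + 0 * v (- k)"
      by (rule act_one_plus) (use 3 k e in auto)
    then show ?thesis unfolding L using 3 by simp
  qed
  then show "act (T_long n k (lam_pow bar lam (- ((eps n k + 1) div 2)) * z)) v i = L k z v i"
    unfolding cc_def .
qed

lemma T_short_G:
  assumes kl: "k \<in> Om" "l \<in> Om" "k \<noteq> l" "k \<noteq> - l"
  shows "T_short bar lam n k l x \<in> carrier G"
proof (rule G_I[of _ "T_short bar lam n k l (- x)"])
  have "k \<noteq> - (- l)" using kl by simp
  then show "act (T_short bar lam n k l x) \<circ> act (T_short bar lam n k l (- x)) = id"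
    "act (T_short bar lam n k l (- x)) \<circ> act (T_short bar lam n k l x) = id"
    unfolding act_T_short[OF kl] using kl by (simp_all add: transv_add_coeff)
qed simp_all

lemma T_long_G:
  assumes k: "k \<in> Om"
  shows "T_long n k (lam_pow bar lam (- ((eps n k + 1) div 2)) * z) \<in> carrier G"
proof (rule G_I[of _ "T_long n k (lam_pow bar lam (- ((eps n k + 1) div 2)) * - z)"])
  show "act (T_long n k (lam_pow bar lam (- ((eps n k + 1) div 2)) * z)) \<circ>
      act (T_long n k (lam_pow bar lam (- ((eps n k + 1) div 2)) * - z)) = id"
    "act (T_long n k (lam_pow bar lam (- ((eps n k + 1) div 2)) * - z)) \<circ>
      act (T_long n k (lam_pow bar lam (- ((eps n k + 1) div 2)) * z)) = id"
    unfolding act_T_long[OF k] using k by (simp_all add: long_transv_add_coeff)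
qed simp_all

section \<open>Lifting elementary operators and products of conjugates to matrices\<close>

lemma EU_closed: "A \<in> EU bar lam Lam n \<Longrightarrow> B \<in> EU bar lam Lam n \<Longrightarrow> A * B \<in> EU bar lam Lam n"
  unfolding EU_def using generate.eng[of A G _ B] by simp

lemma elementary_EU: assumes "g \<in> elementary" shows "\<exists>A \<in> EU bar lam Lam n \<inter> carrier G. act A = g"
  using assms
proof (rule elementary_induct)
  show "\<exists>A \<in> EU bar lam Lam n \<inter> carrier G. act A = id"
    using generate.one[of G] group.is_monoid[OF group_G] monoid.one_closed[of G]
    by (intro bexI[of _ "1\<^sub>m (2 * n)"]) (auto simp: EU_def act_one)
next
  fix g i j x
  assume "\<exists>A \<in> EU bar lam Lam n \<inter> carrier G. act A = g" and ij: "i \<in> Om" "j \<in> Om" "i \<noteq> j" "i \<noteq> - j"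
  then obtain A where A: "A \<in> EU bar lam Lam n" "A \<in> carrier G" "act A = g" by auto
  let ?T = "T_short bar lam n i (- j) (mu j * x)"
  have ij': "i \<in> Om" "- j \<in> Om" "i \<noteq> - j" "i \<noteq> - (- j)" using ij by auto
  have "?T \<in> elem_transvections bar lam Lam n"
    unfolding elem_transvections_def using ij' by blast
  then have T: "?T \<in> carrier G" "act ?T = S i j x" "?T \<in> EU bar lam Lam n"
    using T_short_G[OF ij'] act_T_short[OF ij', of "mu j * x"]
    by (auto simp: EU_def intro: generate.incl)
  show "\<exists>A \<in> EU bar lam Lam n \<inter> carrier G. act A = S i j x \<circ> g"
    using A T by (intro bexI[of _ "?T * A"]) (auto simp: act_mult G_M EU_closed G_closed)
next
  fix g i z
  assume "\<exists>A \<in> EU bar lam Lam n \<inter> carrier G. act A = g" and i: "i \<in> Om" and z: "z \<in> Lam"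
  then obtain A where A: "A \<in> EU bar lam Lam n" "A \<in> carrier G" "act A = g" by auto
  let ?T = "T_long n i (lam_pow bar lam (- ((eps n i + 1) div 2)) * z)"
  have "?T \<in> elem_transvections bar lam Lam n"
    unfolding elem_transvections_def using i z by blast
  then have T: "?T \<in> carrier G" "act ?T = L i z" "?T \<in> EU bar lam Lam n"
    using T_long_G[OF i] act_T_long[OF i]
    by (auto simp: EU_def intro: generate.incl)
  show "\<exists>A \<in> EU bar lam Lam n \<inter> carrier G. act A = L i z \<circ> g"
    using A T by (intro bexI[of _ "?T * A"]) (auto simp: act_mult G_M EU_closed G_closed)
qed

text \<open>Invertibility of the product is carried through the induction, since multiplicativity of
  \<open>act\<close> is applied to matrices in the carrier.\<close>

lemma conj_prod_list:
  assumes \<sigma>: "\<sigma> \<in> carrier G" and P: "conj_prod (act \<sigma>) c k"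
  shows "\<exists>xs. length xs = c \<and> set xs \<subseteq> elem_conjugates bar lam Lam n \<sigma> \<and>
    foldr (\<lambda>x y. x \<otimes>\<^bsub>G\<^esub> y) xs \<one>\<^bsub>G\<^esub> \<in> carrier G \<and> act (foldr (\<lambda>x y. x \<otimes>\<^bsub>G\<^esub> y) xs \<one>\<^bsub>G\<^esub>) = k"
  using P
proof (rule conj_prod.induct)
  show "\<exists>xs. length xs = 0 \<and> set xs \<subseteq> elem_conjugates bar lam Lam n \<sigma> \<and>
    foldr (\<lambda>x y. x \<otimes>\<^bsub>G\<^esub> y) xs \<one>\<^bsub>G\<^esub> \<in> carrier G \<and> act (foldr (\<lambda>x y. x \<otimes>\<^bsub>G\<^esub> y) xs \<one>\<^bsub>G\<^esub>) = id"
    using monoid.one_closed[OF group.is_monoid[OF group_G]] by (auto simp: act_one)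
next
  fix m k g t
  assume "\<exists>xs. length xs = m \<and> set xs \<subseteq> elem_conjugates bar lam Lam n \<sigma> \<and>
    foldr (\<lambda>x y. x \<otimes>\<^bsub>G\<^esub> y) xs \<one>\<^bsub>G\<^esub> \<in> carrier G \<and> act (foldr (\<lambda>x y. x \<otimes>\<^bsub>G\<^esub> y) xs \<one>\<^bsub>G\<^esub>) = k"
    and g: "g \<in> elementary" and t: "t = act \<sigma> \<or> t = ginv (act \<sigma>)"
  then obtain xs where xs: "length xs = m" "set xs \<subseteq> elem_conjugates bar lam Lam n \<sigma>"
    "foldr (\<lambda>x y. x \<otimes>\<^bsub>G\<^esub> y) xs \<one>\<^bsub>G\<^esub> \<in> carrier G" "act (foldr (\<lambda>x y. x \<otimes>\<^bsub>G\<^esub> y) xs \<one>\<^bsub>G\<^esub>) = k"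
    by blast
  obtain A where A: "A \<in> EU bar lam Lam n" "A \<in> carrier G" "act A = g" using elementary_EU[OF g] by auto
  obtain B where B: "B = \<sigma> \<or> B = inv\<^bsub>G\<^esub> \<sigma>" "B \<in> carrier G" "act B = t"
    using t \<sigma> G_inv[OF \<sigma>] by auto
  let ?C = "conjugate_by G A B"
  have C: "?C \<in> carrier G" "act ?C = conjg g t" "?C \<in> elem_conjugates bar lam Lam n \<sigma>"
    using A B G_inv[OF A(2)]
    by (auto simp: conjugate_by_def elem_conjugates_def act_mult G_M G_closed comp_assoc)
  show "\<exists>xs. length xs = Suc m \<and> set xs \<subseteq> elem_conjugates bar lam Lam n \<sigma> \<and>
    foldr (\<lambda>x y. x \<otimes>\<^bsub>G\<^esub> y) xs \<one>\<^bsub>G\<^esub> \<in> carrier G \<and>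
    act (foldr (\<lambda>x y. x \<otimes>\<^bsub>G\<^esub> y) xs \<one>\<^bsub>G\<^esub>) = conjg g t \<circ> k"
    using xs C by (intro exI[of _ "?C # xs"]) (auto simp: act_mult G_M G_closed)
qed

lemma conj_prod_product:
  assumes "\<sigma> \<in> carrier G" "A \<in> carrier G" "conj_prod (act \<sigma>) c (act A)"
  shows "product_of_conjugates bar lam Lam n \<sigma> c A"
  using conj_prod_list[OF assms(1,3)] act_inj[OF G_M G_M] assms(2) unfolding is_product_of_def by metis

end

section \<open>The five counts for matrices\<close>

theorem theorem49:
  fixes bar :: "'a::comm_ring_1 \<Rightarrow> 'a" and lam :: 'a and Lam :: "'a set"
    and n :: nat and \<sigma> :: "'a mat" and i j k l :: int
  assumes "n \<ge> 3"
    and "form_ring bar lam Lam"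
    and "\<sigma> \<in> U bar lam Lam n"
    and "i \<in> Omega n" and "j \<in> Omega n" and "k \<in> Omega n" and "l \<in> Omega n"
    and "k \<noteq> l" and "k \<noteq> - l" and "i \<noteq> j" and "i \<noteq> - j"
  shows
    "product_of_conjugates bar lam Lam n \<sigma> 160
       (T_short bar lam n k l (entry n \<sigma> i j)) \<and>
     product_of_conjugates bar lam Lam n \<sigma> 320
       (T_short bar lam n k l (entry n \<sigma> i (- i))) \<and>
     product_of_conjugates bar lam Lam n \<sigma> 480
       (T_short bar lam n k l (entry n \<sigma> i i - entry n \<sigma> j j)) \<and>
     product_of_conjugates bar lam Lam n \<sigma> 960
       (T_short bar lam n k l (entry n \<sigma> i i - entry n \<sigma> (- i) (- i))) \<and>
     product_of_conjugates bar lam Lam n \<sigma> (1600 * n + 4004)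
       (T_long n k (lam_pow bar lam (- ((eps n k + 1) div 2)) *
          vec_value bar n (column n \<sigma> j)))"
proof -
  interpret R: commutative_form_ring bar lam Lam n
    using assms by (simp add: commutative_form_ring_def commutative_form_ring_axioms_def)
  note u = R.U_unitary(1)[OF assms(3)] and G = R.U_unitary(2)[OF assms(3)]
  have short: "product_of_conjugates bar lam Lam n \<sigma> c (T_short bar lam n k l x)"
    if "R.good (R.act \<sigma>) c x" for c x
  proof -
    \<comment> \<open>\<open>good\<close> covers all multiples, in particular the one by the unit
      that separates \<open>S\<close> from \<open>T_short\<close>.\<close>
    have "R.conj_prod (R.act \<sigma>) c (R.S k (- l) (x * bar (R.mu (- l))))"
      using assms by (intro R.goodD[OF that]) auto
    also have "R.S k (- l) (x * bar (R.mu (- l))) = R.act (T_short bar lam n k l x)"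
      unfolding R.act_T_short[OF assms(6-9)] by (simp only: mult.commute)
    finally show ?thesis
      by (rule R.conj_prod_product[OF G R.T_short_G[OF assms(6-9)]])
  qed
  obtain m where m: "m \<in> Omega n" "m > 0" "m \<noteq> j" "m \<noteq> - j"
    using R.third_index[of j j] by metis
  obtain p where p: "p \<in> Omega n" "p > 0" "p \<noteq> m" "p \<noteq> - m" "p \<noteq> j" "p \<noteq> - j"
    using R.third_index[of m j] by metis
  let ?v = "vec_value bar n (column n \<sigma> j)"
  have v: "?v = R.f (R.act \<sigma> (R.ev j)) (R.act \<sigma> (R.ev j))"
    using assms G by (simp add: vec_value_def R.column_vec_of R.G_M R.f_form_vec_of)
  have "R.conj_prod (R.act \<sigma>) (1440 * n + 4404) (R.L k ?v)"
    unfolding v using R.conj_prod_value[OF u assms(5) m p] m(1) assms(6) by (rule R.move_L)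
  \<comment> \<open>The surplus 160 n - 400 is even, and it is positive for n \<ge> 3, so it can be
    filled by pairs of \<sigma> and its inverse.\<close>
  moreover have "1440 * n + 4404 \<le> 1600 * n + 4004"
    using assms(1) by simp
  moreover have "1600 * n + 4004 - (1440 * n + 4404) = 2 * (80 * n - 200)"
    using assms(1) by simp
  then have "even (1600 * n + 4004 - (1440 * n + 4404))" by (simp only: dvd_triv_left)
  ultimately have "R.conj_prod (R.act \<sigma>) (1600 * n + 4004) (R.L k ?v)"
    by (rule R.conj_prod_mono[OF u])
  then have "R.conj_prod (R.act \<sigma>) (1600 * n + 4004)
      (R.act (T_long n k (lam_pow bar lam (- ((eps n k + 1) div 2)) * ?v)))"
    unfolding R.act_T_long[OF assms(6)] .
  then have long: "product_of_conjugates bar lam Lam n \<sigma> (1600 * n + 4004)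
      (T_long n k (lam_pow bar lam (- ((eps n k + 1) div 2)) * ?v))"
    by (rule R.conj_prod_product[OF G R.T_long_G[OF assms(6)]])
  have e: "entry n \<sigma> a b = R.act \<sigma> (R.ev b) a" if "a \<in> Omega n" "b \<in> Omega n" for a b
    using that by (simp add: R.act_ev)
  show ?thesis
    using assms long R.good_entry[OF u assms(5,4,10,11)] R.good_entry_opp[OF u assms(4)]
      R.good_diag_diff[OF u assms(4,5)] R.good_diag_diff_opp[OF u assms(4)]
    by (intro conjI short) (simp_all add: e)
qed

end
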